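(* Let $L_N$ and $L_M$ be Dirac structures on manifolds $N$ and $M$, and let $\psi:(N,L_N)\to(M,L_M)$ be a backward Dirac map. Suppose that $r_N\in\Omega^1(N,TN)$ and $r_M\in\Omega^1(M,TM)$ are $\psi$-related. If $L_M$ is compatible with $r_M$, then $L_N$ is compatible with $r_N$.
   Context: $\mathbb{T}M=TM\oplus T^*M$ carries the pairing $\langle(X,\alpha),(Y,\beta)\rangle=\beta(X)+\alpha(Y)$ and the Courant-Dorfman bracket $[\![(X,\alpha),(Y,\beta)]\!]=([X,Y],\mathcal{L}_X\beta-i_Yd\alpha)$. A Dirac structure is a subbundle $L\subset\mathbb{T}M$ with $L=L^\perp$ whose sections are closed under the bracket. For $r\in\Omega^1(M,TM)$, viewed as $r:TM\to TM$ with dual $r^*$, set $D^r_X(Y)=[Y,r(X)]-r([Y,X])$, $D^{r,*}_X(\alpha)=\mathcal{L}_X(r^*\alpha)-\mathcal{L}_{r(X)}\alpha$, $\mathbb{D}^r_X(Y,\alpha)=(D^r_X(Y),D^{r,*}_X(\alpha))$. $L$ and $r$ are compatible if $(r,r^* )(L)\subseteq L$ and $\mathbb{D}^r_X(\Gamma(L))\subseteq\Gamma(L)$ for all $X\in\mathfrak{X}(M)$. A smooth map $\psi:N\to M$ is a backward Dirac map if for all $x\in N$, $(L_N)_x=\{(X,(T_x\psi)^*\beta)\in\mathbb{T}_xN: (T_x\psi(X),\beta)\in(L_M)_{\psi(x)}\}$. $r_N$ and $r_M$ are $\psi$-related if $r_M\circ d\psi=d\psi\circ r_N$. *)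

theory Defs
  imports "HOL-Analysis.Analysis" "HOL-Library.Function_Algebras"
begin

section \<open>Pointwise vector space structure on functions\<close>

instantiation "fun" :: (type, real_vector) real_vector
begin

definition scaleR_fun :: "real \<Rightarrow> ('a \<Rightarrow> 'b) \<Rightarrow> 'a \<Rightarrow> 'b"
  where "scaleR_fun r f = (\<lambda>x. r *\<^sub>R f x)"

instance
  by standard (auto simp: scaleR_fun_def fun_eq_iff scaleR_add_right scaleR_add_left)

end


section \<open>Smooth functions on open subsets of finite-dimensional spaces\<close>

text \<open>
  Used only when \<open>S\<close> is open and the domain is finite-dimensional, where continuity of all
  iterated directional derivatives is the usual notion of a \<open>C\<^sup>k\<close> function.
\<close>

primrec Ck_on :: "nat \<Rightarrow> 'a::real_normed_vector set \<Rightarrow> ('a \<Rightarrow> 'b::real_normed_vector) \<Rightarrow> bool" where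
  "Ck_on 0 S f \<longleftrightarrow> continuous_on S f"
| "Ck_on (Suc k) S f \<longleftrightarrow>
     (\<forall>x\<in>S. f differentiable (at x)) \<and> (\<forall>v. Ck_on k S (\<lambda>x. frechet_derivative f (at x) v))"

definition smooth_on :: "'a::real_normed_vector set \<Rightarrow> ('a \<Rightarrow> 'b::real_normed_vector) \<Rightarrow> bool"
  where "smooth_on S f \<longleftrightarrow> (\<forall>k. Ck_on k S f)"


section \<open>Smooth manifolds\<close>

text \<open>
  The points of a manifold form a Hausdorff second countable type \<open>'a\<close>. The model space is a
  finite-dimensional inner product space rather than a type of class \<open>euclidean_space\<close>, because
  that class excludes dimension 0. A chart is a domain together with a map that is meaningful only
  on this domain.
\<close>

type_synonym ('a, 'e) chart = "'a set \<times> ('a \<Rightarrow> 'e)"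

abbreviation chart_inv :: "('a, 'e) chart \<Rightarrow> 'e \<Rightarrow> 'a"
  where "chart_inv c \<equiv> inv_into (fst c) (snd c)"

definition smooth_atlas ::
    "('a::{t2_space, second_countable_topology}, 'e::real_inner) chart set \<Rightarrow> bool"
  where "smooth_atlas A \<longleftrightarrow>
    (\<exists>B::'e set. finite B \<and> span B = UNIV) \<and>
    (\<Union>c\<in>A. fst c) = UNIV \<and>
    (\<forall>c\<in>A. open (fst c) \<and> open (snd c ` fst c) \<and>
       homeomorphism (fst c) (snd c ` fst c) (snd c) (chart_inv c)) \<and>
    (\<forall>c\<in>A. \<forall>d\<in>A. smooth_on (snd c ` (fst c \<inter> fst d)) (snd d \<circ> chart_inv c))"

definition charts_at :: "('a, 'e) chart set \<Rightarrow> 'a \<Rightarrow> ('a, 'e) chart set"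
  where "charts_at A p = {c \<in> A. p \<in> fst c}"

definition some_chart_at :: "('a, 'e) chart set \<Rightarrow> 'a \<Rightarrow> ('a, 'e) chart"
  where "some_chart_at A p = (SOME c. c \<in> charts_at A p)"


section \<open>Tangent and cotangent spaces\<close>

text \<open>
  A tangent vector at \<open>p\<close> is the family of its components in all charts around \<open>p\<close>, subject to
  the usual transformation law; components in all other charts are set to 0.
  A covector at \<open>p\<close> is a linear functional on the tangent space at \<open>p\<close>, set to 0 off that space.
\<close>

type_synonym ('a, 'e) tangent = "('a, 'e) chart \<Rightarrow> 'e"
type_synonym ('a, 'e) covector = "('a, 'e) tangent \<Rightarrow> real"

definition tangent_space ::
    "('a, 'e::real_inner) chart set \<Rightarrow> 'a \<Rightarrow> ('a, 'e) tangent set"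
  where "tangent_space A p = {v.
    (\<forall>c. c \<notin> charts_at A p \<longrightarrow> v c = 0) \<and>
    (\<forall>c\<in>charts_at A p. \<forall>d\<in>charts_at A p.
       v d = frechet_derivative (snd d \<circ> chart_inv c) (at (snd c p)) (v c))}"

text \<open>The tangent vector at \<open>p\<close> whose component in the chart \<open>c\<close> is \<open>w\<close>.\<close>

definition tangent_of ::
    "('a, 'e::real_inner) chart set \<Rightarrow> ('a, 'e) chart \<Rightarrow> 'a \<Rightarrow> 'e \<Rightarrow> ('a, 'e) tangent"
  where "tangent_of A c p w = (\<lambda>d. if d \<in> charts_at A p
    then frechet_derivative (snd d \<circ> chart_inv c) (at (snd c p)) w else 0)"

definition linear_on_set :: "'v::real_vector set \<Rightarrow> ('v \<Rightarrow> 'w::real_vector) \<Rightarrow> bool"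
  where "linear_on_set V f \<longleftrightarrow>
    (\<forall>x\<in>V. \<forall>y\<in>V. f (x + y) = f x + f y) \<and> (\<forall>a. \<forall>x\<in>V. f (a *\<^sub>R x) = a *\<^sub>R f x)"

definition cotangent_space ::
    "('a, 'e::real_inner) chart set \<Rightarrow> 'a \<Rightarrow> ('a, 'e) covector set"
  where "cotangent_space A p = {\<alpha>.
    linear_on_set (tangent_space A p) \<alpha> \<and> (\<forall>v. v \<notin> tangent_space A p \<longrightarrow> \<alpha> v = 0)}"

definition restrict0 :: "'v set \<Rightarrow> ('v \<Rightarrow> 'w::zero) \<Rightarrow> 'v \<Rightarrow> 'w"
  where "restrict0 V f = (\<lambda>v. if v \<in> V then f v else 0)"


section \<open>Vector fields, 1-forms and the Cartan calculus\<close>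

type_synonym ('a, 'e) vfield = "'a \<Rightarrow> ('a, 'e) tangent"
type_synonym ('a, 'e) oneform = "'a \<Rightarrow> ('a, 'e) covector"

definition vfield_comp ::
    "('a, 'e) vfield \<Rightarrow> ('a, 'e) chart \<Rightarrow> 'e \<Rightarrow> 'e"
  where "vfield_comp X c = (\<lambda>y. X (chart_inv c y) c)"

definition oneform_comp ::
    "('a, 'e::real_inner) chart set \<Rightarrow> ('a, 'e) oneform \<Rightarrow> ('a, 'e) chart \<Rightarrow> 'e \<Rightarrow> 'e \<Rightarrow> real"
  where "oneform_comp A \<alpha> c w = (\<lambda>y. \<alpha> (chart_inv c y) (tangent_of A c (chart_inv c y) w))"

definition vfields_on ::
    "('a, 'e::real_inner) chart set \<Rightarrow> 'a set \<Rightarrow> ('a, 'e) vfield set"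
  where "vfields_on A U = {X. (\<forall>p\<in>U. X p \<in> tangent_space A p) \<and>
    (\<forall>c\<in>A. smooth_on (snd c ` (fst c \<inter> U)) (vfield_comp X c))}"

definition oneforms_on ::
    "('a, 'e::real_inner) chart set \<Rightarrow> 'a set \<Rightarrow> ('a, 'e) oneform set"
  where "oneforms_on A U = {\<alpha>. (\<forall>p\<in>U. \<alpha> p \<in> cotangent_space A p) \<and>
    (\<forall>c\<in>A. \<forall>w. smooth_on (snd c ` (fst c \<inter> U)) (oneform_comp A \<alpha> c w))}"

definition lie_bracket ::
    "('a, 'e::real_inner) chart set \<Rightarrow> ('a, 'e) vfield \<Rightarrow> ('a, 'e) vfield \<Rightarrow> ('a, 'e) vfield"
  where "lie_bracket A X Y = (\<lambda>p c. if c \<in> charts_at A p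
    then frechet_derivative (vfield_comp Y c) (at (snd c p)) (X p c)
       - frechet_derivative (vfield_comp X c) (at (snd c p)) (Y p c)
    else 0)"

text \<open>
  The next two definitions are evaluated in an arbitrarily chosen chart around the point; the
  values do not depend on this choice.
\<close>

definition differential ::
    "('a, 'e::real_inner) chart set \<Rightarrow> ('a \<Rightarrow> real) \<Rightarrow> ('a, 'e) oneform"
  where "differential A f = (\<lambda>p. restrict0 (tangent_space A p) (\<lambda>v.
    let c = some_chart_at A p in frechet_derivative (f \<circ> chart_inv c) (at (snd c p)) (v c)))"

definition ext_deriv ::
    "('a, 'e::real_inner) chart set \<Rightarrow> ('a, 'e) oneform \<Rightarrow>
      'a \<Rightarrow> ('a, 'e) tangent \<Rightarrow> ('a, 'e) tangent \<Rightarrow> real"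
  where "ext_deriv A \<alpha> p v w = (let c = some_chart_at A p in
      frechet_derivative (oneform_comp A \<alpha> c (w c)) (at (snd c p)) (v c)
    - frechet_derivative (oneform_comp A \<alpha> c (v c)) (at (snd c p)) (w c))"

definition interior_ext_deriv ::
    "('a, 'e::real_inner) chart set \<Rightarrow> ('a, 'e) vfield \<Rightarrow> ('a, 'e) oneform \<Rightarrow> ('a, 'e) oneform"
  where "interior_ext_deriv A X \<alpha> = (\<lambda>p. restrict0 (tangent_space A p) (ext_deriv A \<alpha> p (X p)))"

text \<open>Cartan's formula \<open>L\<^sub>X \<alpha> = i\<^sub>X d\<alpha> + d(\<alpha>(X))\<close>.\<close>

definition lie_deriv ::
    "('a, 'e::real_inner) chart set \<Rightarrow> ('a, 'e) vfield \<Rightarrow> ('a, 'e) oneform \<Rightarrow> ('a, 'e) oneform"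
  where "lie_deriv A X \<alpha> = interior_ext_deriv A X \<alpha> + differential A (\<lambda>p. \<alpha> p (X p))"


section \<open>Dirac structures\<close>

type_synonym ('a, 'e) gvector = "('a, 'e) tangent \<times> ('a, 'e) covector"

definition gtangent_space ::
    "('a, 'e::real_inner) chart set \<Rightarrow> 'a \<Rightarrow> ('a, 'e) gvector set"
  where "gtangent_space A p = tangent_space A p \<times> cotangent_space A p"

definition pairing :: "('a, 'e) gvector \<Rightarrow> ('a, 'e) gvector \<Rightarrow> real"
  where "pairing a b = snd b (fst a) + snd a (fst b)"

definition sections_on ::
    "('a, 'e::real_inner) chart set \<Rightarrow> 'a set \<Rightarrow> ('a \<Rightarrow> ('a, 'e) gvector set) \<Rightarrow>
      ('a \<Rightarrow> ('a, 'e) gvector) set"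
  where "sections_on A U L = {s. (\<forall>p\<in>U. s p \<in> L p) \<and>
    (\<lambda>p. fst (s p)) \<in> vfields_on A U \<and> (\<lambda>p. snd (s p)) \<in> oneforms_on A U}"

abbreviation sections ::
    "('a, 'e::real_inner) chart set \<Rightarrow> ('a \<Rightarrow> ('a, 'e) gvector set) \<Rightarrow>
      ('a \<Rightarrow> ('a, 'e) gvector) set"
  where "sections A L \<equiv> sections_on A UNIV L"

definition courant_bracket ::
    "('a, 'e::real_inner) chart set \<Rightarrow> ('a \<Rightarrow> ('a, 'e) gvector) \<Rightarrow> ('a \<Rightarrow> ('a, 'e) gvector) \<Rightarrow>
      'a \<Rightarrow> ('a, 'e) gvector"
  where "courant_bracket A s t =
    (let X = \<lambda>p. fst (s p); \<alpha> = \<lambda>p. snd (s p); Y = \<lambda>p. fst (t p); \<beta> = \<lambda>p. snd (t p)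
     in (\<lambda>p. (lie_bracket A X Y p, (lie_deriv A X \<beta> - interior_ext_deriv A Y \<alpha>) p)))"

text \<open>A smooth subbundle of the generalized tangent bundle, via local frames.\<close>

definition subbundle ::
    "('a::topological_space, 'e::real_inner) chart set \<Rightarrow> ('a \<Rightarrow> ('a, 'e) gvector set) \<Rightarrow> bool"
  where "subbundle A L \<longleftrightarrow>
    (\<forall>p. L p \<subseteq> gtangent_space A p) \<and>
    (\<forall>p. \<exists>U k e. open U \<and> p \<in> U \<and> (\<forall>i<k. e i \<in> sections_on A U L) \<and>
       (\<forall>q\<in>U. inj_on (\<lambda>i::nat. e i q) {..<k} \<and> independent ((\<lambda>i. e i q) ` {..<k}) \<and>
          span ((\<lambda>i. e i q) ` {..<k}) = L q))"

definition dirac_structure ::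
    "('a::topological_space, 'e::real_inner) chart set \<Rightarrow> ('a \<Rightarrow> ('a, 'e) gvector set) \<Rightarrow> bool"
  where "dirac_structure A L \<longleftrightarrow>
    subbundle A L \<and>
    (\<forall>p. L p = {a \<in> gtangent_space A p. \<forall>b\<in>L p. pairing a b = 0}) \<and>
    (\<forall>s\<in>sections A L. \<forall>t\<in>sections A L. courant_bracket A s t \<in> sections A L)"


section \<open>Tangent-valued 1-forms and compatibility\<close>

type_synonym ('a, 'e) tensor11 = "'a \<Rightarrow> ('a, 'e) tangent \<Rightarrow> ('a, 'e) tangent"

definition vector_valued_oneforms ::
    "('a, 'e::real_inner) chart set \<Rightarrow> ('a, 'e) tensor11 set"
  where "vector_valued_oneforms A = {r.
    (\<forall>p. r p ` tangent_space A p \<subseteq> tangent_space A p \<and> linear_on_set (tangent_space A p) (r p)) \<and>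
    (\<forall>c\<in>A. \<forall>w. smooth_on (snd c ` fst c)
       (\<lambda>y. r (chart_inv c y) (tangent_of A c (chart_inv c y) w) c))}"

definition app_vfield :: "('a, 'e) tensor11 \<Rightarrow> ('a, 'e) vfield \<Rightarrow> ('a, 'e) vfield"
  where "app_vfield r X = (\<lambda>p. r p (X p))"

definition dual_map ::
    "('a, 'e::real_inner) chart set \<Rightarrow> ('a, 'e) tensor11 \<Rightarrow> 'a \<Rightarrow>
      ('a, 'e) covector \<Rightarrow> ('a, 'e) covector"
  where "dual_map A r p \<alpha> = restrict0 (tangent_space A p) (\<lambda>v. \<alpha> (r p v))"

definition D_op ::
    "('a, 'e::real_inner) chart set \<Rightarrow> ('a, 'e) tensor11 \<Rightarrow> ('a, 'e) vfield \<Rightarrow>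
      ('a, 'e) vfield \<Rightarrow> ('a, 'e) vfield"
  where "D_op A r X Y = lie_bracket A Y (app_vfield r X) - app_vfield r (lie_bracket A Y X)"

definition D_op_dual ::
    "('a, 'e::real_inner) chart set \<Rightarrow> ('a, 'e) tensor11 \<Rightarrow> ('a, 'e) vfield \<Rightarrow>
      ('a, 'e) oneform \<Rightarrow> ('a, 'e) oneform"
  where "D_op_dual A r X \<alpha> =
    lie_deriv A X (\<lambda>p. dual_map A r p (\<alpha> p)) - lie_deriv A (app_vfield r X) \<alpha>"

definition DD_op ::
    "('a, 'e::real_inner) chart set \<Rightarrow> ('a, 'e) tensor11 \<Rightarrow> ('a, 'e) vfield \<Rightarrow>
      ('a \<Rightarrow> ('a, 'e) gvector) \<Rightarrow> 'a \<Rightarrow> ('a, 'e) gvector"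
  where "DD_op A r X s =
    (\<lambda>p. (D_op A r X (\<lambda>q. fst (s q)) p, D_op_dual A r X (\<lambda>q. snd (s q)) p))"

definition compatible ::
    "('a, 'e::real_inner) chart set \<Rightarrow> ('a \<Rightarrow> ('a, 'e) gvector set) \<Rightarrow> ('a, 'e) tensor11 \<Rightarrow> bool"
  where "compatible A L r \<longleftrightarrow>
    (\<forall>p. \<forall>(v, \<alpha>)\<in>L p. (r p v, dual_map A r p \<alpha>) \<in> L p) \<and>
    (\<forall>X\<in>vfields_on A UNIV. \<forall>s\<in>sections A L. DD_op A r X s \<in> sections A L)"


section \<open>Smooth maps and backward Dirac maps\<close>

definition smooth_map ::
    "('a::topological_space, 'd::real_inner) chart set \<Rightarrow>
     ('b::topological_space, 'e::real_inner) chart set \<Rightarrow> ('a \<Rightarrow> 'b) \<Rightarrow> bool"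
  where "smooth_map A B \<psi> \<longleftrightarrow> continuous_on UNIV \<psi> \<and>
    (\<forall>c\<in>A. \<forall>d\<in>B. smooth_on (snd c ` (fst c \<inter> \<psi> -` fst d)) (snd d \<circ> \<psi> \<circ> chart_inv c))"

text \<open>As above, independent of the chart chosen around \<open>x\<close>.\<close>

definition tangent_map ::
    "('a, 'd::real_inner) chart set \<Rightarrow> ('b, 'e::real_inner) chart set \<Rightarrow> ('a \<Rightarrow> 'b) \<Rightarrow> 'a \<Rightarrow>
      ('a, 'd) tangent \<Rightarrow> ('b, 'e) tangent"
  where "tangent_map A B \<psi> x v = (let c = some_chart_at A x in
    (\<lambda>d. if d \<in> charts_at B (\<psi> x)
         then frechet_derivative (snd d \<circ> \<psi> \<circ> chart_inv c) (at (snd c x)) (v c) else 0))"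

definition cotangent_map ::
    "('a, 'd::real_inner) chart set \<Rightarrow> ('b, 'e::real_inner) chart set \<Rightarrow> ('a \<Rightarrow> 'b) \<Rightarrow> 'a \<Rightarrow>
      ('b, 'e) covector \<Rightarrow> ('a, 'd) covector"
  where "cotangent_map A B \<psi> x \<beta> = restrict0 (tangent_space A x) (\<lambda>v. \<beta> (tangent_map A B \<psi> x v))"

definition backward_dirac_map ::
    "('a::topological_space, 'd::real_inner) chart set \<Rightarrow> ('a \<Rightarrow> ('a, 'd) gvector set) \<Rightarrow>
     ('b::topological_space, 'e::real_inner) chart set \<Rightarrow> ('b \<Rightarrow> ('b, 'e) gvector set) \<Rightarrow>
     ('a \<Rightarrow> 'b) \<Rightarrow> bool"
  where "backward_dirac_map A L\<^sub>N B L\<^sub>M \<psi> \<longleftrightarrow> smooth_map A B \<psi> \<and>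
    (\<forall>x. L\<^sub>N x = {(v, cotangent_map A B \<psi> x \<beta>) | v \<beta>.
       v \<in> tangent_space A x \<and> \<beta> \<in> cotangent_space B (\<psi> x) \<and>
       (tangent_map A B \<psi> x v, \<beta>) \<in> L\<^sub>M (\<psi> x)})"

definition related_by ::
    "('a, 'd::real_inner) chart set \<Rightarrow> ('b, 'e::real_inner) chart set \<Rightarrow> ('a \<Rightarrow> 'b) \<Rightarrow>
      ('a, 'd) tensor11 \<Rightarrow> ('b, 'e) tensor11 \<Rightarrow> bool"
  where "related_by A B \<psi> r\<^sub>N r\<^sub>M \<longleftrightarrow> (\<forall>x. \<forall>v\<in>tangent_space A x.
    r\<^sub>M (\<psi> x) (tangent_map A B \<psi> x v) = tangent_map A B \<psi> x (r\<^sub>N x v))"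

end

theory Submission
  imports Defs
begin

text \<open>
  Write \<open>F\<^sub>N(X; a, b)\<close> for the pairing of \<open>D\<^sub>X a\<close> with \<open>b\<close>, where \<open>a, b\<close> are sections of \<open>L\<^sub>N\<close>; since \<open>L\<^sub>N\<close>
  is its own orthogonal, the claim is that \<open>F\<^sub>N\<close> vanishes. At points where a section of \<open>L\<^sub>N\<close> lifts
  differentiably to a combination \<open>\<Sum> g\<^sub>i (e\<^sub>i \<circ> \<psi>)\<close> of sections \<open>e\<^sub>i\<close> of \<open>L\<^sub>M\<close> along \<open>\<psi>\<close>, a computation in charts
  (in which the second derivatives of \<open>\<psi>\<close> cancel) gives \<open>F\<^sub>N = \<Sum> g\<^sub>i F\<^sub>M(T\<psi> X; e\<^sub>i, b)\<close>, up to terms in the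
  derivatives of the \<open>g\<^sub>i\<close> that vanish because \<open>(r\<^sub>M, r\<^sub>M\<^sup>*)\<close> preserves the isotropic \<open>L\<^sub>M\<close>. Pointwise lifts need
  not depend continuously on the point, but Gaussian elimination produces differentiable ones over
  a dense open set, and \<open>F\<^sub>N\<close> vanishes everywhere by continuity. Bump functions supply enough global
  vector fields and global sections of \<open>L\<^sub>M\<close> to exploit the compatibility on \<open>M\<close>.
\<close>

section \<open>Calculus on finite-dimensional inner product spaces\<close>

text \<open>The obstacle is the regularity of lifts. The fibre of \<open>L\<^sub>N\<close> at x
  comes from the part of \<open>L\<^sub>M\<close> at \<psi> x whose vector component lies in the
  image of T\<psi>. The dimension of this part can jump with the rank of T\<psi>, so a smooth
  section of \<open>L\<^sub>N\<close> is not guaranteed a smooth lift. A dense set and merely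
  differentiable lifts suffice because of the shape of \<open>F\<^sub>N\<close>: the derivatives of
  X cancel, b enters through its value only, and a enters through its value and first derivatives.
  Hence X and b are transported at a single point, and the lift of a is differentiated once. Second
  derivatives of \<psi> appear because T\<psi> is itself differentiated, both in the lifting
  identity and in the relation between the two tensors. They occur in pairs that symmetry of second
  derivatives makes opposite. The model spaces are known only through a finite spanning set. Linear
  dependence on a varying vector is therefore always reduced to finitely many fixed vectors by an
  orthonormal expansion.\<close>

definition fin_dim :: "'e::real_inner itself \<Rightarrow> bool"
  where "fin_dim _ \<longleftrightarrow> (\<exists>B::'e set. finite B \<and> span B = UNIV)"

text \<open>An orthogonal spanning set, normalised after dropping 0, is orthonormal; both sides
  being linear in x, it is enough to check the spanning vectors. Later the expansion replaces a
  varying vector argument by fixed vectors with scalar coefficients.\<close>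

lemma fin_dim_expansion:
  assumes "fin_dim TYPE('e::real_inner)"
  obtains B :: "'e::real_inner set" where "finite B" and "\<And>x. (\<Sum>b\<in>B. (x \<bullet> b) *\<^sub>R b) = x"
proof -
  obtain B0 :: "'e set" where B0: "finite B0" "span B0 = UNIV"
    using assms by (auto simp: fin_dim_def)
  obtain C :: "'e set" where C: "finite C" "span C = UNIV" "pairwise orthogonal C"
    using basis_orthogonal[OF B0(1)] B0(2) by auto
  define n where "n = (\<lambda>c::'e. (1 / norm c) *\<^sub>R c)"
  define B where "B = n ` (C - {0})"
  \<comment> \<open>Distinct vectors of \<open>C\<close> are orthogonal, whereas equal
    normalisations have inner product 1. Injectivity lets the sum over \<open>B\<close> be rewritten
    as a sum over \<open>C - {0}\<close>.\<close>
  have inj: "inj_on n (C - {0})"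
  proof (rule inj_onI)
    fix c d assume cd: "c \<in> C - {0}" "d \<in> C - {0}" "n c = n d"
    have "c = d" if "c \<bullet> d \<noteq> 0"
      using C(3) cd that by (auto simp: pairwise_def orthogonal_def)
    moreover have "n c \<bullet> n c = 1"
      using cd(1) by (simp add: n_def power2_norm_eq_inner[symmetric] power2_eq_square)
    then have "n c \<bullet> n d \<noteq> 0" using cd(3) by simp
    then have "c \<bullet> d \<noteq> 0" by (auto simp: n_def)
    ultimately show "c = d" by blast
  qed
  have key: "(\<Sum>b\<in>B. (x \<bullet> b) *\<^sub>R b) = x" if "x \<in> span C" for x
    using that
  proof (induction rule: span_induct)
    case base
    show ?case by (auto simp: subspace_def inner_add_left scaleR_add_left sum.distrib
          scaleR_sum_right[symmetric] simp flip: scaleR_scaleR)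
  next
    case (step a)
    have "(\<Sum>b\<in>B. (a \<bullet> b) *\<^sub>R b) = (\<Sum>c\<in>C - {0}. (a \<bullet> n c) *\<^sub>R n c)"
      unfolding B_def by (simp add: sum.reindex[OF inj])
    also have "\<dots> = (\<Sum>c\<in>C - {0}. if c = a then a else 0)"
    proof (rule sum.cong[OF refl])
      fix c assume c: "c \<in> C - {0}"
      show "(a \<bullet> n c) *\<^sub>R n c = (if c = a then a else 0)"
      proof (cases "c = a")
        case True
        then show ?thesis using c
          by (simp add: n_def power2_norm_eq_inner[symmetric] power2_eq_square)
      next
        case False
        then have "a \<bullet> c = 0" using C(3) c step
          by (auto simp: pairwise_def orthogonal_def)
        then show ?thesis using False by (simp add: n_def)
      qed
    qed
    also have "\<dots> = a" using step C(1) by (cases "a = 0") auto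
    finally show ?case .
  qed
  show thesis
    by (rule that[of B]) (use C key in \<open>auto simp: B_def\<close>)
qed

lemma linear_expansion:
  assumes "\<And>x. (\<Sum>b\<in>B. (x \<bullet> b) *\<^sub>R b) = x" and "linear f"
  shows "f x = (\<Sum>b\<in>B. (x \<bullet> b) *\<^sub>R f b)"
  by (subst assms(1)[of x, symmetric]) (simp add: linear_sum[OF assms(2)] linear_cmul[OF assms(2)])

lemma has_derivative_frechet:
  "f differentiable (at x) \<Longrightarrow> (f has_derivative frechet_derivative f (at x)) (at x)"
  by (simp add: frechet_derivative_works)

lemma frechet_derivative_eq:
  "(f has_derivative f') (at x) \<Longrightarrow> frechet_derivative f (at x) = f'"
  by (rule frechet_derivative_at[symmetric])

lemma has_derivative_imp_differentiable:
  "(f has_derivative f') F \<Longrightarrow> f differentiable F"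
  by (auto simp: differentiable_def)

text \<open>\<open>frechet_derivative\<close> is a choice among all derivatives, and local agreement
  gives both functions the same candidates; so differentiability need not be known.\<close>

lemma frechet_derivative_cong_open:
  assumes "open S" "x \<in> S" "\<And>y. y \<in> S \<Longrightarrow> f y = g y"
  shows "frechet_derivative f (at x) = frechet_derivative g (at x)"
  unfolding frechet_derivative_def
  by (rule arg_cong[where f = Eps], rule ext, rule iffI;
      erule has_derivative_transform_within_open[OF _ assms(1,2)]) (simp_all add: assms(3))

text \<open>A product rule for a family of linear maps known only through the functions
  \<open>\<lambda>y. G y w\<close> with w fixed, the form in which tensors, 1-forms and derivatives
  of maps appear in charts. Expanding \<open>X y\<close> in an orthonormal family leaves a finite
  sum of products.\<close>

lemma has_derivative_linear_apply:
  fixes G :: "'x::real_normed_vector \<Rightarrow> 'e::real_inner \<Rightarrow> 'f::real_normed_vector"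
  assumes fd: "fin_dim TYPE('e)" and S: "open S" "y\<^sub>0 \<in> S"
    and lin: "\<And>y. y \<in> S \<Longrightarrow> linear (G y)"
    and G: "\<And>w. (\<lambda>y. G y w) differentiable (at y\<^sub>0)"
    and X: "(X has_derivative X') (at y\<^sub>0)"
  shows "((\<lambda>y. G y (X y)) has_derivative
    (\<lambda>h. frechet_derivative (\<lambda>y. G y (X y\<^sub>0)) (at y\<^sub>0) h + G y\<^sub>0 (X' h))) (at y\<^sub>0)"
proof -
  obtain B :: "'e set" where B: "finite B" "\<And>x. (\<Sum>b\<in>B. (x \<bullet> b) *\<^sub>R b) = x"
    using fin_dim_expansion[OF fd] by blast
  define G' where "G' = (\<lambda>b. frechet_derivative (\<lambda>y. G y b) (at y\<^sub>0))"
  have G': "((\<lambda>y. G y b) has_derivative G' b) (at y\<^sub>0)" for b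
    unfolding G'_def by (rule has_derivative_frechet[OF G])
  have expand: "frechet_derivative (\<lambda>y. G y w) (at y\<^sub>0) = (\<lambda>h. \<Sum>b\<in>B. (w \<bullet> b) *\<^sub>R G' b h)" for w
  proof (rule frechet_derivative_eq)
    have "((\<lambda>y. \<Sum>b\<in>B. (w \<bullet> b) *\<^sub>R G y b) has_derivative (\<lambda>h. \<Sum>b\<in>B. (w \<bullet> b) *\<^sub>R G' b h)) (at y\<^sub>0)"
      by (intro has_derivative_sum has_derivative_scaleR_right G')
    then show "((\<lambda>y. G y w) has_derivative (\<lambda>h. \<Sum>b\<in>B. (w \<bullet> b) *\<^sub>R G' b h)) (at y\<^sub>0)"
      by (rule has_derivative_transform_within_open[OF _ S])
        (simp add: linear_expansion[OF B(2) lin, of _ w])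
  qed
  have "((\<lambda>y. \<Sum>b\<in>B. (X y \<bullet> b) *\<^sub>R G y b) has_derivative
      (\<lambda>h. \<Sum>b\<in>B. (X y\<^sub>0 \<bullet> b) *\<^sub>R G' b h + (X' h \<bullet> b) *\<^sub>R G y\<^sub>0 b)) (at y\<^sub>0)"
    by (intro has_derivative_sum has_derivative_scaleR G' has_derivative_inner_left X)
  moreover have "(\<Sum>b\<in>B. (X y\<^sub>0 \<bullet> b) *\<^sub>R G' b h + (X' h \<bullet> b) *\<^sub>R G y\<^sub>0 b)
      = frechet_derivative (\<lambda>y. G y (X y\<^sub>0)) (at y\<^sub>0) h + G y\<^sub>0 (X' h)" for h
    unfolding expand by (simp add: linear_expansion[OF B(2) lin[OF S(2)], of "X' h"] sum.distrib)
  ultimately have "((\<lambda>y. \<Sum>b\<in>B. (X y \<bullet> b) *\<^sub>R G y b) has_derivative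
      (\<lambda>h. frechet_derivative (\<lambda>y. G y (X y\<^sub>0)) (at y\<^sub>0) h + G y\<^sub>0 (X' h))) (at y\<^sub>0)"
    by simp
  then show ?thesis
    by (rule has_derivative_transform_within_open[OF _ S])
      (simp add: linear_expansion[OF B(2) lin])
qed

text \<open>Differentiation in the base point commutes with linear combinations in the parameter.
  This makes coordinate expressions such as \<open>lie_deriv_comp\<close> covectors.\<close>

lemma linear_frechet_derivative_parameter:
  assumes S: "open S" "y \<in> S" and lin: "\<And>y. y \<in> S \<Longrightarrow> linear (G y)"
    and G: "\<And>w. (\<lambda>y. G y w) differentiable (at y)"
  shows "linear (\<lambda>w. frechet_derivative (\<lambda>y. G y w) (at y) h)"
proof (rule linearI)
  note G' = has_derivative_frechet[OF G]
  fix a b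
  have "((\<lambda>y. G y (a + b)) has_derivative
      (\<lambda>h. frechet_derivative (\<lambda>y. G y a) (at y) h + frechet_derivative (\<lambda>y. G y b) (at y) h)) (at y)"
    by (rule has_derivative_transform_within_open[OF has_derivative_add[OF G' G'] S])
      (simp add: linear_add[OF lin])
  then show "frechet_derivative (\<lambda>y. G y (a + b)) (at y) h
      = frechet_derivative (\<lambda>y. G y a) (at y) h + frechet_derivative (\<lambda>y. G y b) (at y) h"
    by (simp add: frechet_derivative_eq)
next
  note G' = has_derivative_frechet[OF G]
  fix r a
  have "((\<lambda>y. G y (r *\<^sub>R a)) has_derivative
      (\<lambda>h. r *\<^sub>R frechet_derivative (\<lambda>y. G y a) (at y) h)) (at y)"
    by (rule has_derivative_transform_within_open[OF has_derivative_scaleR_right[OF G'] S])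
      (simp add: linear_cmul[OF lin])
  then show "frechet_derivative (\<lambda>y. G y (r *\<^sub>R a)) (at y) h
      = r *\<^sub>R frechet_derivative (\<lambda>y. G y a) (at y) h"
    by (simp add: frechet_derivative_eq)
qed

subsection \<open>Functions of class \<open>C\<^sup>k\<close>\<close>

lemma Ck_on_Suc_imp: "Ck_on (Suc k) S f \<Longrightarrow> Ck_on k S f"
proof (induction k arbitrary: f)
  case 0
  then show ?case
    by (auto intro!: continuous_at_imp_continuous_on differentiable_imp_continuous_within)
next
  case (Suc k)
  then show ?case unfolding Ck_on.simps(2)[of "Suc k"] Ck_on.simps(2)[of k S f] by blast
qed

text \<open>Derivatives in \<open>Ck_on\<close> are taken in the whole space, so agreement on open
  neighbourhoods, and not just on S, is what transfers the property. \<open>Ck_on_cong\<close> and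
  \<open>Ck_on_subset\<close> are the case of one common neighbourhood.\<close>

lemma Ck_on_locally:
  assumes "\<And>x. x \<in> S \<Longrightarrow> \<exists>T g. open T \<and> x \<in> T \<and> Ck_on k T g \<and> (\<forall>y\<in>T. f y = g y)"
  shows "Ck_on k S f"
  using assms
proof (induction k arbitrary: f)
  case 0
  have "isCont f x" if x: "x \<in> S" for x
  proof -
    obtain T g where T: "open T" "x \<in> T" "continuous_on T g" "\<forall>y\<in>T. f y = g y"
      using 0[OF x] by auto
    then have "continuous_on T f" using continuous_on_cong[of T T f g] by simp
    then show ?thesis using T by (metis continuous_on_eq_continuous_at)
  qed
  then show ?case by (simp add: continuous_at_imp_continuous_on)
next
  case (Suc k)
  have "f differentiable (at x)" if x: "x \<in> S" for x
  proof -
    obtain T g where T: "open T" "x \<in> T" "Ck_on (Suc k) T g" "\<forall>y\<in>T. f y = g y"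
      using Suc.prems[OF x] by auto
    then have "(g has_derivative frechet_derivative g (at x)) (at x)"
      by (simp add: has_derivative_frechet)
    then have "(f has_derivative frechet_derivative g (at x)) (at x)"
      by (rule has_derivative_transform_within_open) (use T in auto)
    then show ?thesis by (rule has_derivative_imp_differentiable)
  qed
  moreover have "Ck_on k S (\<lambda>x. frechet_derivative f (at x) v)" for v
  proof (rule Suc.IH)
    fix x assume x: "x \<in> S"
    obtain T g where T: "open T" "x \<in> T" "Ck_on (Suc k) T g" "\<forall>y\<in>T. f y = g y"
      using Suc.prems[OF x] by auto
    then have "\<forall>y\<in>T. frechet_derivative f (at y) v = frechet_derivative g (at y) v"
      using frechet_derivative_cong_open[of T _ f g] by simp
    then show "\<exists>T g. open T \<and> x \<in> T \<and> Ck_on k T g \<and>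
        (\<forall>y\<in>T. frechet_derivative f (at y) v = g y)"
      using T by (intro exI[of _ T] exI[of _ "\<lambda>y. frechet_derivative g (at y) v"]) auto
  qed
  ultimately show ?case by simp
qed

lemma Ck_on_cong:
  assumes "Ck_on k S g" "open S" "\<And>x. x \<in> S \<Longrightarrow> f x = g x"
  shows "Ck_on k S f"
  by (rule Ck_on_locally) (use assms in blast)

lemma Ck_on_subset:
  assumes "Ck_on k S f" "open S" "T \<subseteq> S"
  shows "Ck_on k T f"
  by (rule Ck_on_locally) (use assms in blast)

lemma Ck_on_const: "Ck_on k S (\<lambda>x. c)"
  by (induction k arbitrary: c) auto

lemma Ck_on_linear:
  assumes "bounded_linear h"
  shows "Ck_on k S h"
proof (cases k)
  case 0
  then show ?thesis using assms by (simp add: linear_continuous_on)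
next
  case (Suc j)
  have "(h has_derivative h) (at x)" for x using assms by (rule bounded_linear_imp_has_derivative)
  then have "frechet_derivative h (at x) = h" "h differentiable (at x)" for x
    by (auto simp: frechet_derivative_eq intro: has_derivative_imp_differentiable)
  then show ?thesis using Suc by (simp add: Ck_on_const)
qed

lemma Ck_on_linear_compose:
  assumes "bounded_linear h" "open S" "Ck_on k S f"
  shows "Ck_on k S (\<lambda>x. h (f x))"
  using assms(3)
proof (induction k arbitrary: f)
  case 0
  then show ?case using assms(1)
    by (simp add: bounded_linear.continuous_on)
next
  case (Suc k)
  have d: "((\<lambda>x. h (f x)) has_derivative (\<lambda>v. h (frechet_derivative f (at x) v))) (at x)"
    if "x \<in> S" for x
    using Suc.prems that by (intro bounded_linear.has_derivative[OF assms(1)] has_derivative_frechet) auto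
  have "Ck_on k S (\<lambda>x. frechet_derivative (\<lambda>x. h (f x)) (at x) v)" for v
    by (rule Ck_on_cong[OF Suc.IH[of "\<lambda>x. frechet_derivative f (at x) v"] assms(2)])
      (use Suc.prems in \<open>auto simp: frechet_derivative_eq[OF d]\<close>)
  then show ?case using has_derivative_imp_differentiable[OF d] by simp
qed

lemma Ck_on_add:
  assumes "open S" "Ck_on k S f" "Ck_on k S g"
  shows "Ck_on k S (\<lambda>x. f x + g x)"
  using assms(2,3)
proof (induction k arbitrary: f g)
  case 0
  then show ?case by (simp add: continuous_on_add)
next
  case (Suc k)
  have d: "((\<lambda>x. f x + g x) has_derivative
      (\<lambda>v. frechet_derivative f (at x) v + frechet_derivative g (at x) v)) (at x)"
    if "x \<in> S" for x
    using Suc.prems that by (intro has_derivative_add has_derivative_frechet) auto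
  have "Ck_on k S (\<lambda>x. frechet_derivative (\<lambda>x. f x + g x) (at x) v)" for v
    by (rule Ck_on_cong[OF Suc.IH[of "\<lambda>x. frechet_derivative f (at x) v"
            "\<lambda>x. frechet_derivative g (at x) v"] assms(1)])
      (use Suc.prems in \<open>auto simp: frechet_derivative_eq[OF d]\<close>)
  then show ?case using has_derivative_imp_differentiable[OF d] by simp
qed

lemma Ck_on_sum:
  assumes "open S" "\<And>i. i \<in> I \<Longrightarrow> Ck_on k S (f i)"
  shows "Ck_on k S (\<lambda>x. \<Sum>i\<in>I. f i x)"
  using assms(2)
  by (induction I rule: infinite_finite_induct) (auto simp: Ck_on_const intro: Ck_on_add assms(1))

lemma Ck_on_minus: "open S \<Longrightarrow> Ck_on k S f \<Longrightarrow> Ck_on k S (\<lambda>x. - f x)"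
  by (rule Ck_on_linear_compose[OF bounded_linear_minus[OF bounded_linear_ident]])

lemma Ck_on_diff:
  "open S \<Longrightarrow> Ck_on k S f \<Longrightarrow> Ck_on k S g \<Longrightarrow> Ck_on k S (\<lambda>x. f x - g x)"
  using Ck_on_add[of S k f "\<lambda>x. - g x"] Ck_on_minus[of S k g] by simp

lemma Ck_on_bilinear:
  assumes b: "bounded_bilinear b" and S: "open S" and fg: "Ck_on k S f" "Ck_on k S g"
  shows "Ck_on k S (\<lambda>x. b (f x) (g x))"
  using fg
proof (induction k arbitrary: f g)
  case 0
  then show ?case by (simp add: bounded_bilinear.continuous_on[OF b])
next
  case (Suc k)
  have d: "((\<lambda>x. b (f x) (g x)) has_derivative
      (\<lambda>v. b (f x) (frechet_derivative g (at x) v) + b (frechet_derivative f (at x) v) (g x))) (at x)"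
    if "x \<in> S" for x
    using Suc.prems that by (intro bounded_bilinear.FDERIV[OF b] has_derivative_frechet) auto
  have "Ck_on k S (\<lambda>x. frechet_derivative (\<lambda>x. b (f x) (g x)) (at x) v)" for v
  proof (rule Ck_on_cong[OF _ S])
    \<comment> \<open>Each term of the product rule retains an undifferentiated factor, so the
      induction hypothesis needs f and g at the lower order as well.\<close>
    show "Ck_on k S (\<lambda>x. b (f x) (frechet_derivative g (at x) v) + b (frechet_derivative f (at x) v) (g x))"
      using Suc.prems Ck_on_Suc_imp[OF Suc.prems(1)] Ck_on_Suc_imp[OF Suc.prems(2)]
      by (intro Ck_on_add S Suc.IH) auto
  qed (simp add: frechet_derivative_eq[OF d])
  then show ?case using has_derivative_imp_differentiable[OF d] by simp
qed

lemmas Ck_on_scaleR = Ck_on_bilinear[OF bounded_bilinear_scaleR]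
lemmas Ck_on_inner = Ck_on_bilinear[OF bounded_bilinear_inner]

text \<open>The chain rule gives a derivative of g in a direction that moves with x. Expanding this
  direction in an orthonormal family leaves derivatives along fixed b, and the induction hypothesis
  applies with g replaced by its derivative along b.\<close>

lemma Ck_on_compose:
  fixes f :: "'x::real_normed_vector \<Rightarrow> 'e::real_inner"
  assumes fd: "fin_dim TYPE('e)" and S: "open S" and T: "f ` S \<subseteq> T"
    and f: "Ck_on k S f" and g: "Ck_on k T g"
  shows "Ck_on k S (\<lambda>x. g (f x))"
  using f g
proof (induction k arbitrary: g)
  case 0
  then show ?case using T by (auto intro: continuous_on_compose2)
next
  case (Suc k)
  obtain B :: "'e set" where B: "finite B" "\<And>x. (\<Sum>b\<in>B. (x \<bullet> b) *\<^sub>R b) = x"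
    using fin_dim_expansion[OF fd] by blast
  have g': "(g has_derivative frechet_derivative g (at (f x))) (at (f x))" if "x \<in> S" for x
    using Suc.prems that T by (intro has_derivative_frechet) auto
  have d: "((\<lambda>x. g (f x)) has_derivative
      (\<lambda>v. frechet_derivative g (at (f x)) (frechet_derivative f (at x) v))) (at x)"
    if "x \<in> S" for x
    using Suc.prems that T
    by (intro has_derivative_compose[where f = f and g = g, OF _ g'[OF that]] has_derivative_frechet) auto
  have "Ck_on k S (\<lambda>x. frechet_derivative (\<lambda>x. g (f x)) (at x) v)" for v
  proof (rule Ck_on_cong[OF _ S])
    show "Ck_on k S (\<lambda>x. \<Sum>b\<in>B. (frechet_derivative f (at x) v \<bullet> b) *\<^sub>R
        frechet_derivative g (at (f x)) b)"
      using Suc.prems Ck_on_Suc_imp[OF Suc.prems(1)]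
      by (intro Ck_on_sum Ck_on_scaleR S Suc.IH Ck_on_inner Ck_on_const) auto
    fix x assume x: "x \<in> S"
    have "linear (frechet_derivative g (at (f x)))"
      using g'[OF x] by (rule has_derivative_linear)
    from linear_expansion[OF B(2) this]
    show "frechet_derivative (\<lambda>x. g (f x)) (at x) v = (\<Sum>b\<in>B. (frechet_derivative f (at x) v \<bullet> b) *\<^sub>R
        frechet_derivative g (at (f x)) b)"
      using frechet_derivative_eq[OF d[OF x]] by metis
  qed
  then show ?case using has_derivative_imp_differentiable[OF d] by simp
qed

lemma Ck_on_linear_apply:
  fixes X :: "'x::real_normed_vector \<Rightarrow> 'e::real_inner"
  assumes fd: "fin_dim TYPE('e)" and S: "open S"
    and lin: "\<And>y. y \<in> S \<Longrightarrow> linear (G y)"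
    and G: "\<And>w. Ck_on k S (\<lambda>y. G y w)" and X: "Ck_on k S X"
  shows "Ck_on k S (\<lambda>y. G y (X y))"
proof -
  obtain B :: "'e set" where B: "finite B" "\<And>x. (\<Sum>b\<in>B. (x \<bullet> b) *\<^sub>R b) = x"
    using fin_dim_expansion[OF fd] by blast
  have "Ck_on k S (\<lambda>y. \<Sum>b\<in>B. (X y \<bullet> b) *\<^sub>R G y b)"
    by (intro Ck_on_sum Ck_on_scaleR S Ck_on_inner Ck_on_const X G)
  then show ?thesis
    by (rule Ck_on_cong[OF _ S]) (simp add: linear_expansion[OF B(2) lin])
qed

abbreviation fd :: "('x::real_normed_vector \<Rightarrow> 'y::real_normed_vector) \<Rightarrow> 'x \<Rightarrow> 'x \<Rightarrow> 'y"
  where "fd f x \<equiv> frechet_derivative f (at x)"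

section \<open>Smooth functions: closure properties inherited from every finite order\<close>

lemma smooth_on_locally:
  assumes "\<And>x. x \<in> S \<Longrightarrow> \<exists>T g. open T \<and> x \<in> T \<and> smooth_on T g \<and> (\<forall>y\<in>T. f y = g y)"
  shows "smooth_on S f"
  using assms unfolding smooth_on_def by (intro allI Ck_on_locally) blast

lemma smooth_on_cong:
  "smooth_on S g \<Longrightarrow> open S \<Longrightarrow> (\<And>x. x \<in> S \<Longrightarrow> f x = g x) \<Longrightarrow> smooth_on S f"
  unfolding smooth_on_def using Ck_on_cong by blast

lemma smooth_on_subset: "smooth_on S f \<Longrightarrow> open S \<Longrightarrow> T \<subseteq> S \<Longrightarrow> smooth_on T f"
  unfolding smooth_on_def using Ck_on_subset by blast

lemma smooth_on_const: "smooth_on S (\<lambda>x. c)"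
  by (simp add: smooth_on_def Ck_on_const)

lemma smooth_on_add:
  "open S \<Longrightarrow> smooth_on S f \<Longrightarrow> smooth_on S g \<Longrightarrow> smooth_on S (\<lambda>x. f x + g x)"
  by (simp add: smooth_on_def Ck_on_add)

lemma smooth_on_diff:
  "open S \<Longrightarrow> smooth_on S f \<Longrightarrow> smooth_on S g \<Longrightarrow> smooth_on S (\<lambda>x. f x - g x)"
  by (simp add: smooth_on_def Ck_on_diff)

lemma smooth_on_scaleR:
  "open S \<Longrightarrow> smooth_on S f \<Longrightarrow> smooth_on S g \<Longrightarrow> smooth_on S (\<lambda>x. f x *\<^sub>R g x)"
  by (simp add: smooth_on_def Ck_on_scaleR)

lemma smooth_on_compose:
  fixes f :: "'x::real_normed_vector \<Rightarrow> 'e::real_inner"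
  assumes "fin_dim TYPE('e)" "open S" "f ` S \<subseteq> T" "smooth_on S f" "smooth_on T g"
  shows "smooth_on S (\<lambda>x. g (f x))"
  using assms(4,5) unfolding smooth_on_def by (blast intro: Ck_on_compose[OF assms(1-3)])

lemma smooth_on_linear_apply:
  fixes X :: "'x::real_normed_vector \<Rightarrow> 'e::real_inner"
  assumes "fin_dim TYPE('e)" "open S" "\<And>y. y \<in> S \<Longrightarrow> linear (G y)"
    and "\<And>w. smooth_on S (\<lambda>y. G y w)" "smooth_on S X"
  shows "smooth_on S (\<lambda>y. G y (X y))"
  unfolding smooth_on_def
  by (rule allI, rule Ck_on_linear_apply[OF assms(1-3)]) (use assms(4,5) in \<open>auto simp: smooth_on_def\<close>)

lemma smooth_on_fd:
  assumes "smooth_on S f"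
  shows "smooth_on S (\<lambda>x. fd f x v)"
  unfolding smooth_on_def
proof
  fix k
  have "Ck_on (Suc k) S f" using assms unfolding smooth_on_def by blast
  then show "Ck_on k S (\<lambda>x. fd f x v)" by simp
qed

lemma smooth_on_differentiable: "smooth_on S f \<Longrightarrow> x \<in> S \<Longrightarrow> f differentiable (at x)"
  unfolding smooth_on_def by (drule spec[of _ "Suc 0"]) simp

lemma smooth_on_has_derivative: "smooth_on S f \<Longrightarrow> x \<in> S \<Longrightarrow> (f has_derivative fd f x) (at x)"
  by (rule has_derivative_frechet[OF smooth_on_differentiable])

lemma smooth_on_linear_fd: "smooth_on S f \<Longrightarrow> x \<in> S \<Longrightarrow> linear (fd f x)"
  by (rule linear_frechet_derivative[OF smooth_on_differentiable])

lemma smooth_on_fd_apply: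
  fixes f :: "'e::real_inner \<Rightarrow> 'f::real_normed_vector"
  assumes "fin_dim TYPE('e)" "open S" "smooth_on S f" "smooth_on S X"
  shows "smooth_on S (\<lambda>y. fd f y (X y))"
  by (rule smooth_on_linear_apply[where G = "fd f", OF assms(1,2) smooth_on_linear_fd[OF assms(3)]
        smooth_on_fd[OF assms(3)] assms(4)])

lemma smooth_on_imp_continuous_on: "smooth_on S f \<Longrightarrow> continuous_on S f"
  unfolding smooth_on_def by (drule spec[of _ 0]) simp

subsection \<open>Symmetry of second derivatives\<close>

text \<open>Two applications of the mean value theorem, first along u and then along v. The
  left-hand side is symmetric in u and v, so exchanging them relates the two mixed
  derivatives.\<close>

lemma second_difference_mean_value:
  fixes f :: "'e::real_normed_vector \<Rightarrow> real"
  assumes "t > 0"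
    and S: "\<And>a b. 0 \<le> a \<Longrightarrow> a \<le> t \<Longrightarrow> 0 \<le> b \<Longrightarrow> b \<le> t \<Longrightarrow> x + a *\<^sub>R u + b *\<^sub>R v \<in> S"
    and f: "\<And>y. y \<in> S \<Longrightarrow> f differentiable (at y)"
    and f': "\<And>y. y \<in> S \<Longrightarrow> (\<lambda>z. frechet_derivative f (at z) u) differentiable (at y)"
  shows "\<exists>a b. 0 < a \<and> a < t \<and> 0 < b \<and> b < t \<and>
    f (x + t *\<^sub>R u + t *\<^sub>R v) - f (x + t *\<^sub>R u) - f (x + t *\<^sub>R v) + f x =
    t * (t * frechet_derivative (\<lambda>z. frechet_derivative f (at z) u) (at (x + a *\<^sub>R u + b *\<^sub>R v)) v)"
proof -
  have d: "((\<lambda>a. g (y + a *\<^sub>R w)) has_real_derivative frechet_derivative g (at (y + a *\<^sub>R w)) w) (at a)"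
    if "g differentiable (at (y + a *\<^sub>R w))" for g :: "'e \<Rightarrow> real" and y w a
  proof -
    have l: "((\<lambda>a. y + a *\<^sub>R w) has_derivative (\<lambda>h. h *\<^sub>R w)) (at a)"
      by (auto intro!: derivative_eq_intros)
    have "((\<lambda>a. g (y + a *\<^sub>R w)) has_derivative
        (\<lambda>h. frechet_derivative g (at (y + a *\<^sub>R w)) (h *\<^sub>R w))) (at a)"
      by (rule has_derivative_compose[OF l has_derivative_frechet[OF that]])
    moreover have "frechet_derivative g (at (y + a *\<^sub>R w)) (h *\<^sub>R w)
        = frechet_derivative g (at (y + a *\<^sub>R w)) w * h" for h
      using linear_cmul[OF linear_frechet_derivative[OF that]] by simp
    ultimately show ?thesis unfolding has_field_derivative_def by simp
  qed
  define D where "D = (\<lambda>z. frechet_derivative f (at z) u)"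
  have comm: "x + a *\<^sub>R u + b *\<^sub>R v = (x + b *\<^sub>R v) + a *\<^sub>R u" for a b by simp
  have "\<exists>a>0. a < t \<and> (f (x + t *\<^sub>R v + t *\<^sub>R u) - f (x + t *\<^sub>R u)) - (f (x + t *\<^sub>R v + 0 *\<^sub>R u) - f (x + 0 *\<^sub>R u))
      = (t - 0) * (D (x + t *\<^sub>R v + a *\<^sub>R u) - D (x + a *\<^sub>R u))"
  proof (rule MVT2[OF assms(1)])
    fix a :: real assume a: "0 \<le> a" "a \<le> t"
    have "x + t *\<^sub>R v + a *\<^sub>R u \<in> S" using S[OF a, of t] assms(1) comm by simp
    moreover have "x + a *\<^sub>R u \<in> S" using S[OF a, of 0] assms(1) by simp
    ultimately show "((\<lambda>a. f (x + t *\<^sub>R v + a *\<^sub>R u) - f (x + a *\<^sub>R u)) has_real_derivative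
        D (x + t *\<^sub>R v + a *\<^sub>R u) - D (x + a *\<^sub>R u)) (at a)"
      unfolding D_def by (intro DERIV_diff d f)
  qed
  then obtain a where a: "0 < a" "a < t"
    "f (x + t *\<^sub>R v + t *\<^sub>R u) - f (x + t *\<^sub>R u) - (f (x + t *\<^sub>R v) - f x)
      = t * (D (x + t *\<^sub>R v + a *\<^sub>R u) - D (x + a *\<^sub>R u))"
    by auto
  have "\<exists>b>0. b < t \<and> D (x + a *\<^sub>R u + t *\<^sub>R v) - D (x + a *\<^sub>R u + 0 *\<^sub>R v)
      = (t - 0) * frechet_derivative D (at (x + a *\<^sub>R u + b *\<^sub>R v)) v"
  proof (rule MVT2[OF assms(1)])
    fix b :: real assume "0 \<le> b" "b \<le> t"
    then have "x + a *\<^sub>R u + b *\<^sub>R v \<in> S" using S[of a b] a by simp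
    then show "((\<lambda>b. D (x + a *\<^sub>R u + b *\<^sub>R v)) has_real_derivative
        frechet_derivative D (at (x + a *\<^sub>R u + b *\<^sub>R v)) v) (at b)"
      using f' unfolding D_def by (intro d) auto
  qed
  then obtain b where b: "0 < b" "b < t" "D (x + a *\<^sub>R u + t *\<^sub>R v) - D (x + a *\<^sub>R u)
      = t * frechet_derivative D (at (x + a *\<^sub>R u + b *\<^sub>R v)) v"
    by auto
  show ?thesis
    by (intro exI[of _ a] exI[of _ b]) (use a b in \<open>auto simp: D_def algebra_simps\<close>)
qed

text \<open>The second difference over the parallelogram with sides t u and t v is t^2 times either
  mixed derivative, each taken at some point of the parallelogram. By continuity both values are
  within e/2 of those at x.\<close>

lemma second_derivative_symmetric_real:
  fixes f :: "'e::real_normed_vector \<Rightarrow> real"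
  assumes S: "open S" "x \<in> S" and f: "Ck_on 2 S f"
  shows "frechet_derivative (\<lambda>z. frechet_derivative f (at z) u) (at x) v
    = frechet_derivative (\<lambda>z. frechet_derivative f (at z) v) (at x) u"
proof -
  define H where "H = (\<lambda>u v x. frechet_derivative (\<lambda>z. frechet_derivative f (at z) u) (at x) v)"
  have f1: "f differentiable (at y)" and f2: "(\<lambda>z. frechet_derivative f (at z) w) differentiable (at y)"
    and H: "continuous_on S (H w w')" if "y \<in> S" for y w w'
    using f that by (auto simp: numeral_2_eq_2 H_def)
  have "dist (H u v x) (H v u x) < e" if e: "e > 0" for e
  proof -
    have "isCont (H u v) x" "isCont (H v u) x"
      using H[OF S(2)] S by (simp_all add: continuous_on_eq_continuous_at)
    then obtain d1 d2 where d: "d1 > 0" "\<And>y. dist y x < d1 \<Longrightarrow> dist (H u v y) (H u v x) < e/2"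
      "d2 > 0" "\<And>y. dist y x < d2 \<Longrightarrow> dist (H v u y) (H v u x) < e/2"
      using half_gt_zero[OF e] unfolding continuous_at_eps_delta by blast
    obtain d3 where d3: "d3 > 0" "ball x d3 \<subseteq> S" using S open_contains_ball by blast
    define d where "d = min d1 (min d2 d3)"
    \<comment> \<open>The summand 1 keeps \<open>N\<close> positive when u = v = 0. The choice of
      \<open>t\<close> keeps the whole parallelogram within t * N = d / 2 of x.\<close>
    define N where "N = norm u + norm v + 1"
    define t where "t = d / 2 / N"
    have dp: "d > 0" using d d3 by (simp add: d_def)
    have np: "N > 0" by (simp add: N_def add_nonneg_pos)
    have t: "t > 0" using dp np by (simp add: t_def)
    have near: "dist (x + a *\<^sub>R u + b *\<^sub>R v) x < d" if "0 \<le> a" "a \<le> t" "0 \<le> b" "b \<le> t" for a b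
    proof -
      have "dist (x + a *\<^sub>R u + b *\<^sub>R v) x = norm (a *\<^sub>R u + b *\<^sub>R v)" by (simp add: dist_norm)
      also have "\<dots> \<le> a * norm u + b * norm v"
        using norm_triangle_ineq[of "a *\<^sub>R u" "b *\<^sub>R v"] that by simp
      also have "\<dots> \<le> t * norm u + t * norm v"
        using that by (intro add_mono mult_right_mono) auto
      also have "\<dots> \<le> t * N" using t by (simp add: N_def algebra_simps)
      also have "\<dots> = d / 2" using np by (simp add: t_def)
      also have "\<dots> < d" using dp by simp
      finally show ?thesis .
    qed
    have inS: "x + a *\<^sub>R u + b *\<^sub>R v \<in> S" if "0 \<le> a" "a \<le> t" "0 \<le> b" "b \<le> t" for a b
      using near[OF that] d3(2) by (auto simp: d_def dist_commute subset_iff)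
    obtain a b where ab: "0 < a" "a < t" "0 < b" "b < t"
      "f (x + t *\<^sub>R u + t *\<^sub>R v) - f (x + t *\<^sub>R u) - f (x + t *\<^sub>R v) + f x =
        t * (t * H u v (x + a *\<^sub>R u + b *\<^sub>R v))"
      using second_difference_mean_value[OF t inS f1 f2] unfolding H_def by blast
    have inS': "x + a *\<^sub>R v + b *\<^sub>R u \<in> S" if "0 \<le> a" "a \<le> t" "0 \<le> b" "b \<le> t" for a b
      using inS[OF that(3,4,1,2)] by (simp add: algebra_simps)
    obtain a' b' where ab': "0 < a'" "a' < t" "0 < b'" "b' < t"
      "f (x + t *\<^sub>R v + t *\<^sub>R u) - f (x + t *\<^sub>R v) - f (x + t *\<^sub>R u) + f x =
        t * (t * H v u (x + a' *\<^sub>R v + b' *\<^sub>R u))"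
      using second_difference_mean_value[OF t inS' f1 f2] unfolding H_def by blast
    have sw: "x + t *\<^sub>R v + t *\<^sub>R u = x + t *\<^sub>R u + t *\<^sub>R v" "x + a' *\<^sub>R v + b' *\<^sub>R u = x + b' *\<^sub>R u + a' *\<^sub>R v"
      by simp_all
    have "t * (t * H u v (x + a *\<^sub>R u + b *\<^sub>R v)) = t * (t * H v u (x + b' *\<^sub>R u + a' *\<^sub>R v))"
      using ab(5) ab'(5) unfolding sw by linarith
    then have eq: "H u v (x + a *\<^sub>R u + b *\<^sub>R v) = H v u (x + b' *\<^sub>R u + a' *\<^sub>R v)" using t by simp
    have "dist (H u v (x + a *\<^sub>R u + b *\<^sub>R v)) (H u v x) < e/2"
      using d(2) near[of a b] ab by (simp add: d_def)
    moreover have "dist (H v u (x + b' *\<^sub>R u + a' *\<^sub>R v)) (H v u x) < e/2"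
      using d(4) near[of b' a'] ab' by (simp add: d_def)
    ultimately show ?thesis unfolding eq by (rule dist_triangle_half_r)
  qed
  then have "H u v x = H v u x" by (metis dist_pos_lt less_irrefl)
  then show ?thesis by (simp add: H_def)
qed

text \<open>Inner products with fixed vectors w reduce the claim to real-valued functions.\<close>

lemma second_derivative_symmetric:
  fixes f :: "'e::real_normed_vector \<Rightarrow> 'f::real_inner"
  assumes S: "open S" "x \<in> S" and f: "Ck_on 2 S f"
  shows "frechet_derivative (\<lambda>z. frechet_derivative f (at z) u) (at x) v
    = frechet_derivative (\<lambda>z. frechet_derivative f (at z) v) (at x) u"
proof -
  have f1: "f differentiable (at y)" and f2: "(\<lambda>z. frechet_derivative f (at z) w) differentiable (at y)"
    if "y \<in> S" for y w
    using f that by (auto simp: numeral_2_eq_2)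
  have "frechet_derivative (\<lambda>z. frechet_derivative (\<lambda>y. f y \<bullet> w) (at z) a) (at x) b
      = frechet_derivative (\<lambda>z. frechet_derivative f (at z) a) (at x) b \<bullet> w" for a b w
  proof -
    have "frechet_derivative (\<lambda>y. f y \<bullet> w) (at z) a = frechet_derivative f (at z) a \<bullet> w"
      if "z \<in> S" for z
      using frechet_derivative_eq[OF has_derivative_inner_left[OF has_derivative_frechet[OF f1[OF that]]]]
      by metis
    then have "frechet_derivative (\<lambda>z. frechet_derivative (\<lambda>y. f y \<bullet> w) (at z) a) (at x)
        = frechet_derivative (\<lambda>z. frechet_derivative f (at z) a \<bullet> w) (at x)"
      by (rule frechet_derivative_cong_open[OF S])
    also have "\<dots> = (\<lambda>b. frechet_derivative (\<lambda>z. frechet_derivative f (at z) a) (at x) b \<bullet> w)"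
      by (intro frechet_derivative_eq has_derivative_inner_left has_derivative_frechet f2 S)
    finally show ?thesis by simp
  qed
  moreover have "Ck_on 2 S (\<lambda>y. f y \<bullet> w)" for w
    by (rule Ck_on_inner[OF S(1) f Ck_on_const])
  ultimately have "frechet_derivative (\<lambda>z. frechet_derivative f (at z) u) (at x) v \<bullet> w
      = frechet_derivative (\<lambda>z. frechet_derivative f (at z) v) (at x) u \<bullet> w" for w
    using second_derivative_symmetric_real[OF S, of "\<lambda>y. f y \<bullet> w" u v] by simp
  then show ?thesis using vector_eq_rdot by blast
qed

lemma smooth_on_fd_commute:
  fixes f :: "'e::real_normed_vector \<Rightarrow> 'f::real_inner"
  assumes "open S" "x \<in> S" "smooth_on S f"
  shows "fd (\<lambda>z. fd f z u) x v = fd (\<lambda>z. fd f z v) x u"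
  by (rule second_derivative_symmetric[OF assms(1,2)]) (use assms(3) in \<open>simp add: smooth_on_def\<close>)

subsection \<open>Bump functions\<close>

text \<open>The powers of 1/t make the family closed under differentiation up to linear
  combinations; n = 0 is the classical flat function exp(-1/t).\<close>

definition flat_power :: "nat \<Rightarrow> real \<Rightarrow> real"
  where "flat_power n t = (if t > 0 then inverse t ^ n * exp (- inverse t) else 0)"

lemma flat_power_tendsto: "(flat_power n \<longlongrightarrow> 0) (at 0)"
proof -
  have "((\<lambda>t. inverse t ^ n / exp (inverse t)) \<longlongrightarrow> 0) (at_right (0::real))"
    by (rule filterlim_compose[OF tendsto_power_div_exp_0 filterlim_inverse_at_top_right])
  moreover have "\<forall>\<^sub>F t in at_right 0. inverse t ^ n / exp (inverse t) = flat_power n t"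
    by (rule eventually_mono[OF eventually_at_right_less[of 0]])
      (simp add: flat_power_def exp_minus divide_inverse)
  ultimately have "(flat_power n \<longlongrightarrow> 0) (at_right 0)"
    by (rule Lim_transform_eventually)
  moreover have "(flat_power n \<longlongrightarrow> 0) (at_left 0)"
    by (rule tendsto_eventually) (auto simp: flat_power_def eventually_at_left_field intro: exI[of _ "-1"])
  ultimately show ?thesis by (simp add: filterlim_at_split)
qed

lemma flat_power_derivative:
  "(flat_power n has_real_derivative (flat_power (n + 2) t - n * flat_power (n + 1) t)) (at t)"
proof -
  consider "t > 0" | "t < 0" | "t = 0" by linarith
  then show ?thesis
  proof cases
    case 1
    have "(inverse has_real_derivative - ((inverse t)\<^sup>2)) (at t)"
      using 1 by (auto intro!: derivative_eq_intros simp: power2_eq_square)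
    then have "((\<lambda>t. inverse t ^ n * exp (- inverse t)) has_real_derivative
        (n * inverse t ^ (n - 1) * - ((inverse t)\<^sup>2) * exp (- inverse t)
          + inverse t ^ n * (exp (- inverse t) * (inverse t)\<^sup>2))) (at t)"
      using 1 by (auto intro!: derivative_eq_intros simp: power2_eq_square algebra_simps)
    moreover have "n * inverse t ^ (n - 1) * - ((inverse t)\<^sup>2) * exp (- inverse t)
          + inverse t ^ n * (exp (- inverse t) * (inverse t)\<^sup>2)
        = flat_power (n + 2) t - n * flat_power (n + 1) t"
      \<comment> \<open>For n = 0 the factor n kills the term with the truncated exponent
        \<open>n - 1\<close>.\<close>
      using 1 by (cases n) (simp_all add: flat_power_def power2_eq_square algebra_simps)
    ultimately have "((\<lambda>t. inverse t ^ n * exp (- inverse t)) has_real_derivative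
        (flat_power (n + 2) t - n * flat_power (n + 1) t)) (at t)"
      by simp
    then show ?thesis
      by (rule DERIV_cong_ev[OF refl _ refl, THEN iffD1, rotated])
        (use 1 in \<open>auto simp: flat_power_def intro!: eventually_nhds_in_open[of "{0<..}", THEN eventually_mono]\<close>)
  next
    case 2
    have "((\<lambda>t. 0) has_real_derivative (flat_power (n + 2) t - n * flat_power (n + 1) t)) (at t)"
      using 2 by (simp add: flat_power_def)
    then show ?thesis
      by (rule DERIV_cong_ev[OF refl _ refl, THEN iffD1, rotated])
        (use 2 in \<open>auto simp: flat_power_def intro!: eventually_nhds_in_open[of "{..<0}", THEN eventually_mono]\<close>)
  next
    case 3
    \<comment> \<open>At 0 the difference quotient of \<open>flat_power n\<close> is
      \<open>flat_power (Suc n)\<close>, because dividing by h adds one power.\<close>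
    have "((\<lambda>h. flat_power n h / h) \<longlongrightarrow> 0) (at 0)"
      by (rule tendsto_cong[THEN iffD1, OF _ flat_power_tendsto[of "Suc n"]])
        (auto simp: flat_power_def field_simps eventually_at_filter)
    then show ?thesis using 3 by (simp add: DERIV_def flat_power_def)
  qed
qed

lemma Ck_on_flat_power: "Ck_on k UNIV (flat_power n)"
proof (induction k arbitrary: n)
  case 0
  then show ?case using flat_power_derivative by (auto intro!: continuous_at_imp_continuous_on DERIV_isCont)
next
  case (Suc k)
  have d: "(flat_power n has_derivative
      (\<lambda>h. (flat_power (n + 2) t - n * flat_power (n + 1) t) * h)) (at t)" for t
    using flat_power_derivative[of n t] by (simp add: has_field_derivative_def)
  have "Ck_on k UNIV (\<lambda>t. (flat_power (n + 2) t - real n *\<^sub>R flat_power (n + 1) t) *\<^sub>R h)" for h :: real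
    by (intro Ck_on_scaleR[OF open_UNIV Ck_on_diff[OF open_UNIV _ Ck_on_scaleR[OF open_UNIV]]]
        Ck_on_const Suc.IH)
  then have "Ck_on k UNIV (\<lambda>t. frechet_derivative (flat_power n) (at t) h)" for h
    unfolding frechet_derivative_eq[OF d] by simp
  then show ?case using has_derivative_imp_differentiable[OF d] by simp
qed

lemma fin_dim_real: "fin_dim TYPE(real)"
  unfolding fin_dim_def by (rule exI[of _ "{1}"]) (auto simp: span_singleton)

lemma bump_function:
  fixes y\<^sub>0 :: "'e::real_inner"
  assumes "e > 0"
  obtains h :: "'e \<Rightarrow> real" where "smooth_on UNIV h" "h y\<^sub>0 = 1" "\<And>y. dist y y\<^sub>0 \<ge> e \<Longrightarrow> h y = 0"
proof
  define c where "c = flat_power 0 (e\<^sup>2)"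
  have c: "c > 0" using assms by (simp add: c_def flat_power_def)
  \<comment> \<open>The squared distance is smooth even at the centre. The argument of
    \<open>flat_power\<close> is nonpositive exactly outside the open ball of radius e, and
    \<open>c\<close> normalises the value at the centre.\<close>
  define h where "h = (\<lambda>y::'e. flat_power 0 (e\<^sup>2 - (y - y\<^sub>0) \<bullet> (y - y\<^sub>0)) *\<^sub>R inverse c)"
  show "smooth_on UNIV h"
    unfolding smooth_on_def
  proof
    fix k
    have "Ck_on k UNIV (\<lambda>y. y - y\<^sub>0)"
      by (intro Ck_on_diff Ck_on_const Ck_on_linear bounded_linear_ident) auto
    then have "Ck_on k UNIV (\<lambda>y. e\<^sup>2 - (y - y\<^sub>0) \<bullet> (y - y\<^sub>0))"
      by (intro Ck_on_diff[OF _ Ck_on_const Ck_on_inner]) auto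
    then have "Ck_on k UNIV (\<lambda>y. flat_power 0 (e\<^sup>2 - (y - y\<^sub>0) \<bullet> (y - y\<^sub>0)))"
      by (rule Ck_on_compose[OF fin_dim_real open_UNIV subset_UNIV _ Ck_on_flat_power])
    then show "Ck_on k UNIV h" unfolding h_def
      by (intro Ck_on_scaleR open_UNIV Ck_on_const)
  qed
  show "h y\<^sub>0 = 1" using c by (simp add: h_def c_def)
  fix y assume "dist y y\<^sub>0 \<ge> e"
  then have "e\<^sup>2 \<le> (y - y\<^sub>0) \<bullet> (y - y\<^sub>0)"
    using assms by (simp add: dist_norm power2_norm_eq_inner[symmetric])
  then show "h y = 0" by (simp add: h_def flat_power_def)
qed

text \<open>The ball is a closed subset of a box, which is a finite Minkowski sum of compact
  segments. Compactness makes the image of a coordinate ball closed in the Hausdorff space of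
  points, as the construction of cutoffs requires.\<close>

lemma compact_cball_fin_dim:
  fixes x :: "'e::real_inner"
  assumes "fin_dim TYPE('e)"
  shows "compact (cball x e)"
proof -
  obtain B :: "'e set" where B: "finite B" "\<And>x. (\<Sum>b\<in>B. (x \<bullet> b) *\<^sub>R b) = x"
    using fin_dim_expansion[OF assms] by blast
  \<comment> \<open>By the Cauchy-Schwarz inequality \<open>M b\<close> bounds the coefficient of b
    for all points of the ball.\<close>
  define M where "M = (\<lambda>b::'e. (norm x + e) * norm b)"
  define box where "box = (\<lambda>C. {\<Sum>b\<in>C. t b *\<^sub>R b |t. \<forall>b\<in>C. \<bar>t b\<bar> \<le> M b})"
  have "compact (box C)" if "finite C" for C
    using that
  proof (induction C)
    case empty
    then show ?case by (simp add: box_def)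
  next
    case (insert c C)
    have "box (insert c C) = {y + z |y z. y \<in> (\<lambda>t. t *\<^sub>R c) ` {- M c..M c} \<and> z \<in> box C}"
    proof (intro equalityI subsetI)
      fix y assume "y \<in> box (insert c C)"
      then obtain t where t: "y = (\<Sum>b\<in>insert c C. t b *\<^sub>R b)" "\<forall>b\<in>insert c C. \<bar>t b\<bar> \<le> M b"
        unfolding box_def by blast
      then have "y = t c *\<^sub>R c + (\<Sum>b\<in>C. t b *\<^sub>R b)" using insert by simp
      moreover have "(\<Sum>b\<in>C. t b *\<^sub>R b) \<in> box C" using t by (auto simp: box_def)
      moreover have "t c *\<^sub>R c \<in> (\<lambda>t. t *\<^sub>R c) ` {- M c..M c}" using t by (auto simp: abs_le_iff)
      ultimately show "y \<in> {y + z |y z. y \<in> (\<lambda>t. t *\<^sub>R c) ` {- M c..M c} \<and> z \<in> box C}" by blast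
    next
      fix y assume "y \<in> {y + z |y z. y \<in> (\<lambda>t. t *\<^sub>R c) ` {- M c..M c} \<and> z \<in> box C}"
      then obtain r t where t: "y = r *\<^sub>R c + (\<Sum>b\<in>C. t b *\<^sub>R b)" "\<bar>r\<bar> \<le> M c" "\<forall>b\<in>C. \<bar>t b\<bar> \<le> M b"
        unfolding box_def by (auto simp: abs_le_iff)
      have "(\<Sum>b\<in>C. t b *\<^sub>R b) = (\<Sum>b\<in>C. (t(c := r)) b *\<^sub>R b)"
        using insert by (intro sum.cong) auto
      then have "y = (\<Sum>b\<in>insert c C. (t(c := r)) b *\<^sub>R b)" using insert t by simp
      moreover have "\<forall>b\<in>insert c C. \<bar>(t(c := r)) b\<bar> \<le> M b" using t by simp
      ultimately show "y \<in> box (insert c C)" unfolding box_def by blast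
    qed
    moreover have "compact ((\<lambda>t. t *\<^sub>R c) ` {- M c..M c})"
      by (intro compact_continuous_image continuous_intros compact_Icc)
    ultimately show ?case using compact_sums[OF _ insert.IH] by simp
  qed
  moreover have "cball x e \<subseteq> box B"
  proof
    fix y assume y: "y \<in> cball x e"
    have "norm y \<le> norm x + e"
      using norm_triangle_ineq2[of y x] y by (simp add: dist_norm norm_minus_commute)
    then have "\<bar>y \<bullet> b\<bar> \<le> M b" for b
      unfolding M_def
      by (intro order_trans[OF Cauchy_Schwarz_ineq2 mult_right_mono]) auto
    then show "y \<in> box B" unfolding box_def using B(2)[of y] by (auto intro!: exI[of _ "\<lambda>b. y \<bullet> b"])
  qed
  ultimately show ?thesis
    using B(1) closed_Int_compact[of "cball x e" "box B"] by (simp add: Int_absorb2)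
qed

subsection \<open>Differentiable solutions of linear systems\<close>

text \<open>Gaussian elimination: wherever some entry of the last column is nonzero, that column can be
  eliminated; otherwise the column vanishes identically and can be dropped.\<close>

lemma differentiable_solution_on_open_subset:
  fixes v :: "nat \<Rightarrow> 'k \<Rightarrow> 'x::real_normed_vector \<Rightarrow> real" and w :: "'k \<Rightarrow> 'x \<Rightarrow> real"
  assumes "open U" "U \<noteq> {}"
    and "\<And>i k y. i < n \<Longrightarrow> y \<in> U \<Longrightarrow> v i k differentiable (at y)"
    and "\<And>k y. y \<in> U \<Longrightarrow> w k differentiable (at y)"
    and "\<And>y. y \<in> U \<Longrightarrow> \<exists>c. \<forall>k. w k y = (\<Sum>i<n. c i * v i k y)"
  shows "\<exists>V g. open V \<and> V \<noteq> {} \<and> V \<subseteq> U \<and> (\<forall>i<n. \<forall>y\<in>V. g i differentiable (at y)) \<and>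
    (\<forall>y\<in>V. \<forall>k. w k y = (\<Sum>i<n. g i y * v i k y))"
  using assms
proof (induction n arbitrary: U v w)
  case 0
  then show ?case by auto
next
  case (Suc n)
  show ?case
  proof (cases "\<forall>y\<in>U. \<forall>k. v n k y = 0")
    case True
    have "\<exists>V g. open V \<and> V \<noteq> {} \<and> V \<subseteq> U \<and> (\<forall>i<n. \<forall>y\<in>V. g i differentiable (at y)) \<and>
      (\<forall>y\<in>V. \<forall>k. w k y = (\<Sum>i<n. g i y * v i k y))"
      by (rule Suc.IH) (use Suc.prems True in auto)
    then obtain V g where V: "open V" "V \<noteq> {}" "V \<subseteq> U" "\<forall>i<n. \<forall>y\<in>V. g i differentiable (at y)"
      "\<forall>y\<in>V. \<forall>k. w k y = (\<Sum>i<n. g i y * v i k y)" by blast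
    show ?thesis
      by (intro exI[of _ V] exI[of _ "\<lambda>i. if i = n then (\<lambda>y. 0) else g i"])
        (use V True in \<open>auto simp: less_Suc_eq\<close>)
  next
    case False
    then obtain y\<^sub>0 k\<^sub>0 where y0: "y\<^sub>0 \<in> U" "v n k\<^sub>0 y\<^sub>0 \<noteq> 0" by blast
    define p where "p = v n k\<^sub>0"
    have "continuous_on U p"
      unfolding p_def using Suc.prems(3)[of n]
      by (intro continuous_at_imp_continuous_on ballI differentiable_imp_continuous_within) auto
    then have "open (U \<inter> p -` (- {0}))"
      using Suc.prems(1) by (intro continuous_open_preimage) auto
    moreover define U' where "U' = U \<inter> p -` (- {0})"
    ultimately have U': "open U'" "U' \<noteq> {}" "U' \<subseteq> U" "\<And>y. y \<in> U' \<Longrightarrow> p y \<noteq> 0"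
      using y0 by (auto simp: p_def)
    \<comment> \<open>From equation k the multiple \<open>v n k y / p y\<close> of the pivot
      equation \<open>k\<^sub>0\<close> is subtracted, which removes unknown n. There may be
      infinitely many equations; the induction runs over the unknowns.\<close>
    define v' where "v' = (\<lambda>i k y. v i k y - v i k\<^sub>0 y / p y * v n k y)"
    define w' where "w' = (\<lambda>k y. w k y - w k\<^sub>0 y / p y * v n k y)"
    have dp: "p differentiable (at y)" if "y \<in> U'" for y
      using Suc.prems(3)[of n y k\<^sub>0] that U' by (auto simp: p_def)
    have "\<exists>V g. open V \<and> V \<noteq> {} \<and> V \<subseteq> U' \<and> (\<forall>i<n. \<forall>y\<in>V. g i differentiable (at y)) \<and>
      (\<forall>y\<in>V. \<forall>k. w' k y = (\<Sum>i<n. g i y * v' i k y))"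
    proof (rule Suc.IH[OF U'(1,2)])
      fix y assume y: "y \<in> U'"
      then have yU: "y \<in> U" using U' by auto
      obtain c where c: "\<And>k. w k y = (\<Sum>i<n. c i * v i k y) + c n * v n k y"
        using Suc.prems(5)[OF yU] by auto
      \<comment> \<open>A pointwise solution of the original system solves the reduced one once its
        last entry is dropped.\<close>
      have "w' k y = (\<Sum>i<n. c i * v' i k y)" for k
        using U'(4)[OF y] unfolding w'_def c[of k] c[of k\<^sub>0] v'_def p_def
        by (simp add: right_diff_distrib sum_subtractf sum_distrib_right sum_divide_distrib
            add_divide_distrib distrib_right mult.assoc)
      then show "\<exists>c. \<forall>k. w' k y = (\<Sum>i<n. c i * v' i k y)" by blast
    next
      fix i k y assume "i < n" "y \<in> U'"
      then show "v' i k differentiable (at y)"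
        unfolding v'_def using Suc.prems(3) U' dp
        by (intro differentiable_diff differentiable_mult differentiable_divide) auto
    next
      fix k y assume "y \<in> U'"
      then show "w' k differentiable (at y)"
        unfolding w'_def using Suc.prems(3)[of n] Suc.prems(4) U' dp
        by (intro differentiable_diff differentiable_mult differentiable_divide) auto
    qed
    then obtain V g where V: "open V" "V \<noteq> {}" "V \<subseteq> U'" "\<forall>i<n. \<forall>y\<in>V. g i differentiable (at y)"
      "\<forall>y\<in>V. \<forall>k. w' k y = (\<Sum>i<n. g i y * v' i k y)" by blast
    \<comment> \<open>Back substitution: the last unknown is read off from the pivot
      equation.\<close>
    define g' where "g' = (\<lambda>i. if i = n then (\<lambda>y. (w k\<^sub>0 y - (\<Sum>i<n. g i y * v i k\<^sub>0 y)) / p y) else g i)"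
    have "g' i differentiable (at y)" if "i < Suc n" "y \<in> V" for i y
    proof (cases "i = n")
      case True
      have y: "y \<in> U'" "y \<in> U" using that V U' by auto
      have gd: "g i differentiable (at y)" if "i < n" for i using V(4) that \<open>y \<in> V\<close> by simp
      have vd: "v i k differentiable (at y)" if "i < n" for i k using Suc.prems(3) that y by simp
      have "(\<lambda>y. (w k\<^sub>0 y - (\<Sum>i<n. g i y * v i k\<^sub>0 y)) / p y) differentiable (at y)"
        using y
        by (intro differentiable_diff differentiable_divide differentiable_sum ballI
            differentiable_mult             gd vd dp Suc.prems(4) U'(4)) auto
      then show ?thesis using True by (simp add: g'_def)
    next
      case False
      then show ?thesis using that V by (simp add: g'_def)
    qed
    moreover have "w k y = (\<Sum>i<Suc n. g' i y * v i k y)" if y: "y \<in> V" for y k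
    proof -
      have "p y \<noteq> 0" using U' V y by auto
      have "w k y = w' k y + w k\<^sub>0 y / p y * v n k y" by (simp add: w'_def)
      also have "w' k y = (\<Sum>i<n. g i y * v' i k y)" using V y by blast
      also have "\<dots> = (\<Sum>i<n. g i y * v i k y) - (\<Sum>i<n. g i y * v i k\<^sub>0 y) / p y * v n k y"
        unfolding v'_def
        by (simp add: right_diff_distrib sum_subtractf sum_distrib_right sum_divide_distrib mult.assoc)
      finally have "w k y = (\<Sum>i<n. g i y * v i k y)
          + (w k\<^sub>0 y - (\<Sum>i<n. g i y * v i k\<^sub>0 y)) / p y * v n k y"
        by (simp add: diff_divide_distrib left_diff_distrib)
      then show ?thesis by (simp add: g'_def)
    qed
    ultimately show ?thesis using V(1,2) subset_trans[OF V(3) U'(3)]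
      by (intro exI[of _ V] exI[of _ g']) auto
  qed
qed

section \<open>Manifolds in charts\<close>

lemma chart_inv_image:
  "y \<in> snd c ` fst c \<Longrightarrow> chart_inv c y \<in> fst c \<and> snd c (chart_inv c y) = y"
  by (metis f_inv_into_f inv_into_into)

text \<open>The position is the last argument, so that fixing w leaves the function to be
  differentiated; it is the function whose smoothness \<open>vector_valued_oneforms\<close>
  demands.\<close>

definition tensor_comp ::
    "('a, 'e::real_inner) chart set \<Rightarrow> ('a, 'e) tensor11 \<Rightarrow> ('a, 'e) chart \<Rightarrow> 'e \<Rightarrow> 'e \<Rightarrow> 'e"
  where "tensor_comp A r c w = (\<lambda>y. r (chart_inv c y) (tangent_of A c (chart_inv c y) w) c)"

locale manifold =
  fixes A :: "('a::{t2_space, second_countable_topology}, 'e::real_inner) chart set"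
  assumes atlas: "smooth_atlas A"
begin

lemma fin_dim_model: "fin_dim TYPE('e)"
  using atlas by (auto simp: smooth_atlas_def fin_dim_def)

lemma open_chart: "c \<in> A \<Longrightarrow> open (fst c)"
  using atlas by (auto simp: smooth_atlas_def)

lemma chart_homeomorphism:
  "c \<in> A \<Longrightarrow> homeomorphism (fst c) (snd c ` fst c) (snd c) (chart_inv c)"
  using atlas unfolding smooth_atlas_def by blast

lemma chart_inv_chart [simp]: "c \<in> A \<Longrightarrow> p \<in> fst c \<Longrightarrow> chart_inv c (snd c p) = p"
  using chart_homeomorphism[of c] by (auto simp: homeomorphism_def)

lemma open_chart_image:
  assumes "c \<in> A" "open U"
  shows "open (snd c ` (fst c \<inter> U))"
proof -
  have o: "open (snd c ` fst c)" using atlas assms by (auto simp: smooth_atlas_def)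
  have "openin (top_of_set (snd c ` fst c)) (snd c ` (fst c \<inter> U))"
    by (rule homeomorphism_imp_open_map[OF chart_homeomorphism[OF assms(1)]])
      (use assms openin_open in blast)
  then show ?thesis using o openin_open_trans by blast
qed

lemma open_chart_image': "c \<in> A \<Longrightarrow> open (snd c ` fst c)"
  using open_chart_image[of c UNIV] by simp

lemma chart_inv_in:
  "c \<in> A \<Longrightarrow> y \<in> snd c ` (fst c \<inter> U) \<Longrightarrow> chart_inv c y \<in> fst c \<and> chart_inv c y \<in> U"
  by auto

lemma some_chart: "some_chart_at A p \<in> charts_at A p"
proof -
  have "\<exists>c. c \<in> charts_at A p"
    using atlas unfolding smooth_atlas_def charts_at_def by blast
  then show ?thesis unfolding some_chart_at_def by (rule someI_ex)
qed

lemma charts_at_iff: "c \<in> charts_at A p \<longleftrightarrow> c \<in> A \<and> p \<in> fst c"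
  by (simp add: charts_at_def)

section \<open>Transition maps and the component description of tangent vectors and
  covectors\<close>

lemma smooth_transition:
  "c \<in> A \<Longrightarrow> d \<in> A \<Longrightarrow> smooth_on (snd c ` (fst c \<inter> fst d)) (snd d \<circ> chart_inv c)"
  using atlas by (auto simp: smooth_atlas_def)

lemma transition_has_derivative:
  assumes "c \<in> charts_at A p" "d \<in> charts_at A p"
  shows "(snd d \<circ> chart_inv c has_derivative fd (snd d \<circ> chart_inv c) (snd c p)) (at (snd c p))"
  using assms by (intro smooth_on_has_derivative[OF smooth_transition]) (auto simp: charts_at_iff)

lemma linear_transition:
  "c \<in> charts_at A p \<Longrightarrow> d \<in> charts_at A p \<Longrightarrow> linear (fd (snd d \<circ> chart_inv c) (snd c p))"
  by (rule has_derivative_linear[OF transition_has_derivative])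

lemma transition_self:
  assumes "c \<in> charts_at A p"
  shows "fd (snd c \<circ> chart_inv c) (snd c p) w = w"
proof -
  have c: "c \<in> A" "p \<in> fst c" using assms by (auto simp: charts_at_iff)
  have "fd (snd c \<circ> chart_inv c) (snd c p) = fd (\<lambda>y. y) (snd c p)"
    by (rule frechet_derivative_cong_open[OF open_chart_image'[OF c(1)]]) (use c in \<open>auto simp: chart_inv_image\<close>)
  then show ?thesis by simp
qed

text \<open>The cocycle law, by the chain rule. It makes the families produced by
  \<open>tangent_of\<close> obey the transformation law of tangent vectors.\<close>

lemma transition_compose:
  assumes "c \<in> charts_at A p" "d \<in> charts_at A p" "e \<in> charts_at A p"
  shows "fd (snd e \<circ> chart_inv d) (snd d p) (fd (snd d \<circ> chart_inv c) (snd c p) w)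
    = fd (snd e \<circ> chart_inv c) (snd c p) w"
proof -
  have c: "c \<in> A" "p \<in> fst c" "d \<in> A" "p \<in> fst d" "e \<in> A" using assms by (auto simp: charts_at_iff)
  have dp: "(snd d \<circ> chart_inv c) (snd c p) = snd d p" using c by simp
  have "(snd e \<circ> chart_inv d has_derivative fd (snd e \<circ> chart_inv d) (snd d p))
      (at ((snd d \<circ> chart_inv c) (snd c p)))"
    unfolding dp by (rule transition_has_derivative[OF assms(2,3)])
  from diff_chain_at[OF transition_has_derivative[OF assms(1,2)] this]
  have "((snd e \<circ> chart_inv d) \<circ> (snd d \<circ> chart_inv c) has_derivative
    fd (snd e \<circ> chart_inv d) (snd d p) \<circ> fd (snd d \<circ> chart_inv c) (snd c p)) (at (snd c p))" .
  then have "(snd e \<circ> chart_inv c has_derivative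
    fd (snd e \<circ> chart_inv d) (snd d p) \<circ> fd (snd d \<circ> chart_inv c) (snd c p)) (at (snd c p))"
    by (rule has_derivative_transform_within_open[OF _ open_chart_image[OF c(1) open_chart[OF c(3)]]])
      (use c in auto)
  then show ?thesis by (simp add: frechet_derivative_eq)
qed

lemma tangent_of_self: "c \<in> charts_at A p \<Longrightarrow> tangent_of A c p w c = w"
  by (simp add: tangent_of_def transition_self)

lemma tangent_space_change:
  assumes "v \<in> tangent_space A p" "c \<in> charts_at A p" "d \<in> charts_at A p"
  shows "v d = fd (snd d \<circ> chart_inv c) (snd c p) (v c)"
  using assms unfolding tangent_space_def by blast

lemma tangent_space_off_charts:
  "v \<in> tangent_space A p \<Longrightarrow> c \<notin> charts_at A p \<Longrightarrow> v c = 0"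
  unfolding tangent_space_def by blast

lemma tangent_spaceI:
  assumes "\<And>c. c \<notin> charts_at A p \<Longrightarrow> v c = 0"
    and "\<And>c d. c \<in> charts_at A p \<Longrightarrow> d \<in> charts_at A p \<Longrightarrow>
      v d = fd (snd d \<circ> chart_inv c) (snd c p) (v c)"
  shows "v \<in> tangent_space A p"
  using assms unfolding tangent_space_def by blast

lemma tangent_of_in: "c \<in> charts_at A p \<Longrightarrow> tangent_of A c p w \<in> tangent_space A p"
  by (rule tangent_spaceI) (simp_all add: tangent_of_def transition_compose)

lemma tangent_of_component:
  assumes "c \<in> charts_at A p" "v \<in> tangent_space A p"
  shows "tangent_of A c p (v c) = v"
proof
  fix d
  show "tangent_of A c p (v c) d = v d"
    using tangent_space_change[OF assms(2,1), of d] tangent_space_off_charts[OF assms(2), of d]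
    by (simp add: tangent_of_def)
qed

lemma tangent_of_change:
  assumes "c \<in> charts_at A p" "d \<in> charts_at A p"
  shows "tangent_of A d p (fd (snd d \<circ> chart_inv c) (snd c p) w) = tangent_of A c p w"
  using tangent_of_component[OF assms(2) tangent_of_in[OF assms(1), of w]] assms
  by (simp add: tangent_of_def)

lemma linear_tangent_of:
  assumes "c \<in> charts_at A p"
  shows "linear (tangent_of A c p)"
proof -
  note l = linear_transition[OF assms]
  show ?thesis
    by (intro linearI ext) (simp_all add: tangent_of_def scaleR_fun_def linear_add[OF l] linear_cmul[OF l])
qed

lemma tangent_space_add:
  assumes "v \<in> tangent_space A p" "w \<in> tangent_space A p"
  shows "v + w \<in> tangent_space A p"
proof (rule tangent_spaceI)
  fix c d assume "c \<in> charts_at A p" "d \<in> charts_at A p"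
  then show "(v + w) d = fd (snd d \<circ> chart_inv c) (snd c p) ((v + w) c)"
    using assms[THEN tangent_space_change, of c d] by (simp add: linear_add[OF linear_transition])
qed (simp add: assms[THEN tangent_space_off_charts])

lemma tangent_space_scaleR:
  assumes "v \<in> tangent_space A p"
  shows "a *\<^sub>R v \<in> tangent_space A p"
proof (rule tangent_spaceI)
  fix c d assume "c \<in> charts_at A p" "d \<in> charts_at A p"
  then show "(a *\<^sub>R v) d = fd (snd d \<circ> chart_inv c) (snd c p) ((a *\<^sub>R v) c)"
    using tangent_space_change[OF assms, of c d]
    by (simp add: scaleR_fun_def linear_cmul[OF linear_transition])
qed (simp add: scaleR_fun_def tangent_space_off_charts[OF assms])

lemma tangent_space_zero: "0 \<in> tangent_space A p"
  by (rule tangent_spaceI) (simp_all add: linear_0[OF linear_transition])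

lemma tangent_space_diff:
  "v \<in> tangent_space A p \<Longrightarrow> w \<in> tangent_space A p \<Longrightarrow> v - w \<in> tangent_space A p"
  using tangent_space_add[of v p "(- 1) *\<^sub>R w"] tangent_space_scaleR[of w p "- 1"] by simp

lemma linear_on_set_component:
  assumes "c \<in> charts_at A p" "linear_on_set (tangent_space A p) f"
  shows "linear (\<lambda>w. f (tangent_of A c p w))"
  using assms(2) tangent_of_in[OF assms(1)] unfolding linear_on_set_def
  by (intro linearI)
    (simp_all add: linear_add[OF linear_tangent_of[OF assms(1)]] linear_cmul[OF linear_tangent_of[OF assms(1)]])

lemma linear_covector:
  "c \<in> charts_at A p \<Longrightarrow> \<alpha> \<in> cotangent_space A p \<Longrightarrow> linear (\<lambda>w. \<alpha> (tangent_of A c p w))"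
  by (rule linear_on_set_component) (auto simp: cotangent_space_def)

lemma covector_component:
  "c \<in> charts_at A p \<Longrightarrow> v \<in> tangent_space A p \<Longrightarrow> \<alpha> (tangent_of A c p (v c)) = \<alpha> v"
  by (simp add: tangent_of_component)

lemma cotangent_spaceI:
  assumes "c \<in> charts_at A p" "linear f" "\<And>v. v \<in> tangent_space A p \<Longrightarrow> \<alpha> v = f (v c)"
    and "\<And>v. v \<notin> tangent_space A p \<Longrightarrow> \<alpha> v = 0"
  shows "\<alpha> \<in> cotangent_space A p"
  unfolding cotangent_space_def linear_on_set_def
proof (intro CollectI conjI ballI allI impI)
  fix v w assume "v \<in> tangent_space A p" "w \<in> tangent_space A p"
  then show "\<alpha> (v + w) = \<alpha> v + \<alpha> w"
    by (simp add: assms(3) tangent_space_add linear_add[OF assms(2)])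
next
  fix a v assume v: "v \<in> tangent_space A p"
  have "\<alpha> (a *\<^sub>R v) = f ((a *\<^sub>R v) c)" by (rule assms(3)[OF tangent_space_scaleR[OF v]])
  then show "\<alpha> (a *\<^sub>R v) = a *\<^sub>R \<alpha> v"
    by (simp add: assms(3)[OF v] scaleR_fun_def linear_cmul[OF assms(2)])
qed (rule assms(4))

subsection \<open>Vector fields, 1-forms and tensors in a chart\<close>

lemma vfield_comp_at: "c \<in> charts_at A p \<Longrightarrow> vfield_comp X c (snd c p) = X p c"
  by (simp add: vfield_comp_def charts_at_iff)

lemma oneform_comp_at: "c \<in> charts_at A p \<Longrightarrow> oneform_comp A \<alpha> c w (snd c p) = \<alpha> p (tangent_of A c p w)"
  by (simp add: oneform_comp_def charts_at_iff)

lemma tensor_comp_at: "c \<in> charts_at A p \<Longrightarrow> tensor_comp A r c w (snd c p) = r p (tangent_of A c p w) c"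
  by (simp add: tensor_comp_def charts_at_iff)

lemma chart_image_cases:
  assumes "c \<in> A" "y \<in> snd c ` (fst c \<inter> U)"
  obtains p where "p \<in> U" "c \<in> charts_at A p" "y = snd c p" "chart_inv c y = p"
  using assms by (auto simp: charts_at_iff)

lemma chart_image_cases':
  assumes "c \<in> A" "y \<in> snd c ` fst c"
  obtains p where "c \<in> charts_at A p" "y = snd c p" "chart_inv c y = p"
  using assms by (auto simp: charts_at_iff)

lemma vfields_onD:
  "X \<in> vfields_on A U \<Longrightarrow> p \<in> U \<Longrightarrow> X p \<in> tangent_space A p"
  "X \<in> vfields_on A U \<Longrightarrow> c \<in> A \<Longrightarrow> smooth_on (snd c ` (fst c \<inter> U)) (vfield_comp X c)"
  by (auto simp: vfields_on_def)

lemma oneforms_onD: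
  "\<alpha> \<in> oneforms_on A U \<Longrightarrow> p \<in> U \<Longrightarrow> \<alpha> p \<in> cotangent_space A p"
  "\<alpha> \<in> oneforms_on A U \<Longrightarrow> c \<in> A \<Longrightarrow> smooth_on (snd c ` (fst c \<inter> U)) (oneform_comp A \<alpha> c w)"
  by (auto simp: oneforms_on_def)

lemma linear_oneform_comp:
  assumes "\<alpha> \<in> oneforms_on A U" "c \<in> A" "y \<in> snd c ` (fst c \<inter> U)"
  shows "linear (\<lambda>w. oneform_comp A \<alpha> c w y)"
proof -
  obtain p where p: "p \<in> U" "c \<in> charts_at A p" "y = snd c p"
    using chart_image_cases[OF assms(2,3)] by metis
  show ?thesis unfolding p(3) oneform_comp_at[OF p(2)]
    by (rule linear_covector[OF p(2) oneforms_onD(1)[OF assms(1) p(1)]])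
qed

lemma tensorD:
  assumes "r \<in> vector_valued_oneforms A"
  shows "v \<in> tangent_space A p \<Longrightarrow> r p v \<in> tangent_space A p"
    "linear_on_set (tangent_space A p) (r p)"
    "c \<in> A \<Longrightarrow> smooth_on (snd c ` fst c) (tensor_comp A r c w)"
  using assms by (auto simp: vector_valued_oneforms_def tensor_comp_def image_subset_iff)

lemma linear_tensor:
  assumes "r \<in> vector_valued_oneforms A" "c \<in> charts_at A p"
  shows "linear (\<lambda>w. r p (tangent_of A c p w) c)"
proof -
  note l = linear_on_set_component[OF assms(2) tensorD(2)[OF assms(1)]]
  show ?thesis
    by (rule linearI) (simp_all add: linear_add[OF l] linear_cmul[OF l] scaleR_fun_def)
qed

lemma linear_tensor_comp:
  assumes "r \<in> vector_valued_oneforms A" "c \<in> A" "y \<in> snd c ` fst c"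
  shows "linear (\<lambda>w. tensor_comp A r c w y)"
proof -
  obtain p where p: "c \<in> charts_at A p" "y = snd c p"
    using chart_image_cases'[OF assms(2,3)] by metis
  show ?thesis unfolding p(2) tensor_comp_at[OF p(1)] by (rule linear_tensor[OF assms(1) p(1)])
qed

lemma vfield_differentiable:
  assumes "X \<in> vfields_on A UNIV" "c \<in> charts_at A p"
  shows "(vfield_comp X c has_derivative fd (vfield_comp X c) (snd c p)) (at (snd c p))"
  by (rule smooth_on_has_derivative[OF vfields_onD(2)[OF assms(1)]])
    (use assms in \<open>auto simp: charts_at_iff\<close>)

lemma oneform_differentiable:
  assumes "\<alpha> \<in> oneforms_on A UNIV" "c \<in> charts_at A p"
  shows "oneform_comp A \<alpha> c w differentiable (at (snd c p))"
  by (rule smooth_on_differentiable[OF oneforms_onD(2)[OF assms(1)]])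
    (use assms in \<open>auto simp: charts_at_iff\<close>)

lemma tensor_differentiable:
  assumes "r \<in> vector_valued_oneforms A" "c \<in> charts_at A p"
  shows "tensor_comp A r c w differentiable (at (snd c p))"
  by (rule smooth_on_differentiable[OF tensorD(3)[OF assms(1)]])
    (use assms in \<open>auto simp: charts_at_iff\<close>)

lemma smooth_on_oneform_apply:
  assumes "\<alpha> \<in> oneforms_on A U" "c \<in> A" "open U" "smooth_on (snd c ` (fst c \<inter> U)) X"
  shows "smooth_on (snd c ` (fst c \<inter> U)) (\<lambda>y. oneform_comp A \<alpha> c (X y) y)"
  by (rule smooth_on_linear_apply[where G = "\<lambda>y w. oneform_comp A \<alpha> c w y", OF fin_dim_model
        open_chart_image[OF assms(2,3)] linear_oneform_comp[OF assms(1,2)] oneforms_onD(2)[OF assms(1,2)] assms(4)])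

lemma smooth_on_tensor_apply:
  assumes "r \<in> vector_valued_oneforms A" "c \<in> A" "smooth_on (snd c ` fst c) X"
  shows "smooth_on (snd c ` fst c) (\<lambda>y. tensor_comp A r c (X y) y)"
  by (rule smooth_on_linear_apply[where G = "\<lambda>y w. tensor_comp A r c w y", OF fin_dim_model
        open_chart_image'[OF assms(2)] linear_tensor_comp[OF assms(1,2)] tensorD(3)[OF assms(1,2)] assms(3)])

lemma has_derivative_oneform_apply:
  assumes "\<alpha> \<in> oneforms_on A UNIV" "c \<in> charts_at A p" "(X has_derivative X') (at (snd c p))"
  shows "((\<lambda>y. oneform_comp A \<alpha> c (X y) y) has_derivative (\<lambda>h.
    fd (oneform_comp A \<alpha> c (X (snd c p))) (snd c p) h + \<alpha> p (tangent_of A c p (X' h)))) (at (snd c p))"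
proof -
  have c: "c \<in> A" "p \<in> fst c" using assms(2) by (auto simp: charts_at_iff)
  have "((\<lambda>y. oneform_comp A \<alpha> c (X y) y) has_derivative (\<lambda>h.
      fd (\<lambda>y. oneform_comp A \<alpha> c (X (snd c p)) y) (snd c p) h + oneform_comp A \<alpha> c (X' h) (snd c p)))
      (at (snd c p))"
    using c assms(1)
    by (intro has_derivative_linear_apply[where G = "\<lambda>y w. oneform_comp A \<alpha> c w y", OF fin_dim_model
          open_chart_image'[OF c(1)]] oneform_differentiable assms) (auto intro: linear_oneform_comp[where U = UNIV])
  then show ?thesis by (simp add: oneform_comp_at[OF assms(2)])
qed

lemma has_derivative_tensor_apply:
  assumes "r \<in> vector_valued_oneforms A" "c \<in> charts_at A p" "(X has_derivative X') (at (snd c p))"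
  shows "((\<lambda>y. tensor_comp A r c (X y) y) has_derivative (\<lambda>h.
    fd (tensor_comp A r c (X (snd c p))) (snd c p) h + r p (tangent_of A c p (X' h)) c)) (at (snd c p))"
proof -
  have c: "c \<in> A" "p \<in> fst c" using assms(2) by (auto simp: charts_at_iff)
  have "((\<lambda>y. tensor_comp A r c (X y) y) has_derivative (\<lambda>h.
      fd (\<lambda>y. tensor_comp A r c (X (snd c p)) y) (snd c p) h + tensor_comp A r c (X' h) (snd c p)))
      (at (snd c p))"
    using c assms(1)
    by (intro has_derivative_linear_apply[where G = "\<lambda>y w. tensor_comp A r c w y", OF fin_dim_model
          open_chart_image'[OF c(1)]] tensor_differentiable assms) (auto intro: linear_tensor_comp)
  then show ?thesis by (simp add: tensor_comp_at[OF assms(2)])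
qed

lemma vfield_comp_change:
  assumes "X \<in> vfields_on A UNIV" "c \<in> A" "d \<in> A" "y \<in> snd c ` (fst c \<inter> fst d)"
  shows "vfield_comp X d ((snd d \<circ> chart_inv c) y) = fd (snd d \<circ> chart_inv c) y (vfield_comp X c y)"
proof -
  obtain p where p: "p \<in> fst d" "c \<in> charts_at A p" "y = snd c p" "chart_inv c y = p"
    using chart_image_cases[OF assms(2,4)] by metis
  then have d: "d \<in> charts_at A p" using assms by (simp add: charts_at_iff)
  show ?thesis using tangent_space_change[OF vfields_onD(1)[OF assms(1)] p(2) d] p assms(3)
    by (simp add: vfield_comp_def charts_at_iff)
qed

lemma oneform_comp_change:
  assumes "c \<in> A" "d \<in> A" "y \<in> snd c ` (fst c \<inter> fst d)"
  shows "oneform_comp A \<alpha> c w y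
    = oneform_comp A \<alpha> d (fd (snd d \<circ> chart_inv c) y w) ((snd d \<circ> chart_inv c) y)"
proof -
  obtain p where p: "p \<in> fst d" "c \<in> charts_at A p" "y = snd c p" "chart_inv c y = p"
    using chart_image_cases[OF assms(1,3)] by metis
  then have d: "d \<in> charts_at A p" using assms by (simp add: charts_at_iff)
  show ?thesis using p d tangent_of_change[OF p(2) d, of w]
    by (simp add: oneform_comp_def charts_at_iff)
qed

lemma vfields_on_diff:
  assumes "open U" "X \<in> vfields_on A U" "Y \<in> vfields_on A U"
  shows "X - Y \<in> vfields_on A U"
proof -
  have "vfield_comp (X - Y) c = (\<lambda>y. vfield_comp X c y - vfield_comp Y c y)" for c
    by (simp add: vfield_comp_def)
  then show ?thesis using assms unfolding vfields_on_def
    by (auto intro!: tangent_space_diff smooth_on_diff open_chart_image)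
qed

lemma cotangent_space_diff:
  "\<alpha> \<in> cotangent_space A p \<Longrightarrow> \<beta> \<in> cotangent_space A p \<Longrightarrow> \<alpha> - \<beta> \<in> cotangent_space A p"
  by (auto simp: cotangent_space_def linear_on_set_def algebra_simps)

lemma cotangent_space_scaleR:
  "\<alpha> \<in> cotangent_space A p \<Longrightarrow> a *\<^sub>R \<alpha> \<in> cotangent_space A p"
  by (auto simp: cotangent_space_def linear_on_set_def scaleR_fun_def algebra_simps)

lemma cotangent_space_zero: "0 \<in> cotangent_space A p"
  by (auto simp: cotangent_space_def linear_on_set_def)

lemma oneforms_on_diff:
  assumes "open U" "\<alpha> \<in> oneforms_on A U" "\<beta> \<in> oneforms_on A U"
  shows "\<alpha> - \<beta> \<in> oneforms_on A U"
proof -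
  have "oneform_comp A (\<alpha> - \<beta>) c w = (\<lambda>y. oneform_comp A \<alpha> c w y - oneform_comp A \<beta> c w y)" for c w
    by (simp add: oneform_comp_def)
  then show ?thesis using assms unfolding oneforms_on_def
    by (auto intro!: cotangent_space_diff smooth_on_diff open_chart_image)
qed

lemma vfield_comp_app:
  assumes "X \<in> vfields_on A UNIV" "c \<in> A" "y \<in> snd c ` fst c"
  shows "vfield_comp (app_vfield r X) c y = tensor_comp A r c (vfield_comp X c y) y"
proof -
  obtain p where p: "c \<in> charts_at A p" "y = snd c p" "chart_inv c y = p"
    using chart_image_cases'[OF assms(2,3)] by metis
  show ?thesis using tangent_of_component[OF p(1) vfields_onD(1)[OF assms(1)]] p
    by (simp add: vfield_comp_def tensor_comp_def app_vfield_def)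
qed

lemma app_vfield_vfields:
  assumes "r \<in> vector_valued_oneforms A" "X \<in> vfields_on A UNIV"
  shows "app_vfield r X \<in> vfields_on A UNIV"
  unfolding vfields_on_def
proof (intro CollectI conjI ballI)
  fix p show "app_vfield r X p \<in> tangent_space A p"
    using assms by (simp add: app_vfield_def tensorD(1) vfields_onD(1))
next
  fix c assume c: "c \<in> A"
  have "smooth_on (snd c ` fst c) (\<lambda>y. tensor_comp A r c (vfield_comp X c y) y)"
    using smooth_on_tensor_apply[OF assms(1) c] vfields_onD(2)[OF assms(2) c] by simp
  then show "smooth_on (snd c ` (fst c \<inter> UNIV)) (vfield_comp (app_vfield r X) c)"
    using smooth_on_cong[OF _ open_chart_image'[OF c] vfield_comp_app[OF assms(2) c]] by simp
qed

lemma dual_map_tangent_of: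
  "c \<in> charts_at A p \<Longrightarrow> dual_map A r p \<alpha> (tangent_of A c p w) = \<alpha> (r p (tangent_of A c p w))"
  by (simp add: dual_map_def restrict0_def tangent_of_in)

lemma dual_map_cotangent:
  assumes "r \<in> vector_valued_oneforms A" "\<alpha> \<in> cotangent_space A p"
  shows "dual_map A r p \<alpha> \<in> cotangent_space A p"
  using assms tensorD(1,2)[OF assms(1), where p = p]
  by (auto simp: cotangent_space_def linear_on_set_def dual_map_def restrict0_def
      tangent_space_add tangent_space_scaleR)

lemma oneform_comp_dual:
  assumes "r \<in> vector_valued_oneforms A" "c \<in> A" "y \<in> snd c ` fst c"
  shows "oneform_comp A (\<lambda>p. dual_map A r p (\<alpha> p)) c w y = oneform_comp A \<alpha> c (tensor_comp A r c w y) y"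
proof -
  obtain p where p: "c \<in> charts_at A p" "y = snd c p" "chart_inv c y = p"
    using chart_image_cases'[OF assms(2,3)] by metis
  show ?thesis
    using tangent_of_component[OF p(1) tensorD(1)[OF assms(1) tangent_of_in[OF p(1)]], of w] p
    by (simp add: oneform_comp_def tensor_comp_def dual_map_tangent_of)
qed

lemma dual_map_oneforms:
  assumes "r \<in> vector_valued_oneforms A" "\<alpha> \<in> oneforms_on A UNIV"
  shows "(\<lambda>p. dual_map A r p (\<alpha> p)) \<in> oneforms_on A UNIV"
  unfolding oneforms_on_def
proof (intro CollectI conjI ballI allI)
  fix p show "dual_map A r p (\<alpha> p) \<in> cotangent_space A p"
    using assms by (simp add: dual_map_cotangent oneforms_onD(1))
next
  fix c w assume c: "c \<in> A"
  have "smooth_on (snd c ` fst c) (\<lambda>y. oneform_comp A \<alpha> c (tensor_comp A r c w y) y)"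
    using smooth_on_oneform_apply[OF assms(2) c open_UNIV, of "tensor_comp A r c w"]
      tensorD(3)[OF assms(1) c] by simp
  then show "smooth_on (snd c ` (fst c \<inter> UNIV)) (oneform_comp A (\<lambda>p. dual_map A r p (\<alpha> p)) c w)"
    using smooth_on_cong[OF _ open_chart_image'[OF c] oneform_comp_dual[OF assms(1) c]] by simp
qed

subsection \<open>Lie brackets and Lie derivatives\<close>

text \<open>The transformation law of a vector field is differentiated once by the chain rule and
  once by the product rule. The second derivative of the transition map shows that the coordinate
  derivative of a field is not a tensor; in invariant expressions these terms have to
  cancel.\<close>

lemma vfield_derivative_change:
  assumes "X \<in> vfields_on A UNIV" "c \<in> charts_at A p" "d \<in> charts_at A p"
  shows "fd (vfield_comp X d) (snd d p) (fd (snd d \<circ> chart_inv c) (snd c p) h)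
    = fd (\<lambda>y. fd (snd d \<circ> chart_inv c) y (X p c)) (snd c p) h
      + fd (snd d \<circ> chart_inv c) (snd c p) (fd (vfield_comp X c) (snd c p) h)"
proof -
  define \<phi> where "\<phi> = snd d \<circ> chart_inv c"
  define S where "S = snd c ` (fst c \<inter> fst d)"
  have c: "c \<in> A" "p \<in> fst c" "d \<in> A" "p \<in> fst d" using assms by (auto simp: charts_at_iff)
  have S: "open S" "snd c p \<in> S" using c by (auto simp: S_def open_chart_image open_chart)
  have sm: "smooth_on S \<phi>" unfolding S_def \<phi>_def by (rule smooth_transition[OF c(1,3)])
  have \<phi>p: "\<phi> (snd c p) = snd d p" using c by (simp add: \<phi>_def)
  have "((\<lambda>y. fd \<phi> y (vfield_comp X c y)) has_derivative (\<lambda>h.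
      fd (\<lambda>y. fd \<phi> y (vfield_comp X c (snd c p))) (snd c p) h
      + fd \<phi> (snd c p) (fd (vfield_comp X c) (snd c p) h))) (at (snd c p))"
    by (rule has_derivative_linear_apply[where G = "fd \<phi>", OF fin_dim_model S])
      (use sm S assms vfield_differentiable in \<open>auto intro: smooth_on_linear_fd smooth_on_differentiable[OF smooth_on_fd]\<close>)
  then have "((\<lambda>y. vfield_comp X d (\<phi> y)) has_derivative (\<lambda>h.
      fd (\<lambda>y. fd \<phi> y (vfield_comp X c (snd c p))) (snd c p) h
      + fd \<phi> (snd c p) (fd (vfield_comp X c) (snd c p) h))) (at (snd c p))"
    by (rule has_derivative_transform_within_open[OF _ S])
      (use vfield_comp_change[OF assms(1) c(1,3)] in \<open>simp add: \<phi>_def S_def\<close>)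
  moreover have "((\<lambda>y. vfield_comp X d (\<phi> y)) has_derivative
      (\<lambda>h. fd (vfield_comp X d) (snd d p) (fd \<phi> (snd c p) h))) (at (snd c p))"
    by (rule has_derivative_compose[where f = \<phi> and g = "vfield_comp X d",
        OF smooth_on_has_derivative[OF sm S(2)] vfield_differentiable[OF assms(1,3), folded \<phi>p],
        unfolded \<phi>p])
  ultimately have "(\<lambda>h. fd (\<lambda>y. fd \<phi> y (vfield_comp X c (snd c p))) (snd c p) h
      + fd \<phi> (snd c p) (fd (vfield_comp X c) (snd c p) h))
    = (\<lambda>h. fd (vfield_comp X d) (snd d p) (fd \<phi> (snd c p) h))"
    by (rule has_derivative_unique)
  from fun_cong[OF this, of h] show ?thesis
    by (simp add: vfield_comp_at[OF assms(2)] \<phi>_def)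
qed

lemma transition_second_derivative_commute:
  assumes "c \<in> charts_at A p" "d \<in> charts_at A p"
  shows "fd (\<lambda>y. fd (snd d \<circ> chart_inv c) y u) (snd c p) v
    = fd (\<lambda>y. fd (snd d \<circ> chart_inv c) y v) (snd c p) u"
  by (rule smooth_on_fd_commute[OF _ _ smooth_transition[of c d]])
    (use assms in \<open>auto simp: charts_at_iff open_chart_image open_chart\<close>)

text \<open>Each of the two derivatives contributes the second derivative of the transition map at
  \<open>X p c\<close> and \<open>Y p c\<close>; by symmetry these contributions cancel in the
  difference.\<close>

lemma lie_bracket_tangent:
  assumes "X \<in> vfields_on A UNIV" "Y \<in> vfields_on A UNIV"
  shows "lie_bracket A X Y p \<in> tangent_space A p"
proof (rule tangent_spaceI)
  fix c assume "c \<notin> charts_at A p"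
  then show "lie_bracket A X Y p c = 0" by (simp add: lie_bracket_def)
next
  fix c d assume cd: "c \<in> charts_at A p" "d \<in> charts_at A p"
  have "Z p d = fd (snd d \<circ> chart_inv c) (snd c p) (Z p c)" if "Z \<in> vfields_on A UNIV" for Z
    by (rule tangent_space_change[OF vfields_onD(1)[OF that UNIV_I] cd])
  note ch = this
  show "lie_bracket A X Y p d = fd (snd d \<circ> chart_inv c) (snd c p) (lie_bracket A X Y p c)"
    unfolding lie_bracket_def ch[OF assms(1)] ch[OF assms(2)]
      vfield_derivative_change[OF assms(1) cd] vfield_derivative_change[OF assms(2) cd]
    using cd transition_second_derivative_commute[OF cd, of "X p c" "Y p c"]
    by (simp add: linear_diff[OF linear_transition])
qed

lemma lie_bracket_vfields:
  assumes "X \<in> vfields_on A UNIV" "Y \<in> vfields_on A UNIV"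
  shows "lie_bracket A X Y \<in> vfields_on A UNIV"
  unfolding vfields_on_def
proof (intro CollectI conjI ballI)
  fix p show "lie_bracket A X Y p \<in> tangent_space A p" by (rule lie_bracket_tangent[OF assms])
next
  fix c assume c: "c \<in> A"
  have sm: "smooth_on (snd c ` fst c) (vfield_comp Z c)" if "Z \<in> vfields_on A UNIV" for Z
    using vfields_onD(2)[OF that c] by simp
  note o = open_chart_image'[OF c]
  have "smooth_on (snd c ` fst c) (\<lambda>y. fd (vfield_comp Y c) y (vfield_comp X c y)
      - fd (vfield_comp X c) y (vfield_comp Y c y))"
    by (intro smooth_on_diff o smooth_on_fd_apply[OF fin_dim_model o] sm assms)
  then have "smooth_on (snd c ` fst c) (vfield_comp (lie_bracket A X Y) c)"
    by (rule smooth_on_cong[OF _ o])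
      (use c in \<open>auto simp: vfield_comp_def lie_bracket_def charts_at_iff\<close>)
  then show "smooth_on (snd c ` (fst c \<inter> UNIV)) (vfield_comp (lie_bracket A X Y) c)" by simp
qed

text \<open>What remains of Cartan's formula after the derivative of \<alpha> in direction w,
  present in both of its terms with opposite signs, has cancelled. The chart c is free here, whereas
  \<open>lie_deriv\<close> uses a chosen one.\<close>

definition lie_deriv_comp ::
    "('a, 'e) vfield \<Rightarrow> ('a, 'e) oneform \<Rightarrow> ('a, 'e) chart \<Rightarrow> 'a \<Rightarrow> 'e \<Rightarrow> real"
  where "lie_deriv_comp X \<alpha> c p w = fd (oneform_comp A \<alpha> c w) (snd c p) (X p c)
    + \<alpha> p (tangent_of A c p (fd (vfield_comp X c) (snd c p) w))"

text \<open>The chart chosen in \<open>lie_deriv\<close> varies with the point without any control,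
  so smoothness can only be seen after passing to a fixed chart. The second derivative of the
  transition map enters once through \<alpha> and once through X, with opposite signs.\<close>

lemma lie_deriv_comp_change:
  assumes X: "X \<in> vfields_on A UNIV" and \<alpha>: "\<alpha> \<in> oneforms_on A UNIV"
    and cd: "c \<in> charts_at A p" "d \<in> charts_at A p"
  shows "lie_deriv_comp X \<alpha> c p w = lie_deriv_comp X \<alpha> d p (fd (snd d \<circ> chart_inv c) (snd c p) w)"
proof -
  define \<phi> where "\<phi> = snd d \<circ> chart_inv c"
  define S where "S = snd c ` (fst c \<inter> fst d)"
  define P where "P = fd \<phi> (snd c p)"
  have c: "c \<in> A" "p \<in> fst c" "d \<in> A" "p \<in> fst d" using cd by (auto simp: charts_at_iff)
  have S: "open S" "snd c p \<in> S" using c by (auto simp: S_def open_chart_image open_chart)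
  have sm: "smooth_on S \<phi>" unfolding S_def \<phi>_def by (rule smooth_transition[OF c(1,3)])
  have \<phi>p: "\<phi> (snd c p) = snd d p" using c by (simp add: \<phi>_def)
  have \<phi>S: "\<phi> y \<in> snd d ` fst d" if "y \<in> S" for y using that c by (auto simp: S_def \<phi>_def)
  have d\<phi>: "(\<phi> has_derivative P) (at (snd c p))" unfolding P_def by (rule smooth_on_has_derivative[OF sm S(2)])
  have Xd: "X p d = P (X p c)"
    using tangent_space_change[OF vfields_onD(1)[OF X UNIV_I] cd] by (simp add: P_def \<phi>_def)
  have comp: "((\<lambda>y. oneform_comp A \<alpha> d u (\<phi> y)) has_derivative
      (\<lambda>h. fd (oneform_comp A \<alpha> d u) (snd d p) (P h))) (at (snd c p))" for u
    by (rule has_derivative_compose[where f = \<phi> and g = "oneform_comp A \<alpha> d u", OF d\<phi>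
        has_derivative_frechet[OF oneform_differentiable[OF \<alpha> cd(2)], folded \<phi>p], unfolded \<phi>p])
  have "((\<lambda>y. oneform_comp A \<alpha> d (fd \<phi> y w) (\<phi> y)) has_derivative
      (\<lambda>h. fd (\<lambda>y. oneform_comp A \<alpha> d (fd \<phi> (snd c p) w) (\<phi> y)) (snd c p) h
        + oneform_comp A \<alpha> d (fd (\<lambda>y. fd \<phi> y w) (snd c p) h) (\<phi> (snd c p)))) (at (snd c p))"
    by (rule has_derivative_linear_apply[where G = "\<lambda>y w. oneform_comp A \<alpha> d w (\<phi> y)", OF fin_dim_model S])
      (use linear_oneform_comp[OF \<alpha> c(3)] \<phi>S has_derivative_imp_differentiable[OF comp]
        smooth_on_has_derivative[OF smooth_on_fd[OF sm] S(2)] in auto)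
  then have "((\<lambda>y. oneform_comp A \<alpha> c w y) has_derivative
      (\<lambda>h. fd (\<lambda>y. oneform_comp A \<alpha> d (fd \<phi> (snd c p) w) (\<phi> y)) (snd c p) h
        + oneform_comp A \<alpha> d (fd (\<lambda>y. fd \<phi> y w) (snd c p) h) (\<phi> (snd c p)))) (at (snd c p))"
    by (rule has_derivative_transform_within_open[OF _ S])
      (use oneform_comp_change[OF c(1,3)] in \<open>simp add: \<phi>_def S_def\<close>)
  then have *: "fd (oneform_comp A \<alpha> c w) (snd c p) h = fd (oneform_comp A \<alpha> d (P w)) (snd d p) (P h)
      + \<alpha> p (tangent_of A d p (fd (\<lambda>y. fd \<phi> y w) (snd c p) h))" for h
    unfolding frechet_derivative_eq[OF comp] \<phi>p oneform_comp_at[OF cd(2)] P_def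
    by (simp add: frechet_derivative_eq)
  have "tangent_of A c p (fd (vfield_comp X c) (snd c p) w)
      = tangent_of A d p (P (fd (vfield_comp X c) (snd c p) w))"
    using tangent_of_change[OF cd] by (simp add: P_def \<phi>_def)
  also have "P (fd (vfield_comp X c) (snd c p) w)
      = fd (vfield_comp X d) (snd d p) (P w) - fd (\<lambda>y. fd \<phi> y (X p c)) (snd c p) w"
    using vfield_derivative_change[OF X cd, of w] by (simp add: P_def \<phi>_def)
  also have "fd (\<lambda>y. fd \<phi> y (X p c)) (snd c p) w = fd (\<lambda>y. fd \<phi> y w) (snd c p) (X p c)"
    using transition_second_derivative_commute[OF cd] by (simp add: \<phi>_def)
  finally have **: "\<alpha> p (tangent_of A c p (fd (vfield_comp X c) (snd c p) w))
      = \<alpha> p (tangent_of A d p (fd (vfield_comp X d) (snd d p) (P w)))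
      - \<alpha> p (tangent_of A d p (fd (\<lambda>y. fd \<phi> y w) (snd c p) (X p c)))"
    by (simp add: linear_diff[OF linear_covector[OF cd(2) oneforms_onD(1)[OF \<alpha>]]])
  show ?thesis
    unfolding lie_deriv_comp_def * ** Xd by (simp add: P_def \<phi>_def)
qed

text \<open>In the chosen chart, the product rule for \<alpha>(X) yields a derivative of \<alpha>
  along v that cancels one half of the exterior derivative. Invariance then allows any chart around
  p.\<close>

lemma lie_deriv_eq:
  assumes X: "X \<in> vfields_on A UNIV" and \<alpha>: "\<alpha> \<in> oneforms_on A UNIV"
    and c: "c \<in> charts_at A p" and v: "v \<in> tangent_space A p"
  shows "lie_deriv A X \<alpha> p v = lie_deriv_comp X \<alpha> c p (v c)"
proof -
  define d where "d = some_chart_at A p"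
  have d: "d \<in> charts_at A p" unfolding d_def by (rule some_chart)
  then have dA: "d \<in> A" "p \<in> fst d" by (auto simp: charts_at_iff)
  have "((\<lambda>y. oneform_comp A \<alpha> d (vfield_comp X d y) y) has_derivative (\<lambda>h.
      fd (oneform_comp A \<alpha> d (vfield_comp X d (snd d p))) (snd d p) h
      + \<alpha> p (tangent_of A d p (fd (vfield_comp X d) (snd d p) h)))) (at (snd d p))"
    by (rule has_derivative_oneform_apply[OF \<alpha> d vfield_differentiable[OF X d]])
  then have "((\<lambda>p. \<alpha> p (X p)) \<circ> chart_inv d has_derivative (\<lambda>h.
      fd (oneform_comp A \<alpha> d (vfield_comp X d (snd d p))) (snd d p) h
      + \<alpha> p (tangent_of A d p (fd (vfield_comp X d) (snd d p) h)))) (at (snd d p))"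
  proof (rule has_derivative_transform_within_open[OF _ open_chart_image'[OF dA(1)]])
    show "snd d p \<in> snd d ` fst d" using dA by simp
    fix y assume "y \<in> snd d ` fst d"
    then obtain q where q: "d \<in> charts_at A q" "y = snd d q" "chart_inv d y = q"
      using chart_image_cases'[OF dA(1)] by metis
    show "oneform_comp A \<alpha> d (vfield_comp X d y) y = ((\<lambda>p. \<alpha> p (X p)) \<circ> chart_inv d) y"
      using q tangent_of_component[OF q(1) vfields_onD(1)[OF X]]
      by (simp add: oneform_comp_def vfield_comp_def)
  qed
  then have "lie_deriv A X \<alpha> p v = lie_deriv_comp X \<alpha> d p (v d)"
    using v unfolding lie_deriv_def interior_ext_deriv_def differential_def ext_deriv_def
    by (simp add: restrict0_def Let_def d_def[symmetric] frechet_derivative_eq vfield_comp_at[OF d]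
        lie_deriv_comp_def)
  moreover have "v d = fd (snd d \<circ> chart_inv c) (snd c p) (v c)"
    by (rule tangent_space_change[OF v c d])
  ultimately show ?thesis using lie_deriv_comp_change[OF X \<alpha> c d] by simp
qed

lemma linear_lie_deriv_comp:
  assumes X: "X \<in> vfields_on A UNIV" and \<alpha>: "\<alpha> \<in> oneforms_on A UNIV" and c: "c \<in> charts_at A p"
  shows "linear (lie_deriv_comp X \<alpha> c p)"
proof -
  have cA: "c \<in> A" "p \<in> fst c" using c by (auto simp: charts_at_iff)
  have "linear (\<lambda>w. fd (oneform_comp A \<alpha> c w) (snd c p) (X p c))"
    by (rule linear_frechet_derivative_parameter[where G = "\<lambda>y w. oneform_comp A \<alpha> c w y",
          OF open_chart_image'[OF cA(1)]])
      (use linear_oneform_comp[OF \<alpha> cA(1)] oneform_differentiable[OF \<alpha> c] cA in auto)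
  moreover have "linear (\<lambda>w. \<alpha> p (tangent_of A c p (fd (vfield_comp X c) (snd c p) w)))"
    using linear_compose[OF has_derivative_linear[OF vfield_differentiable[OF X c]]
        linear_covector[OF c oneforms_onD(1)[OF \<alpha>]]] by (simp add: o_def)
  ultimately show ?thesis
    unfolding lie_deriv_comp_def by (rule linear_compose_add)
qed

lemma lie_deriv_oneforms:
  assumes X: "X \<in> vfields_on A UNIV" and \<alpha>: "\<alpha> \<in> oneforms_on A UNIV"
  shows "lie_deriv A X \<alpha> \<in> oneforms_on A UNIV"
  unfolding oneforms_on_def
proof (intro CollectI conjI ballI allI)
  fix p
  show "lie_deriv A X \<alpha> p \<in> cotangent_space A p"
  proof (rule cotangent_spaceI[OF some_chart linear_lie_deriv_comp[OF X \<alpha> some_chart]])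
    show "lie_deriv A X \<alpha> p v = lie_deriv_comp X \<alpha> (some_chart_at A p) p (v (some_chart_at A p))"
      if "v \<in> tangent_space A p" for v by (rule lie_deriv_eq[OF X \<alpha> some_chart that])
  qed (simp add: lie_deriv_def interior_ext_deriv_def differential_def restrict0_def)
next
  fix c w assume c: "c \<in> A"
  note o = open_chart_image'[OF c]
  have smX: "smooth_on (snd c ` fst c) (vfield_comp X c)" using vfields_onD(2)[OF X c] by simp
  have sm\<alpha>: "smooth_on (snd c ` fst c) (oneform_comp A \<alpha> c w)" using oneforms_onD(2)[OF \<alpha> c] by simp
  have "smooth_on (snd c ` fst c) (\<lambda>y. oneform_comp A \<alpha> c (fd (vfield_comp X c) y w) y)"
    using smooth_on_oneform_apply[OF \<alpha> c open_UNIV, of "\<lambda>y. fd (vfield_comp X c) y w"]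
      smooth_on_fd[OF smX] by simp
  then have "smooth_on (snd c ` fst c) (\<lambda>y. fd (oneform_comp A \<alpha> c w) y (vfield_comp X c y)
      + oneform_comp A \<alpha> c (fd (vfield_comp X c) y w) y)"
    by (intro smooth_on_add o smooth_on_fd_apply[OF fin_dim_model o] sm\<alpha> smX)
  then have "smooth_on (snd c ` fst c) (oneform_comp A (lie_deriv A X \<alpha>) c w)"
  proof (rule smooth_on_cong[OF _ o])
    fix y assume "y \<in> snd c ` fst c"
    then obtain p where p: "c \<in> charts_at A p" "y = snd c p" "chart_inv c y = p"
      using chart_image_cases'[OF c] by metis
    have "oneform_comp A (lie_deriv A X \<alpha>) c w y = lie_deriv_comp X \<alpha> c p w"
      unfolding p(2) oneform_comp_at[OF p(1)] lie_deriv_eq[OF X \<alpha> p(1) tangent_of_in[OF p(1)]]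
      by (simp add: tangent_of_self[OF p(1)])
    then show "oneform_comp A (lie_deriv A X \<alpha>) c w y = fd (oneform_comp A \<alpha> c w) y (vfield_comp X c y)
      + oneform_comp A \<alpha> c (fd (vfield_comp X c) y w) y"
      unfolding lie_deriv_comp_def p(2) oneform_comp_at[OF p(1)] vfield_comp_at[OF p(1)] .
  qed
  then show "smooth_on (snd c ` (fst c \<inter> UNIV)) (oneform_comp A (lie_deriv A X \<alpha>) c w)" by simp
qed

lemma D_op_vfields:
  "r \<in> vector_valued_oneforms A \<Longrightarrow> X \<in> vfields_on A UNIV \<Longrightarrow> Y \<in> vfields_on A UNIV \<Longrightarrow>
    D_op A r X Y \<in> vfields_on A UNIV"
  unfolding D_op_def by (intro vfields_on_diff open_UNIV lie_bracket_vfields app_vfield_vfields)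

lemma D_op_dual_oneforms:
  "r \<in> vector_valued_oneforms A \<Longrightarrow> X \<in> vfields_on A UNIV \<Longrightarrow> \<alpha> \<in> oneforms_on A UNIV \<Longrightarrow>
    D_op_dual A r X \<alpha> \<in> oneforms_on A UNIV"
  unfolding D_op_dual_def
  by (intro oneforms_on_diff open_UNIV lie_deriv_oneforms app_vfield_vfields dual_map_oneforms)

end

section \<open>The concomitant of a Dirac structure and a tensor in a chart\<close>

text \<open>
  This is the coordinate expression of the pairing of \<open>D\<^sub>X (Y, a)\<close> with \<open>(z, g)\<close>, where \<open>x, y\<close> are the values of
  \<open>X, Y\<close> and \<open>dR u w, dY u, dA u w\<close> are derivatives in direction \<open>u\<close>. Derivatives of \<open>X\<close> do not occur.
\<close>

definition concomitant where
  "concomitant R dR y dY a dA x z g =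
    g (R (dY x) - dY (R x) + dR y x) + dA x (R z) - dA (R x) z + a (dR x z - dR z x)"

text \<open>Linear algebra of first-order data at one point. \<open>P\<close> and \<open>H\<close>
  stand for the first and second derivatives of \<psi> in charts; \<open>drel\<close>,
  \<open>dY\<close> and \<open>dA\<close> are the differentiated forms of \<open>rel\<close>,
  \<open>y\<close> and \<open>a\<close>. All \<open>H\<close> terms cancel by symmetry. The factors
  of \<open>dt i\<close> are the pairings with \<open>(P z, g)\<close> of the pair
  \<open>(Y i, b i)\<close> and of its image under \<open>R'\<close> and the dual of
  \<open>R'\<close>.\<close>

lemma concomitant_pullback:
  fixes P :: "'d::real_vector \<Rightarrow> 'e::real_vector" and Y :: "nat \<Rightarrow> 'e" and t :: "nat \<Rightarrow> real"
    and b :: "nat \<Rightarrow> 'e \<Rightarrow> real" and g :: "'e \<Rightarrow> real" and a :: "'d \<Rightarrow> real"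
  assumes lin: "linear P" "linear g" "linear R'" "\<And>w. linear (\<lambda>u. dR' u w)"
      "\<And>i. i < k \<Longrightarrow> linear (b i)"
    and H: "\<And>u w. H u w = H w u"
    and rel: "\<And>w. P (R w) = R' (P w)"
    and drel: "\<And>u w. H u (R w) + P (dR u w) = dR' (P u) (P w) + R' (H u w)"
    and y: "P y = (\<Sum>i<k. t i *\<^sub>R Y i)"
    and dY: "\<And>u. H u y + P (dY u) = (\<Sum>i<k. t i *\<^sub>R dY' i (P u) + dt i u *\<^sub>R Y i)"
    and a: "\<And>w. a w = (\<Sum>i<k. t i * b i (P w))"
    and dA: "\<And>u w. dA u w = (\<Sum>i<k. t i * (dB i (P u) (P w) + b i (H u w)) + dt i u * b i (P w))"
  shows "concomitant R dR y dY a dA x z (\<lambda>w. g (P w)) =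
    (\<Sum>i<k. t i * concomitant R' dR' (Y i) (dY' i) (b i) (dB i) (P x) (P z) g
      + dt i x * (g (R' (Y i)) + b i (R' (P z)))
      - dt i (R x) * (g (Y i) + b i (P z)))"
proof -
  note lins = linear_add linear_diff linear_cmul linear_sum
  have dY: "P (dY u) = (\<Sum>i<k. t i *\<^sub>R dY' i (P u) + dt i u *\<^sub>R Y i) - H u y" for u
    using dY[of u] by (simp add: algebra_simps)
  have dR: "P (dR u w) = dR' (P u) (P w) + R' (H u w) - H u (R w)" for u w
    using drel[of u w] by (simp add: algebra_simps)
  \<comment> \<open>Four \<open>H\<close> terms arise and cancel in pairs: those inside
    \<open>R'\<close> by \<open>H x y = H y x\<close>, the others by
    \<open>H (R x) y = H y (R x)\<close>.\<close>
  have vec: "P (R (dY x) - dY (R x) + dR y x) =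
      (\<Sum>i<k. t i *\<^sub>R (R' (dY' i (P x)) - dY' i (R' (P x)) + dR' (Y i) (P x))
        + dt i x *\<^sub>R R' (Y i) - dt i (R x) *\<^sub>R Y i)"
  proof -
    have "P (R (dY x) - dY (R x) + dR y x) = R' (P (dY x)) - P (dY (R x)) + P (dR y x)"
      by (simp add: linear_add[OF lin(1)] linear_diff[OF lin(1)] rel)
    also have "\<dots> = R' (\<Sum>i<k. t i *\<^sub>R dY' i (P x) + dt i x *\<^sub>R Y i)
        - (\<Sum>i<k. t i *\<^sub>R dY' i (R' (P x)) + dt i (R x) *\<^sub>R Y i) + dR' (P y) (P x)"
      unfolding dY dR rel by (simp add: linear_diff[OF lin(3)] H[of x y] H[of "R x" y])
    also have "dR' (P y) (P x) = (\<Sum>i<k. t i *\<^sub>R dR' (Y i) (P x))"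
      unfolding y by (simp add: linear_sum[OF lin(4)] linear_cmul[OF lin(4)])
    also have "R' (\<Sum>i<k. t i *\<^sub>R dY' i (P x) + dt i x *\<^sub>R Y i)
        = (\<Sum>i<k. t i *\<^sub>R R' (dY' i (P x)) + dt i x *\<^sub>R R' (Y i))"
      by (simp add: linear_sum[OF lin(3)] linear_cmul[OF lin(3)] linear_add[OF lin(3)])
    finally show ?thesis
      by (simp add: sum.distrib sum_subtractf scaleR_add_right scaleR_diff_right)
  qed
  have "g (P (R (dY x) - dY (R x) + dR y x)) =
      (\<Sum>i<k. t i * g (R' (dY' i (P x)) - dY' i (R' (P x)) + dR' (Y i) (P x))
        + dt i x * g (R' (Y i)) - dt i (R x) * g (Y i))"
    unfolding vec
    by (simp add: linear_sum[OF lin(2)] linear_cmul[OF lin(2)] linear_add[OF lin(2)] linear_diff[OF lin(2)])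
  moreover have "dA x (R z) - dA (R x) z + a (dR x z - dR z x) =
      (\<Sum>i<k. t i * (dB i (P x) (R' (P z)) - dB i (R' (P x)) (P z) + b i (dR' (P x) (P z) - dR' (P z) (P x)))
        + dt i x * b i (R' (P z)) - dt i (R x) * b i (P z))"
  proof -
    have "dA x (R z) - dA (R x) z + a (dR x z - dR z x) =
      (\<Sum>i<k. (t i * (dB i (P x) (P (R z)) + b i (H x (R z))) + dt i x * b i (P (R z)))
        - (t i * (dB i (P (R x)) (P z) + b i (H (R x) z)) + dt i (R x) * b i (P z))
        + t i * b i (P (dR x z - dR z x)))"
      unfolding a dA by (simp add: sum.distrib sum_subtractf)
    also have "\<dots> = (\<Sum>i<k. t i * (dB i (P x) (R' (P z)) - dB i (R' (P x)) (P z)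
          + b i (dR' (P x) (P z) - dR' (P z) (P x)))
        + dt i x * b i (R' (P z)) - dt i (R x) * b i (P z))"
    proof (rule sum.cong[OF refl])
      fix i assume "i \<in> {..<k}"
      then have l: "linear (b i)" using lin(5) by simp
      \<comment> \<open>The \<open>H\<close> terms inside \<open>R'\<close> are already gone by
        symmetry; the two that remain are opposite to those contributed by
        \<open>dA\<close>.\<close>
      have "P (dR x z - dR z x) = dR' (P x) (P z) - dR' (P z) (P x) - H x (R z) + H (R x) z"
        using H[of x z] H[of z "R x"] by (simp add: linear_diff[OF lin(1)] dR)
      then have *: "b i (P (dR x z - dR z x))
          = b i (dR' (P x) (P z) - dR' (P z) (P x)) - b i (H x (R z)) + b i (H (R x) z)"
        by (simp add: linear_add[OF l] linear_diff[OF l])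
      show "t i * (dB i (P x) (P (R z)) + b i (H x (R z))) + dt i x * b i (P (R z))
          - (t i * (dB i (P (R x)) (P z) + b i (H (R x) z)) + dt i (R x) * b i (P z))
          + t i * b i (P (dR x z - dR z x))
        = t i * (dB i (P x) (R' (P z)) - dB i (R' (P x)) (P z)
            + b i (dR' (P x) (P z) - dR' (P z) (P x)))
          + dt i x * b i (R' (P z)) - dt i (R x) * b i (P z)"
        unfolding * rel by (simp add: algebra_simps)
    qed
    finally show ?thesis .
  qed
  moreover have "(\<Sum>i<k. t i * concomitant R' dR' (Y i) (dY' i) (b i) (dB i) (P x) (P z) g
      + dt i x * (g (R' (Y i)) + b i (R' (P z))) - dt i (R x) * (g (Y i) + b i (P z))) =
      (\<Sum>i<k. t i * g (R' (dY' i (P x)) - dY' i (R' (P x)) + dR' (Y i) (P x))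
        + dt i x * g (R' (Y i)) - dt i (R x) * g (Y i)) +
      (\<Sum>i<k. t i * (dB i (P x) (R' (P z)) - dB i (R' (P x)) (P z) + b i (dR' (P x) (P z) - dR' (P z) (P x)))
        + dt i x * b i (R' (P z)) - dt i (R x) * b i (P z))"
    unfolding concomitant_def sum.distrib[symmetric]
    by (rule sum.cong[OF refl]) (simp add: algebra_simps)
  ultimately show ?thesis unfolding concomitant_def by linarith
qed

context manifold
begin

definition covector_comp :: "('a, 'e) chart \<Rightarrow> 'a \<Rightarrow> ('a, 'e) covector \<Rightarrow> 'e \<Rightarrow> real"
  where "covector_comp c p g w = g (tangent_of A c p w)"

definition concomitant_at ::
    "('a, 'e) tensor11 \<Rightarrow> ('a, 'e) chart \<Rightarrow> 'a \<Rightarrow> ('a, 'e) vfield \<Rightarrow> ('a, 'e) oneform \<Rightarrow>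
      'e \<Rightarrow> 'e \<Rightarrow> ('e \<Rightarrow> real) \<Rightarrow> real"
  where "concomitant_at r c p Y \<alpha> = concomitant
    (\<lambda>w. tensor_comp A r c w (snd c p)) (\<lambda>u w. fd (tensor_comp A r c w) (snd c p) u)
    (Y p c) (fd (vfield_comp Y c) (snd c p))
    (covector_comp c p (\<alpha> p)) (\<lambda>u w. fd (oneform_comp A \<alpha> c w) (snd c p) u)"

lemma tensor_apply_component:
  assumes "c \<in> charts_at A p" "v \<in> tangent_space A p"
  shows "r p v c = tensor_comp A r c (v c) (snd c p)"
  by (simp add: tensor_comp_at[OF assms(1)] tangent_of_component[OF assms])

section \<open>Coordinate formulas for the operators \<open>D_op\<close> and
  \<open>D_op_dual\<close>\<close>

lemma app_vfield_derivative:
  assumes r: "r \<in> vector_valued_oneforms A" and X: "X \<in> vfields_on A UNIV" and c: "c \<in> charts_at A p"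
  shows "fd (vfield_comp (app_vfield r X) c) (snd c p) h
    = fd (tensor_comp A r c (X p c)) (snd c p) h
      + tensor_comp A r c (fd (vfield_comp X c) (snd c p) h) (snd c p)"
proof -
  have cA: "c \<in> A" "p \<in> fst c" using c by (auto simp: charts_at_iff)
  have "(vfield_comp (app_vfield r X) c has_derivative (\<lambda>h.
      fd (tensor_comp A r c (vfield_comp X c (snd c p))) (snd c p) h
      + r p (tangent_of A c p (fd (vfield_comp X c) (snd c p) h)) c)) (at (snd c p))"
    by (rule has_derivative_transform_within_open[OF
          has_derivative_tensor_apply[OF r c vfield_differentiable[OF X c]] open_chart_image'[OF cA(1)]])
      (use cA vfield_comp_app[OF X cA(1)] in auto)
  then show ?thesis
    by (simp add: frechet_derivative_eq vfield_comp_at[OF c] tensor_comp_at[OF c])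
qed

text \<open>Both brackets contain r applied to the derivative of X along Y, and these terms cancel;
  X therefore enters through its value at p only.\<close>

lemma D_op_component:
  assumes r: "r \<in> vector_valued_oneforms A" and X: "X \<in> vfields_on A UNIV" and Y: "Y \<in> vfields_on A UNIV"
    and c: "c \<in> charts_at A p"
  shows "D_op A r X Y p c =
    tensor_comp A r c (fd (vfield_comp Y c) (snd c p) (X p c)) (snd c p)
    - fd (vfield_comp Y c) (snd c p) (tensor_comp A r c (X p c) (snd c p))
    + fd (tensor_comp A r c (X p c)) (snd c p) (Y p c)"
proof -
  have cA: "c \<in> A" "p \<in> fst c" using c by (auto simp: charts_at_iff)
  have l: "linear (\<lambda>w. tensor_comp A r c w (snd c p))"
    by (rule linear_tensor_comp[OF r cA(1)]) (use cA in auto)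
  have "app_vfield r (lie_bracket A Y X) p c = tensor_comp A r c (lie_bracket A Y X p c) (snd c p)"
    unfolding app_vfield_def by (rule tensor_apply_component[OF c lie_bracket_tangent[OF Y X]])
  moreover have "app_vfield r X p c = tensor_comp A r c (X p c) (snd c p)"
    unfolding app_vfield_def by (rule tensor_apply_component[OF c vfields_onD(1)[OF X UNIV_I]])
  ultimately show ?thesis
    using c by (simp add: D_op_def lie_bracket_def app_vfield_derivative[OF r X c] linear_diff[OF l])
qed

text \<open>Derivatives of X cancel here too: each of the two Lie derivatives contains \<alpha>
  applied to r of the derivative of X along v.\<close>

lemma D_op_dual_component:
  assumes r: "r \<in> vector_valued_oneforms A" and X: "X \<in> vfields_on A UNIV" and \<alpha>: "\<alpha> \<in> oneforms_on A UNIV"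
    and c: "c \<in> charts_at A p" and v: "v \<in> tangent_space A p"
  shows "D_op_dual A r X \<alpha> p v =
    fd (oneform_comp A \<alpha> c (tensor_comp A r c (v c) (snd c p))) (snd c p) (X p c)
    - fd (oneform_comp A \<alpha> c (v c)) (snd c p) (tensor_comp A r c (X p c) (snd c p))
    + covector_comp c p (\<alpha> p) (fd (tensor_comp A r c (v c)) (snd c p) (X p c)
        - fd (tensor_comp A r c (X p c)) (snd c p) (v c))"
proof -
  have cA: "c \<in> A" "p \<in> fst c" using c by (auto simp: charts_at_iff)
  have l: "linear (covector_comp c p (\<alpha> p))"
    unfolding covector_comp_def by (rule linear_covector[OF c oneforms_onD(1)[OF \<alpha> UNIV_I]])
  let ?r\<alpha> = "\<lambda>p. dual_map A r p (\<alpha> p)"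
  have "(oneform_comp A ?r\<alpha> c (v c) has_derivative (\<lambda>h.
      fd (oneform_comp A \<alpha> c (tensor_comp A r c (v c) (snd c p))) (snd c p) h
      + \<alpha> p (tangent_of A c p (fd (tensor_comp A r c (v c)) (snd c p) h)))) (at (snd c p))"
    by (rule has_derivative_transform_within_open[OF
          has_derivative_oneform_apply[OF \<alpha> c has_derivative_frechet[OF tensor_differentiable[OF r c]]]
          open_chart_image'[OF cA(1)]])
      (use cA oneform_comp_dual[OF r cA(1)] in auto)
  moreover have "?r\<alpha> p (tangent_of A c p w) = covector_comp c p (\<alpha> p) (tensor_comp A r c w (snd c p))" for w
    using tangent_of_component[OF c tensorD(1)[OF r tangent_of_in[OF c]], of w]
    by (simp add: dual_map_tangent_of[OF c] covector_comp_def tensor_comp_at[OF c])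
  moreover have "app_vfield r X p c = tensor_comp A r c (X p c) (snd c p)"
    unfolding app_vfield_def by (rule tensor_apply_component[OF c vfields_onD(1)[OF X UNIV_I]])
  ultimately show ?thesis
    unfolding D_op_dual_def fun_diff_def
      lie_deriv_eq[OF X dual_map_oneforms[OF r \<alpha>] c v] lie_deriv_eq[OF app_vfield_vfields[OF r X] \<alpha> c v]
      lie_deriv_comp_def app_vfield_derivative[OF r X c] covector_comp_def[symmetric]
    by (simp add: frechet_derivative_eq linear_diff[OF l] linear_add[OF l] covector_comp_def[symmetric])
qed

text \<open>The bridge from the invariant operators to the pointwise formula, whose right-hand side
  sees X and b only through their values at p.\<close>

lemma pairing_DD_op:
  assumes r: "r \<in> vector_valued_oneforms A" and X: "X \<in> vfields_on A UNIV"
    and s: "s \<in> sections A L" and c: "c \<in> charts_at A p" and b: "b \<in> gtangent_space A p"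
  shows "pairing (DD_op A r X s p) b = concomitant_at r c p (\<lambda>q. fst (s q)) (\<lambda>q. snd (s q))
    (X p c) (fst b c) (covector_comp c p (snd b))"
proof -
  have Y: "(\<lambda>q. fst (s q)) \<in> vfields_on A UNIV" and \<alpha>: "(\<lambda>q. snd (s q)) \<in> oneforms_on A UNIV"
    using s by (auto simp: sections_on_def)
  have b': "fst b \<in> tangent_space A p" using b by (auto simp: gtangent_space_def)
  have "snd b (D_op A r X (\<lambda>q. fst (s q)) p) = covector_comp c p (snd b) (D_op A r X (\<lambda>q. fst (s q)) p c)"
    unfolding covector_comp_def
    by (rule covector_component[OF c vfields_onD(1)[OF D_op_vfields[OF r X Y] UNIV_I], symmetric])
  then show ?thesis
    unfolding pairing_def DD_op_def fst_conv snd_conv D_op_component[OF r X Y c]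
      D_op_dual_component[OF r X \<alpha> c b'] concomitant_at_def concomitant_def by simp
qed

subsection \<open>Extension by bump functions\<close>

text \<open>The set \<open>K\<close> is closed in the whole manifold and not merely in U; this makes
  the product of \<eta> with a field on U, extended by 0, smooth across the boundary of U.\<close>

definition cutoff :: "'a set \<Rightarrow> ('a \<Rightarrow> real) \<Rightarrow> bool"
  where "cutoff U \<eta> \<longleftrightarrow> open U \<and> (\<exists>K. closed K \<and> K \<subseteq> U \<and> (\<forall>q. q \<notin> K \<longrightarrow> \<eta> q = 0)) \<and>
    (\<forall>c\<in>A. smooth_on (snd c ` fst c) (\<eta> \<circ> chart_inv c))"

text \<open>A Euclidean bump function transplanted by a chart. The value 1 at p serves to prescribe
  values of fields there; nonvanishing on \<open>V\<close> serves to keep frames spanning.\<close>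

lemma cutoff_exists:
  assumes U: "open U" "p \<in> U"
  obtains \<eta> V where "cutoff U \<eta>" "\<eta> p = 1" "open V" "p \<in> V" "V \<subseteq> U" "\<And>q. q \<in> V \<Longrightarrow> \<eta> q \<noteq> 0"
proof -
  define c where "c = some_chart_at A p"
  have c: "c \<in> A" "p \<in> fst c" using some_chart[of p] by (auto simp: c_def charts_at_iff)
  have "open (snd c ` (fst c \<inter> U))" "snd c p \<in> snd c ` (fst c \<inter> U)"
    using c U by (auto simp: open_chart_image)
  then obtain e where e: "e > 0" "cball (snd c p) e \<subseteq> snd c ` (fst c \<inter> U)"
    using open_contains_cball by blast
  obtain h :: "'e \<Rightarrow> real" where h: "smooth_on UNIV h" "h (snd c p) = 1" "\<And>y. dist y (snd c p) \<ge> e \<Longrightarrow> h y = 0"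
    using bump_function[OF e(1)] by metis
  define K where "K = chart_inv c ` cball (snd c p) e"
  define \<eta> where "\<eta> = (\<lambda>q. if q \<in> fst c then h (snd c q) else 0)"
  have "continuous_on (cball (snd c p) e) (chart_inv c)"
    using e(2) chart_homeomorphism[OF c(1)] by (auto simp: homeomorphism_def intro: continuous_on_subset)
  then have "closed K"
    unfolding K_def by (intro compact_imp_closed compact_continuous_image compact_cball_fin_dim fin_dim_model)
  moreover have KU: "K \<subseteq> fst c \<inter> U" using e(2) chart_inv_in[OF c(1), of _ U] by (auto simp: K_def)
  moreover have off: "\<eta> q = 0" if "q \<notin> K" for q
  proof (cases "q \<in> fst c")
    case True
    then have "snd c q \<notin> cball (snd c p) e" using that c by (force simp: K_def)
    then show ?thesis using True h(3)[of "snd c q"] by (simp add: \<eta>_def dist_commute)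
  qed (simp add: \<eta>_def)
  moreover have "smooth_on (snd d ` fst d) (\<eta> \<circ> chart_inv d)" if d: "d \<in> A" for d
  proof (rule smooth_on_locally)
    fix y assume "y \<in> snd d ` fst d"
    then obtain q where q: "d \<in> charts_at A q" "y = snd d q" "chart_inv d y = q"
      using chart_image_cases'[OF d] by metis
    show "\<exists>T g. open T \<and> y \<in> T \<and> smooth_on T g \<and> (\<forall>y\<in>T. (\<eta> \<circ> chart_inv d) y = g y)"
    proof (cases "q \<in> K")
      case True
      have "smooth_on (snd d ` (fst d \<inter> fst c)) (\<lambda>y. h ((snd c \<circ> chart_inv d) y))"
        by (rule smooth_on_compose[OF fin_dim_model open_chart_image[OF d open_chart[OF c(1)]] subset_UNIV
              smooth_transition[OF d c(1)] h(1)])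
      then show ?thesis using q True KU d c
        by (intro exI[of _ "snd d ` (fst d \<inter> fst c)"] exI[of _ "\<lambda>y. h ((snd c \<circ> chart_inv d) y)"])
          (auto simp: open_chart_image open_chart charts_at_iff \<eta>_def)
    next
      case False
      then show ?thesis using q d open_chart_image[OF d open_Compl[OF \<open>closed K\<close>]] off
        by (intro exI[of _ "snd d ` (fst d \<inter> - K)"] exI[of _ "\<lambda>y. 0"])
          (auto simp: open_chart_image charts_at_iff smooth_on_const)
    qed
  qed
  ultimately have "cutoff U \<eta>" using U by (auto simp: cutoff_def)
  moreover define V where "V = fst c \<inter> snd c -` (h -` (- {0}))"
  moreover have "open V"
  proof -
    have "open (h -` (- {0}))"
      using smooth_on_imp_continuous_on[OF h(1)] by (intro open_vimage) auto
    then show ?thesis unfolding V_def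
      using chart_homeomorphism[OF c(1)] open_chart[OF c(1)]
      by (intro continuous_open_preimage) (auto simp: homeomorphism_def)
  qed
  moreover have "\<eta> q \<noteq> 0" if "q \<in> V" for q using that by (simp add: V_def \<eta>_def)
  \<comment> \<open>Here \<open>calculation(4)\<close> is the nonvanishing of \<eta> on
    \<open>V\<close>; as \<eta> vanishes off \<open>K\<close>, points of \<open>V\<close> lie in
    \<open>K\<close>.\<close>
  moreover have "V \<subseteq> U" using calculation(4) off KU by blast
  moreover have "\<eta> p = 1" "p \<in> V" using c h by (auto simp: \<eta>_def V_def)
  ultimately show thesis using that by blast
qed

text \<open>U and the complement of \<open>K\<close> form an open cover: on the first g is a product
  of smooth functions, on the second it vanishes.\<close>

lemma cutoff_smooth:
  assumes \<eta>: "cutoff U \<eta>" and c: "c \<in> A" and f: "smooth_on (snd c ` (fst c \<inter> U)) f"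
    and g: "\<And>y. y \<in> snd c ` fst c \<Longrightarrow> g y = (if chart_inv c y \<in> U then \<eta> (chart_inv c y) *\<^sub>R f y else 0)"
  shows "smooth_on (snd c ` fst c) g"
proof (rule smooth_on_locally)
  obtain K where U: "open U" and K: "closed K" "K \<subseteq> U" "\<And>q. q \<notin> K \<Longrightarrow> \<eta> q = 0"
    and sm: "smooth_on (snd c ` fst c) (\<eta> \<circ> chart_inv c)"
    using \<eta> c by (auto simp: cutoff_def)
  fix y assume y: "y \<in> snd c ` fst c"
  then obtain q where q: "c \<in> charts_at A q" "y = snd c q" "chart_inv c y = q"
    using chart_image_cases'[OF c] by metis
  show "\<exists>T h. open T \<and> y \<in> T \<and> smooth_on T h \<and> (\<forall>y\<in>T. g y = h y)"
  proof (cases "q \<in> K")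
    case True
    have "smooth_on (snd c ` (fst c \<inter> U)) (\<lambda>y. (\<eta> \<circ> chart_inv c) y *\<^sub>R f y)"
      by (intro smooth_on_scaleR open_chart_image c U f smooth_on_subset[OF sm open_chart_image'[OF c]]) auto
    then show ?thesis using q True K c U g
      by (intro exI[of _ "snd c ` (fst c \<inter> U)"] exI[of _ "\<lambda>y. (\<eta> \<circ> chart_inv c) y *\<^sub>R f y"])
        (auto simp: open_chart_image charts_at_iff)
  next
    case False
    then show ?thesis using q c K(2,3) g open_chart_image[OF c open_Compl[OF K(1)]]
      by (intro exI[of _ "snd c ` (fst c \<inter> - K)"] exI[of _ "\<lambda>y. 0"])
        (auto simp: open_chart_image charts_at_iff smooth_on_const)
  qed
qed

lemma cutoff_vfield:
  assumes \<eta>: "cutoff U \<eta>" and X: "X \<in> vfields_on A U"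
  shows "(\<lambda>q. if q \<in> U then \<eta> q *\<^sub>R X q else 0) \<in> vfields_on A UNIV"
  unfolding vfields_on_def
proof (intro CollectI conjI ballI)
  fix q show "(if q \<in> U then \<eta> q *\<^sub>R X q else 0) \<in> tangent_space A q"
    using vfields_onD(1)[OF X, of q] by (simp add: tangent_space_scaleR tangent_space_zero)
next
  fix c assume c: "c \<in> A"
  have "smooth_on (snd c ` fst c) (vfield_comp (\<lambda>q. if q \<in> U then \<eta> q *\<^sub>R X q else 0) c)"
    by (rule cutoff_smooth[OF \<eta> c vfields_onD(2)[OF X c]]) (simp add: vfield_comp_def scaleR_fun_def)
  then show "smooth_on (snd c ` (fst c \<inter> UNIV)) (vfield_comp (\<lambda>q. if q \<in> U then \<eta> q *\<^sub>R X q else 0) c)"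
    by simp
qed

lemma cutoff_oneform:
  assumes \<eta>: "cutoff U \<eta>" and \<alpha>: "\<alpha> \<in> oneforms_on A U"
  shows "(\<lambda>q. if q \<in> U then \<eta> q *\<^sub>R \<alpha> q else 0) \<in> oneforms_on A UNIV"
  unfolding oneforms_on_def
proof (intro CollectI conjI ballI allI)
  fix q show "(if q \<in> U then \<eta> q *\<^sub>R \<alpha> q else 0) \<in> cotangent_space A q"
    using oneforms_onD(1)[OF \<alpha>, of q] by (simp add: cotangent_space_scaleR cotangent_space_zero)
next
  fix c w assume c: "c \<in> A"
  have "smooth_on (snd c ` fst c) (oneform_comp A (\<lambda>q. if q \<in> U then \<eta> q *\<^sub>R \<alpha> q else 0) c w)"
    by (rule cutoff_smooth[OF \<eta> c oneforms_onD(2)[OF \<alpha> c, of w]]) (simp add: oneform_comp_def scaleR_fun_def)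
  then show "smooth_on (snd c ` (fst c \<inter> UNIV)) (oneform_comp A (\<lambda>q. if q \<in> U then \<eta> q *\<^sub>R \<alpha> q else 0) c w)"
    by simp
qed

lemma coordinate_vfield:
  assumes c: "c \<in> A"
  shows "(\<lambda>q. tangent_of A c q w) \<in> vfields_on A (fst c)"
  unfolding vfields_on_def
proof (intro CollectI conjI ballI)
  fix p assume "p \<in> fst c"
  then show "tangent_of A c p w \<in> tangent_space A p" using c by (intro tangent_of_in) (simp add: charts_at_iff)
next
  fix d assume d: "d \<in> A"
  have o: "open (snd d ` (fst d \<inter> fst c))" by (rule open_chart_image[OF d open_chart[OF c]])
  have "smooth_on (snd d ` (fst d \<inter> fst c)) (\<lambda>y. fd (snd d \<circ> chart_inv c) ((snd c \<circ> chart_inv d) y) w)"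
    by (rule smooth_on_compose[where g = "\<lambda>z. fd (snd d \<circ> chart_inv c) z w", OF fin_dim_model o _
          smooth_transition[OF d c] smooth_on_fd[OF smooth_transition[OF c d]]])
      (use d in auto)
  then show "smooth_on (snd d ` (fst d \<inter> fst c)) (vfield_comp (\<lambda>q. tangent_of A c q w) d)"
    by (rule smooth_on_cong[OF _ o]) (use d c in \<open>auto simp: vfield_comp_def tangent_of_def charts_at_iff\<close>)
qed

lemma vfield_through:
  assumes "v \<in> tangent_space A p"
  obtains X where "X \<in> vfields_on A UNIV" "X p = v"
proof -
  define c where "c = some_chart_at A p"
  have c: "c \<in> charts_at A p" using some_chart[of p] by (simp add: c_def)
  then have cA: "c \<in> A" "p \<in> fst c" by (auto simp: charts_at_iff)
  obtain \<eta> V where \<eta>: "cutoff (fst c) \<eta>" "\<eta> p = 1"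
    using cutoff_exists[OF open_chart[OF cA(1)] cA(2)] by metis
  show thesis
    by (rule that[OF cutoff_vfield[OF \<eta>(1) coordinate_vfield[OF cA(1), of "v c"]]])
      (simp add: cA(2) \<eta>(2) tangent_of_component[OF c assms])
qed

section \<open>Global sections that span a subbundle locally, and the pointwise form of
  compatibility\<close>

lemma subbundle_local_frame:
  assumes "subbundle A L"
  obtains U k and e :: "nat \<Rightarrow> 'a \<Rightarrow> ('a, 'e) gvector"
  where "open U" "p \<in> U" "\<And>i. i < k \<Longrightarrow> e i \<in> sections_on A U L"
    "\<And>q. q \<in> U \<Longrightarrow> inj_on (\<lambda>i. e i q) {..<k}"
    "\<And>q. q \<in> U \<Longrightarrow> span ((\<lambda>i. e i q) ` {..<k}) = L q"
proof -
  obtain U k e where U: "open U" "p \<in> U" "\<forall>i<k. e i \<in> sections_on A U L"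
    and fr: "\<forall>q\<in>U. inj_on (\<lambda>i::nat. e i q) {..<k} \<and> independent ((\<lambda>i. e i q) ` {..<k}) \<and>
      span ((\<lambda>i. e i q) ` {..<k}) = L q"
    using spec[OF conjunct2[OF assms[unfolded subbundle_def]], of p] by (elim exE conjE) (rule that)
  show thesis
    by (rule that[of U k e]) (use U fr in simp_all)
qed

lemma subbundle_subspace:
  assumes "subbundle A L"
  shows "subspace (L p)"
proof -
  obtain U k and e :: "nat \<Rightarrow> 'a \<Rightarrow> ('a, 'e) gvector"
    where "p \<in> U" "\<And>q. q \<in> U \<Longrightarrow> span ((\<lambda>i. e i q) ` {..<k}) = L q"
    using subbundle_local_frame[OF assms, of p] by metis
  then show ?thesis using subspace_span[of "(\<lambda>i. e i p) ` {..<k}"] by simp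
qed

text \<open>Frames are local, but compatibility speaks of global sections, so the frame is
  multiplied by a cutoff. Where the cutoff does not vanish the products still span, with
  coefficients divided by \<eta>.\<close>

lemma subbundle_spanning_sections:
  assumes L: "subbundle A L"
  obtains V k and e :: "nat \<Rightarrow> 'a \<Rightarrow> ('a, 'e) gvector"
  where "open V" "p \<in> V" "\<And>i. i < k \<Longrightarrow> e i \<in> sections A L"
    "\<And>q a. q \<in> V \<Longrightarrow> a \<in> L q \<Longrightarrow> \<exists>t. a = (\<Sum>i<k. t i *\<^sub>R e i q)"
proof -
  obtain U k and e :: "nat \<Rightarrow> 'a \<Rightarrow> ('a, 'e) gvector"
    where U: "open U" "p \<in> U" and e: "\<And>i. i < k \<Longrightarrow> e i \<in> sections_on A U L"
    and inj: "\<And>q. q \<in> U \<Longrightarrow> inj_on (\<lambda>i. e i q) {..<k}"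
    and fr: "\<And>q. q \<in> U \<Longrightarrow> span ((\<lambda>i. e i q) ` {..<k}) = L q"
    using subbundle_local_frame[OF L, of p] by metis
  obtain \<eta> V where \<eta>: "cutoff U \<eta>" and V: "open V" "p \<in> V" "V \<subseteq> U" "\<And>q. q \<in> V \<Longrightarrow> \<eta> q \<noteq> 0"
    using cutoff_exists[OF U] by metis
  define f where "f = (\<lambda>i q. if q \<in> U then \<eta> q *\<^sub>R e i q else 0)"
  have f: "f i \<in> sections A L" if "i < k" for i
  proof -
    have ei: "\<And>q. q \<in> U \<Longrightarrow> e i q \<in> L q" "(\<lambda>q. fst (e i q)) \<in> vfields_on A U" "(\<lambda>q. snd (e i q)) \<in> oneforms_on A U"
      using e[OF that] by (auto simp: sections_on_def)
    have "(\<lambda>q. fst (f i q)) = (\<lambda>q. if q \<in> U then \<eta> q *\<^sub>R fst (e i q) else 0)"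
      "(\<lambda>q. snd (f i q)) = (\<lambda>q. if q \<in> U then \<eta> q *\<^sub>R snd (e i q) else 0)"
      by (auto simp: f_def)
    moreover have "f i q \<in> L q" for q
      using ei(1)[of q] subspace_scale[OF subbundle_subspace[OF L]] subspace_0[OF subbundle_subspace[OF L]]
      by (simp add: f_def)
    ultimately show ?thesis
      using cutoff_vfield[OF \<eta> ei(2)] cutoff_oneform[OF \<eta> ei(3)] by (simp add: sections_on_def)
  qed
  have comb: "\<exists>t. a = (\<Sum>i<k. t i *\<^sub>R f i q)" if q: "q \<in> V" "a \<in> L q" for q a
  proof -
    have qU: "q \<in> U" using q V by auto
    have "a \<in> span ((\<lambda>i. e i q) ` {..<k})" using fr[OF qU] q by simp
    then obtain u where "a = (\<Sum>v\<in>(\<lambda>i. e i q) ` {..<k}. u v *\<^sub>R v)"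
      by (auto simp: span_finite)
    then have "a = (\<Sum>i<k. u (e i q) *\<^sub>R e i q)"
      using inj[OF qU] by (simp add: sum.reindex)
    also have "\<dots> = (\<Sum>i<k. (u (e i q) / \<eta> q) *\<^sub>R f i q)"
      using V(4)[OF q(1)] qU by (simp add: f_def)
    finally show ?thesis by (intro exI[of _ "\<lambda>i. u (e i q) / \<eta> q"])
  qed
  show thesis by (rule that[OF V(1,2) f comb])
qed

lemma dirac_isotropic:
  assumes "dirac_structure A L" "a \<in> L p" "b \<in> L p"
  shows "pairing a b = 0"
  using assms unfolding dirac_structure_def by blast

lemma dirac_subset:
  assumes "dirac_structure A L"
  shows "L p \<subseteq> gtangent_space A p"
  using assms unfolding dirac_structure_def subbundle_def by blast

text \<open>Every coordinate vector x is the value at p of a global field X, and no more than this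
  value enters. Isotropy of L turns membership of \<open>DD_op A r X s p\<close> in L p into the
  vanishing of its pairing with b.\<close>

lemma compatible_concomitant_at:
  assumes L: "dirac_structure A L" and r: "r \<in> vector_valued_oneforms A" and cm: "compatible A L r"
    and s: "s \<in> sections A L" and c: "c \<in> charts_at A p" and b: "b \<in> L p"
  shows "concomitant_at r c p (\<lambda>q. fst (s q)) (\<lambda>q. snd (s q)) x (fst b c) (covector_comp c p (snd b)) = 0"
proof -
  obtain X where X: "X \<in> vfields_on A UNIV" "X p = tangent_of A c p x"
    using vfield_through[OF tangent_of_in[OF c]] by metis
  have "DD_op A r X s p \<in> L p"
    using cm X(1) s unfolding compatible_def sections_on_def by blast
  then have "pairing (DD_op A r X s p) b = 0" by (rule dirac_isotropic[OF L _ b])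
  moreover have "b \<in> gtangent_space A p" using dirac_subset[OF L] b by blast
  ultimately show ?thesis
    using pairing_DD_op[OF r X(1) s c] by (simp add: X(2) tangent_of_self[OF c])
qed

end

section \<open>Smooth maps in charts\<close>

locale manifold_map = N: manifold A + M: manifold B
  for A :: "('a::{t2_space, second_countable_topology}, 'd::real_inner) chart set"
    and B :: "('b::{t2_space, second_countable_topology}, 'e::real_inner) chart set" +
  fixes \<psi> :: "'a \<Rightarrow> 'b"
  assumes smooth_map: "smooth_map A B \<psi>"
begin

definition rep :: "('a, 'd) chart \<Rightarrow> ('b, 'e) chart \<Rightarrow> 'd \<Rightarrow> 'e"
  where "rep c d = snd d \<circ> \<psi> \<circ> chart_inv c"

definition rep_dom :: "('a, 'd) chart \<Rightarrow> ('b, 'e) chart \<Rightarrow> 'd set"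
  where "rep_dom c d = snd c ` (fst c \<inter> \<psi> -` fst d)"

lemma open_preimage: "open V \<Longrightarrow> open (\<psi> -` V)"
  using smooth_map by (intro open_vimage) (auto simp: smooth_map_def)

lemma smooth_rep: "c \<in> A \<Longrightarrow> d \<in> B \<Longrightarrow> smooth_on (rep_dom c d) (rep c d)"
  using smooth_map by (auto simp: smooth_map_def rep_def rep_dom_def)

lemma open_rep_dom: "c \<in> A \<Longrightarrow> d \<in> B \<Longrightarrow> open (rep_dom c d)"
  unfolding rep_dom_def by (intro N.open_chart_image open_preimage M.open_chart)

lemma rep_at: "c \<in> charts_at A x \<Longrightarrow> rep c d (snd c x) = snd d (\<psi> x)"
  by (simp add: rep_def N.charts_at_iff)

lemma in_rep_dom: "c \<in> charts_at A x \<Longrightarrow> d \<in> charts_at B (\<psi> x) \<Longrightarrow> snd c x \<in> rep_dom c d"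
  by (auto simp: rep_dom_def charts_at_def)

lemma rep_dom_cases:
  assumes "c \<in> A" "d \<in> B" "y \<in> rep_dom c d"
  obtains x where "c \<in> charts_at A x" "d \<in> charts_at B (\<psi> x)" "y = snd c x" "chart_inv c y = x"
  using assms by (auto simp: rep_dom_def charts_at_def)

lemma rep_has_derivative:
  assumes "c \<in> charts_at A x" "d \<in> charts_at B (\<psi> x)"
  shows "(rep c d has_derivative fd (rep c d) (snd c x)) (at (snd c x))"
  using assms by (intro smooth_on_has_derivative[OF smooth_rep] in_rep_dom) (auto simp: charts_at_def)

text \<open>The chain rule for a change of chart on N; it frees \<open>tangent_map\<close> from the
  chart chosen in its definition.\<close>

lemma rep_change_source:
  assumes c: "c \<in> charts_at A x" "c' \<in> charts_at A x" and d: "d \<in> charts_at B (\<psi> x)"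
  shows "fd (rep c' d) (snd c' x) (fd (snd c' \<circ> chart_inv c) (snd c x) w) = fd (rep c d) (snd c x) w"
proof -
  have cA: "c \<in> A" "x \<in> fst c" "c' \<in> A" "x \<in> fst c'" "d \<in> B" using c d by (auto simp: charts_at_def)
  have eq: "(snd c' \<circ> chart_inv c) (snd c x) = snd c' x" using cA by simp
  have "(rep c' d \<circ> (snd c' \<circ> chart_inv c) has_derivative
    fd (rep c' d) (snd c' x) \<circ> fd (snd c' \<circ> chart_inv c) (snd c x)) (at (snd c x))"
    by (rule diff_chain_at[OF N.transition_has_derivative[OF c] rep_has_derivative[OF c(2) d, folded eq],
          unfolded eq])
  then have "(rep c d has_derivative
    fd (rep c' d) (snd c' x) \<circ> fd (snd c' \<circ> chart_inv c) (snd c x)) (at (snd c x))"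
    by (rule has_derivative_transform_within_open[OF _ N.open_chart_image[OF cA(1) N.open_chart[OF cA(3)]]])
      (use cA in \<open>auto simp: rep_def\<close>)
  then show ?thesis by (simp add: frechet_derivative_eq)
qed

lemma rep_change_target:
  assumes c: "c \<in> charts_at A x" and d: "d \<in> charts_at B (\<psi> x)" "d' \<in> charts_at B (\<psi> x)"
  shows "fd (snd d' \<circ> chart_inv d) (snd d (\<psi> x)) (fd (rep c d) (snd c x) w) = fd (rep c d') (snd c x) w"
proof -
  have dB: "c \<in> A" "x \<in> fst c" "d \<in> B" "\<psi> x \<in> fst d" using c d by (auto simp: charts_at_def)
  have eq: "rep c d (snd c x) = snd d (\<psi> x)" by (rule rep_at[OF c])
  have "((snd d' \<circ> chart_inv d) \<circ> rep c d has_derivative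
    fd (snd d' \<circ> chart_inv d) (snd d (\<psi> x)) \<circ> fd (rep c d) (snd c x)) (at (snd c x))"
    by (rule diff_chain_at[OF rep_has_derivative[OF c d(1)] M.transition_has_derivative[OF d, folded eq],
          unfolded eq])
  then have "(rep c d' has_derivative
    fd (snd d' \<circ> chart_inv d) (snd d (\<psi> x)) \<circ> fd (rep c d) (snd c x)) (at (snd c x))"
    by (rule has_derivative_transform_within_open[OF _ open_rep_dom[OF dB(1,3)] in_rep_dom[OF c d(1)]])
      (use dB in \<open>auto simp: rep_def rep_dom_def\<close>)
  then show ?thesis by (simp add: frechet_derivative_eq)
qed

section \<open>The tangent map and its derivatives in charts\<close>

lemma tangent_map_component:
  assumes c: "c \<in> charts_at A x" and d: "d \<in> charts_at B (\<psi> x)" and v: "v \<in> tangent_space A x"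
  shows "tangent_map A B \<psi> x v d = fd (rep c d) (snd c x) (v c)"
proof -
  have "tangent_map A B \<psi> x v d
      = fd (rep (some_chart_at A x) d) (snd (some_chart_at A x) x) (v (some_chart_at A x))"
    using d by (simp add: tangent_map_def Let_def rep_def)
  also have "v (some_chart_at A x) = fd (snd (some_chart_at A x) \<circ> chart_inv c) (snd c x) (v c)"
    by (rule N.tangent_space_change[OF v c N.some_chart])
  finally show ?thesis using rep_change_source[OF c N.some_chart d] by simp
qed

lemma tangent_map_in:
  assumes v: "v \<in> tangent_space A x"
  shows "tangent_map A B \<psi> x v \<in> tangent_space B (\<psi> x)"
proof (rule M.tangent_spaceI)
  fix d d' assume d: "d \<in> charts_at B (\<psi> x)" "d' \<in> charts_at B (\<psi> x)"
  show "tangent_map A B \<psi> x v d' = fd (snd d' \<circ> chart_inv d) (snd d (\<psi> x)) (tangent_map A B \<psi> x v d)"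
    unfolding tangent_map_component[OF N.some_chart d(1) v] tangent_map_component[OF N.some_chart d(2) v]
    by (rule rep_change_target[OF N.some_chart d, symmetric])
qed (simp add: tangent_map_def Let_def)

lemma tangent_map_tangent_of:
  assumes c: "c \<in> charts_at A x" and d: "d \<in> charts_at B (\<psi> x)"
  shows "tangent_map A B \<psi> x (tangent_of A c x w) = tangent_of B d (\<psi> x) (fd (rep c d) (snd c x) w)"
proof -
  note v = N.tangent_of_in[OF c, of w]
  show ?thesis
    using M.tangent_of_component[OF d tangent_map_in[OF v]]
    by (simp add: tangent_map_component[OF c d v] N.tangent_of_self[OF c])
qed

text \<open>\<open>F\<close> stands for a tensor or a 1-form of M, evaluated along \<psi> on the
  image of a fixed vector w. That image moves with the base point, which brings in the second
  derivative of \<psi>.\<close>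

lemma has_derivative_rep_apply:
  fixes F :: "'e \<Rightarrow> 'e \<Rightarrow> 'f::real_normed_vector"
  assumes c: "c \<in> charts_at A x" and d: "d \<in> charts_at B (\<psi> x)"
    and lin: "\<And>m. m \<in> snd d ` fst d \<Longrightarrow> linear (F m)"
    and F: "\<And>w. (\<lambda>m. F m w) differentiable (at (snd d (\<psi> x)))"
  shows "((\<lambda>y. F (rep c d y) (fd (rep c d) y w)) has_derivative (\<lambda>h.
      fd (\<lambda>m. F m (fd (rep c d) (snd c x) w)) (snd d (\<psi> x)) (fd (rep c d) (snd c x) h)
      + F (snd d (\<psi> x)) (fd (\<lambda>y. fd (rep c d) y w) (snd c x) h))) (at (snd c x))"
proof -
  have cd: "c \<in> A" "x \<in> fst c" "d \<in> B" "\<psi> x \<in> fst d" using c d by (auto simp: charts_at_def)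
  note \<phi>x = rep_at[OF c, of d]
  have comp: "((\<lambda>y. F (rep c d y) u) has_derivative
      (\<lambda>h. fd (\<lambda>m. F m u) (snd d (\<psi> x)) (fd (rep c d) (snd c x) h))) (at (snd c x))" for u
    by (rule has_derivative_compose[where f = "rep c d" and g = "\<lambda>m. F m u", OF rep_has_derivative[OF c d]
        has_derivative_frechet[OF F, folded \<phi>x], unfolded \<phi>x])
  have "((\<lambda>y. F (rep c d y) (fd (rep c d) y w)) has_derivative (\<lambda>h.
      fd (\<lambda>y. F (rep c d y) (fd (rep c d) (snd c x) w)) (snd c x) h
      + F (rep c d (snd c x)) (fd (\<lambda>y. fd (rep c d) y w) (snd c x) h))) (at (snd c x))"
  proof (rule has_derivative_linear_apply[where G = "\<lambda>y. F (rep c d y)", OF M.fin_dim_model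
        open_rep_dom[OF cd(1,3)] in_rep_dom[OF c d]])
    show "linear (F (rep c d y))" if "y \<in> rep_dom c d" for y
      by (rule lin) (use that cd in \<open>auto simp: rep_dom_def rep_def\<close>)
    show "(\<lambda>y. F (rep c d y) w) differentiable (at (snd c x))" for w
      by (rule has_derivative_imp_differentiable[OF comp])
    show "((\<lambda>y. fd (rep c d) y w) has_derivative fd (\<lambda>y. fd (rep c d) y w) (snd c x)) (at (snd c x))"
      by (rule smooth_on_has_derivative[OF smooth_on_fd[OF smooth_rep[OF cd(1,3)]] in_rep_dom[OF c d]])
  qed
  then show ?thesis unfolding frechet_derivative_eq[OF comp] \<phi>x .
qed

lemma has_derivative_rep_fd_apply:
  assumes c: "c \<in> charts_at A x" and d: "d \<in> charts_at B (\<psi> x)"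
    and X: "(X has_derivative X') (at (snd c x))"
  shows "((\<lambda>y. fd (rep c d) y (X y)) has_derivative (\<lambda>h.
      fd (\<lambda>y. fd (rep c d) y (X (snd c x))) (snd c x) h + fd (rep c d) (snd c x) (X' h))) (at (snd c x))"
proof -
  have cd: "c \<in> A" "d \<in> B" using c d by (auto simp: charts_at_def)
  show ?thesis
    by (rule has_derivative_linear_apply[where G = "fd (rep c d)", OF N.fin_dim_model
          open_rep_dom[OF cd] in_rep_dom[OF c d] smooth_on_linear_fd[OF smooth_rep[OF cd]]
          smooth_on_differentiable[OF smooth_on_fd[OF smooth_rep[OF cd]] in_rep_dom[OF c d]] X])
qed

section \<open>Related tensors in charts\<close>

lemma related_in_charts:
  assumes rel: "related_by A B \<psi> r\<^sub>N r\<^sub>M"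
    and r: "r\<^sub>N \<in> vector_valued_oneforms A" "r\<^sub>M \<in> vector_valued_oneforms B"
    and c: "c \<in> charts_at A x" and d: "d \<in> charts_at B (\<psi> x)"
  shows "fd (rep c d) (snd c x) (tensor_comp A r\<^sub>N c w (snd c x))
    = tensor_comp B r\<^sub>M d (fd (rep c d) (snd c x) w) (snd d (\<psi> x))"
proof -
  note v = N.tangent_of_in[OF c, of w]
  have "r\<^sub>M (\<psi> x) (tangent_map A B \<psi> x (tangent_of A c x w)) d
      = tangent_map A B \<psi> x (r\<^sub>N x (tangent_of A c x w)) d"
    using rel v by (simp add: related_by_def)
  then show ?thesis
    by (simp add: tangent_map_component[OF c d N.tensorD(1)[OF r(1) v]] N.tensor_comp_at[OF c]
        tangent_map_tangent_of[OF c d] M.tensor_comp_at[OF d])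
qed

text \<open>Both sides are derivatives of one function of the base point, since
  \<open>related_in_charts\<close> holds at all nearby points. The result is the hypothesis
  \<open>drel\<close> of \<open>concomitant_pullback\<close>.\<close>

lemma related_derivative:
  assumes rel: "related_by A B \<psi> r\<^sub>N r\<^sub>M"
    and r: "r\<^sub>N \<in> vector_valued_oneforms A" "r\<^sub>M \<in> vector_valued_oneforms B"
    and c: "c \<in> charts_at A x" and d: "d \<in> charts_at B (\<psi> x)"
  shows "fd (\<lambda>y. fd (rep c d) y (tensor_comp A r\<^sub>N c w (snd c x))) (snd c x) u
      + fd (rep c d) (snd c x) (fd (tensor_comp A r\<^sub>N c w) (snd c x) u)
    = fd (tensor_comp B r\<^sub>M d (fd (rep c d) (snd c x) w)) (snd d (\<psi> x)) (fd (rep c d) (snd c x) u)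
      + tensor_comp B r\<^sub>M d (fd (\<lambda>y. fd (rep c d) y w) (snd c x) u) (snd d (\<psi> x))"
proof -
  have cd: "c \<in> A" "d \<in> B" using c d by (auto simp: charts_at_def)
  have "((\<lambda>y. tensor_comp B r\<^sub>M d (fd (rep c d) y w) (rep c d y)) has_derivative (\<lambda>h.
      fd (\<lambda>m. tensor_comp B r\<^sub>M d (fd (rep c d) (snd c x) w) m) (snd d (\<psi> x)) (fd (rep c d) (snd c x) h)
      + tensor_comp B r\<^sub>M d (fd (\<lambda>y. fd (rep c d) y w) (snd c x) h) (snd d (\<psi> x)))) (at (snd c x))"
    by (rule has_derivative_rep_apply[where F = "\<lambda>m w. tensor_comp B r\<^sub>M d w m", OF c d
          M.linear_tensor_comp[OF r(2) cd(2)] M.tensor_differentiable[OF r(2) d]])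
  moreover have "((\<lambda>y. tensor_comp B r\<^sub>M d (fd (rep c d) y w) (rep c d y)) has_derivative (\<lambda>h.
      fd (\<lambda>y. fd (rep c d) y (tensor_comp A r\<^sub>N c w (snd c x))) (snd c x) h
      + fd (rep c d) (snd c x) (fd (tensor_comp A r\<^sub>N c w) (snd c x) h))) (at (snd c x))"
  proof (rule has_derivative_transform_within_open[OF has_derivative_rep_fd_apply[OF c d
          has_derivative_frechet[OF N.tensor_differentiable[OF r(1) c]]] open_rep_dom[OF cd] in_rep_dom[OF c d]])
    fix y assume "y \<in> rep_dom c d"
    then obtain q where q: "c \<in> charts_at A q" "d \<in> charts_at B (\<psi> q)" "y = snd c q"
      using rep_dom_cases[OF cd] by metis
    show "fd (rep c d) y (tensor_comp A r\<^sub>N c w y) = tensor_comp B r\<^sub>M d (fd (rep c d) y w) (rep c d y)"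
      unfolding q(3) rep_at[OF q(1)] by (rule related_in_charts[OF rel r q(1,2)])
  qed
  ultimately have "(\<lambda>h. fd (\<lambda>m. tensor_comp B r\<^sub>M d (fd (rep c d) (snd c x) w) m) (snd d (\<psi> x)) (fd (rep c d) (snd c x) h)
      + tensor_comp B r\<^sub>M d (fd (\<lambda>y. fd (rep c d) y w) (snd c x) h) (snd d (\<psi> x)))
    = (\<lambda>h. fd (\<lambda>y. fd (rep c d) y (tensor_comp A r\<^sub>N c w (snd c x))) (snd c x) h
      + fd (rep c d) (snd c x) (fd (tensor_comp A r\<^sub>N c w) (snd c x) h))"
    by (rule has_derivative_unique)
  from fun_cong[OF this, of u] show ?thesis by simp
qed

lemma cotangent_map_component:
  assumes c: "c \<in> charts_at A x" and d: "d \<in> charts_at B (\<psi> x)"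
  shows "N.covector_comp c x (cotangent_map A B \<psi> x \<beta>) w
    = M.covector_comp d (\<psi> x) \<beta> (fd (rep c d) (snd c x) w)"
  using N.tangent_of_in[OF c, of w]
  by (simp add: N.covector_comp_def M.covector_comp_def cotangent_map_def restrict0_def
      tangent_map_tangent_of[OF c d])

text \<open>The coefficient functions lift a section of the pulled back structure to a combination
  of sections along \<open>\<psi>\<close>. Their derivatives only enter multiplied by pairings of elements of
  \<open>L\<^sub>M\<close>, which vanish.\<close>

lemma concomitant_at_lift_zero:
  fixes k :: nat
  assumes L: "dirac_structure B L\<^sub>M" and cm: "compatible B L\<^sub>M r\<^sub>M"
    and r: "r\<^sub>N \<in> vector_valued_oneforms A" "r\<^sub>M \<in> vector_valued_oneforms B"
    and rel: "related_by A B \<psi> r\<^sub>N r\<^sub>M"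
    and Y: "Y \<in> vfields_on A UNIV" and \<alpha>: "\<alpha> \<in> oneforms_on A UNIV"
    and e: "\<And>i. i < k \<Longrightarrow> e i \<in> sections B L\<^sub>M"
    and c: "c \<in> charts_at A x" and d: "d \<in> charts_at B (\<psi> x)"
    and W: "open W" "snd c x \<in> W"
    and g: "\<And>i. i < k \<Longrightarrow> g i differentiable (at (snd c x))"
    and liftY: "\<And>y. y \<in> W \<Longrightarrow> fd (rep c d) y (vfield_comp Y c y)
      = (\<Sum>i<k. g i y *\<^sub>R vfield_comp (\<lambda>q. fst (e i q)) d (rep c d y))"
    and lift\<alpha>: "\<And>y w. y \<in> W \<Longrightarrow> oneform_comp A \<alpha> c w y
      = (\<Sum>i<k. g i y * oneform_comp B (\<lambda>q. snd (e i q)) d (fd (rep c d) y w) (rep c d y))"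
    and z: "z \<in> tangent_space A x" and \<gamma>: "(tangent_map A B \<psi> x z, \<gamma>) \<in> L\<^sub>M (\<psi> x)"
  shows "N.concomitant_at r\<^sub>N c x Y \<alpha> v (z c) (N.covector_comp c x (cotangent_map A B \<psi> x \<gamma>)) = 0"
proof -
  have cd: "c \<in> A" "d \<in> B" "x \<in> fst c" "\<psi> x \<in> fst d" using c d by (auto simp: charts_at_def)
  note \<phi>x = rep_at[OF c, of d]
  have eY: "(\<lambda>q. fst (e i q)) \<in> vfields_on B UNIV" and e\<alpha>: "(\<lambda>q. snd (e i q)) \<in> oneforms_on B UNIV"
    and eL: "e i q \<in> L\<^sub>M q" if "i < k" for i q
    using e[OF that] by (auto simp: sections_on_def)
  have gd: "(g i has_derivative fd (g i) (snd c x)) (at (snd c x))" if "i < k" for i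
    by (rule has_derivative_frechet[OF g[OF that]])
  have m: "(tangent_map A B \<psi> x z, \<gamma>) \<in> gtangent_space B (\<psi> x)"
    using M.dirac_subset[OF L] \<gamma> by blast
  then have \<gamma>': "\<gamma> \<in> cotangent_space B (\<psi> x)" by (simp add: gtangent_space_def)
  define P where "P = fd (rep c d) (snd c x)"
  define H where "H = (\<lambda>u w. fd (\<lambda>y. fd (rep c d) y w) (snd c x) u)"
  have Pz: "tangent_map A B \<psi> x z d = P (z c)"
    unfolding P_def by (rule tangent_map_component[OF c d z])
  have dform: "((\<lambda>y. oneform_comp B (\<lambda>q. snd (e i q)) d (fd (rep c d) y w) (rep c d y)) has_derivative
      (\<lambda>h. fd (oneform_comp B (\<lambda>q. snd (e i q)) d (P w)) (snd d (\<psi> x)) (P h)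
        + M.covector_comp d (\<psi> x) (snd (e i (\<psi> x))) (H h w))) (at (snd c x))" if "i < k" for i w
    using has_derivative_rep_apply[where F = "\<lambda>m w. oneform_comp B (\<lambda>q. snd (e i q)) d w m", OF c d _
        M.oneform_differentiable[OF e\<alpha>[OF that] d], of w] M.linear_oneform_comp[OF e\<alpha>[OF that] cd(2)]
    by (simp add: P_def H_def M.oneform_comp_at[OF d] M.covector_comp_def)
  have dvec: "((\<lambda>y. vfield_comp (\<lambda>q. fst (e i q)) d (rep c d y)) has_derivative
      (\<lambda>h. fd (vfield_comp (\<lambda>q. fst (e i q)) d) (snd d (\<psi> x)) (P h))) (at (snd c x))" if "i < k" for i
    unfolding P_def
    by (rule has_derivative_compose[where f = "rep c d" and g = "vfield_comp (\<lambda>q. fst (e i q)) d",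
          OF rep_has_derivative[OF c d] M.vfield_differentiable[OF eY[OF that] d, folded \<phi>x], unfolded \<phi>x])
  have "N.concomitant_at r\<^sub>N c x Y \<alpha> v (z c) (\<lambda>w. M.covector_comp d (\<psi> x) \<gamma> (P w)) =
    (\<Sum>i<k. g i (snd c x) * M.concomitant_at r\<^sub>M d (\<psi> x) (\<lambda>q. fst (e i q)) (\<lambda>q. snd (e i q)) (P v) (P (z c))
          (M.covector_comp d (\<psi> x) \<gamma>)
      + fd (g i) (snd c x) v * (M.covector_comp d (\<psi> x) \<gamma> (tensor_comp B r\<^sub>M d (fst (e i (\<psi> x)) d) (snd d (\<psi> x)))
        + M.covector_comp d (\<psi> x) (snd (e i (\<psi> x))) (tensor_comp B r\<^sub>M d (P (z c)) (snd d (\<psi> x))))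
      - fd (g i) (snd c x) (tensor_comp A r\<^sub>N c v (snd c x)) * (M.covector_comp d (\<psi> x) \<gamma> (fst (e i (\<psi> x)) d)
        + M.covector_comp d (\<psi> x) (snd (e i (\<psi> x))) (P (z c))))"
    unfolding N.concomitant_at_def M.concomitant_at_def
  proof (rule concomitant_pullback[where H = H and P = P and k = k
        and R' = "\<lambda>w. tensor_comp B r\<^sub>M d w (snd d (\<psi> x))"
        and dR' = "\<lambda>u w. fd (tensor_comp B r\<^sub>M d w) (snd d (\<psi> x)) u"
        and R = "\<lambda>w. tensor_comp A r\<^sub>N c w (snd c x)"
        and dR = "\<lambda>u w. fd (tensor_comp A r\<^sub>N c w) (snd c x) u"
        and Y = "\<lambda>i. fst (e i (\<psi> x)) d" and y = "Y x c"
        and dY' = "\<lambda>i. fd (vfield_comp (\<lambda>q. fst (e i q)) d) (snd d (\<psi> x))"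
        and b = "\<lambda>i. M.covector_comp d (\<psi> x) (snd (e i (\<psi> x)))"
        and dB = "\<lambda>i u w. fd (oneform_comp B (\<lambda>q. snd (e i q)) d w) (snd d (\<psi> x)) u"
        and t = "\<lambda>i. g i (snd c x)" and dt = "\<lambda>i. fd (g i) (snd c x)"
        and g = "M.covector_comp d (\<psi> x) \<gamma>"])
    show "linear P" unfolding P_def by (rule has_derivative_linear[OF rep_has_derivative[OF c d]])
    show "linear (M.covector_comp d (\<psi> x) \<gamma>)"
      unfolding M.covector_comp_def by (rule M.linear_covector[OF d \<gamma>'])
    show "linear (\<lambda>w. tensor_comp B r\<^sub>M d w (snd d (\<psi> x)))"
      by (rule M.linear_tensor_comp[OF r(2) cd(2)]) (use cd in auto)
    show "linear (\<lambda>u. fd (tensor_comp B r\<^sub>M d w) (snd d (\<psi> x)) u)" for w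
      using linear_frechet_derivative[OF M.tensor_differentiable[OF r(2) d]] by simp
    show "linear (M.covector_comp d (\<psi> x) (snd (e i (\<psi> x))))" if "i < k" for i
      unfolding M.covector_comp_def by (rule M.linear_covector[OF d M.oneforms_onD(1)[OF e\<alpha>[OF that] UNIV_I]])
    show "H u w = H w u" for u w
      unfolding H_def
      by (rule smooth_on_fd_commute[OF open_rep_dom[OF cd(1,2)] in_rep_dom[OF c d] smooth_rep[OF cd(1,2)]])
    show "P (tensor_comp A r\<^sub>N c w (snd c x)) = tensor_comp B r\<^sub>M d (P w) (snd d (\<psi> x))" for w
      unfolding P_def by (rule related_in_charts[OF rel r c d])
    show "H u (tensor_comp A r\<^sub>N c w (snd c x)) + P (fd (tensor_comp A r\<^sub>N c w) (snd c x) u)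
      = fd (tensor_comp B r\<^sub>M d (P w)) (snd d (\<psi> x)) (P u) + tensor_comp B r\<^sub>M d (H u w) (snd d (\<psi> x))" for u w
      unfolding P_def H_def by (rule related_derivative[OF rel r c d])
    show "P (Y x c) = (\<Sum>i<k. g i (snd c x) *\<^sub>R fst (e i (\<psi> x)) d)"
      using liftY[OF W(2)] by (simp add: P_def \<phi>x N.vfield_comp_at[OF c] M.vfield_comp_at[OF d])
    show "N.covector_comp c x (\<alpha> x) w
      = (\<Sum>i<k. g i (snd c x) * M.covector_comp d (\<psi> x) (snd (e i (\<psi> x))) (P w))" for w
      using lift\<alpha>[OF W(2), of w]
      by (simp add: P_def \<phi>x N.oneform_comp_at[OF c] M.oneform_comp_at[OF d] N.covector_comp_def M.covector_comp_def)
    fix u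
    \<comment> \<open>The lifting identity holds on the open set \<open>W\<close>, so it may be
      differentiated: the product rule on either side gives the same derivative.\<close>
    have "((\<lambda>y. \<Sum>i<k. g i y *\<^sub>R vfield_comp (\<lambda>q. fst (e i q)) d (rep c d y)) has_derivative
        (\<lambda>h. \<Sum>i<k. g i (snd c x) *\<^sub>R fd (vfield_comp (\<lambda>q. fst (e i q)) d) (snd d (\<psi> x)) (P h)
          + fd (g i) (snd c x) h *\<^sub>R vfield_comp (\<lambda>q. fst (e i q)) d (rep c d (snd c x)))) (at (snd c x))"
      by (intro has_derivative_sum has_derivative_scaleR gd dvec) auto
    moreover have "((\<lambda>y. \<Sum>i<k. g i y *\<^sub>R vfield_comp (\<lambda>q. fst (e i q)) d (rep c d y)) has_derivative
        (\<lambda>h. fd (\<lambda>y. fd (rep c d) y (vfield_comp Y c (snd c x))) (snd c x) h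
          + P (fd (vfield_comp Y c) (snd c x) h))) (at (snd c x))"
      unfolding P_def
      by (rule has_derivative_transform_within_open[OF has_derivative_rep_fd_apply[OF c d
            N.vfield_differentiable[OF Y c]] W liftY])
    ultimately have "(\<lambda>h. \<Sum>i<k. g i (snd c x) *\<^sub>R fd (vfield_comp (\<lambda>q. fst (e i q)) d) (snd d (\<psi> x)) (P h)
          + fd (g i) (snd c x) h *\<^sub>R vfield_comp (\<lambda>q. fst (e i q)) d (rep c d (snd c x)))
      = (\<lambda>h. fd (\<lambda>y. fd (rep c d) y (vfield_comp Y c (snd c x))) (snd c x) h
          + P (fd (vfield_comp Y c) (snd c x) h))"
      by (rule has_derivative_unique)
    from fun_cong[OF this, of u]
    show "H u (Y x c) + P (fd (vfield_comp Y c) (snd c x) u)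
      = (\<Sum>i<k. g i (snd c x) *\<^sub>R fd (vfield_comp (\<lambda>q. fst (e i q)) d) (snd d (\<psi> x)) (P u)
          + fd (g i) (snd c x) u *\<^sub>R fst (e i (\<psi> x)) d)"
      by (simp add: H_def \<phi>x N.vfield_comp_at[OF c] M.vfield_comp_at[OF d])
    fix w
    have "((\<lambda>y. \<Sum>i<k. g i y * oneform_comp B (\<lambda>q. snd (e i q)) d (fd (rep c d) y w) (rep c d y)) has_derivative
        (\<lambda>h. \<Sum>i<k. g i (snd c x) * (fd (oneform_comp B (\<lambda>q. snd (e i q)) d (P w)) (snd d (\<psi> x)) (P h)
            + M.covector_comp d (\<psi> x) (snd (e i (\<psi> x))) (H h w))
          + fd (g i) (snd c x) h * oneform_comp B (\<lambda>q. snd (e i q)) d (fd (rep c d) (snd c x) w) (rep c d (snd c x))))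
        (at (snd c x))"
      by (intro has_derivative_sum has_derivative_mult gd dform) auto
    then have "(oneform_comp A \<alpha> c w has_derivative
        (\<lambda>h. \<Sum>i<k. g i (snd c x) * (fd (oneform_comp B (\<lambda>q. snd (e i q)) d (P w)) (snd d (\<psi> x)) (P h)
            + M.covector_comp d (\<psi> x) (snd (e i (\<psi> x))) (H h w))
          + fd (g i) (snd c x) h * oneform_comp B (\<lambda>q. snd (e i q)) d (fd (rep c d) (snd c x) w) (rep c d (snd c x))))
        (at (snd c x))"
      by (rule has_derivative_transform_within_open[OF _ W]) (simp add: lift\<alpha>)
    from frechet_derivative_eq[OF this]
    show "fd (oneform_comp A \<alpha> c w) (snd c x) u =
      (\<Sum>i<k. g i (snd c x) * (fd (oneform_comp B (\<lambda>q. snd (e i q)) d (P w)) (snd d (\<psi> x)) (P u)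
            + M.covector_comp d (\<psi> x) (snd (e i (\<psi> x))) (H u w))
          + fd (g i) (snd c x) u * M.covector_comp d (\<psi> x) (snd (e i (\<psi> x))) (P w))"
      by (simp add: \<phi>x P_def M.oneform_comp_at[OF d] M.covector_comp_def)
  qed
  also have "\<dots> = 0"
  proof (rule sum.neutral, rule ballI)
    fix i assume "i \<in> {..<k}"
    then have i: "i < k" by simp
    have eg: "fst (e i (\<psi> x)) \<in> tangent_space B (\<psi> x)" by (rule M.vfields_onD(1)[OF eY[OF i] UNIV_I])
    have "M.concomitant_at r\<^sub>M d (\<psi> x) (\<lambda>q. fst (e i q)) (\<lambda>q. snd (e i q)) (P v) (P (z c))
        (M.covector_comp d (\<psi> x) \<gamma>) = 0"
      using M.compatible_concomitant_at[OF L r(2) cm e[OF i] d \<gamma>] by (simp add: Pz)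
    moreover have "M.covector_comp d (\<psi> x) \<gamma> (fst (e i (\<psi> x)) d)
        + M.covector_comp d (\<psi> x) (snd (e i (\<psi> x))) (P (z c)) = 0"
      using M.dirac_isotropic[OF L eL[OF i] \<gamma>]
      by (simp add: pairing_def M.covector_comp_def M.covector_component[OF d] eg tangent_map_in[OF z] Pz[symmetric])
    \<comment> \<open>The pointwise half of compatibility keeps the image of \<open>e i\<close>
      under \<open>r\<^sub>M\<close> and its dual in \<open>L\<^sub>M\<close>, so isotropy applies
      to it as well as to \<open>e i\<close>.\<close>
    moreover have "(r\<^sub>M (\<psi> x) (fst (e i (\<psi> x))), dual_map B r\<^sub>M (\<psi> x) (snd (e i (\<psi> x)))) \<in> L\<^sub>M (\<psi> x)"
      using cm eL[OF i, of "\<psi> x"] by (auto simp: compatible_def split_beta)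
    from M.dirac_isotropic[OF L this \<gamma>]
    have "M.covector_comp d (\<psi> x) \<gamma> (tensor_comp B r\<^sub>M d (fst (e i (\<psi> x)) d) (snd d (\<psi> x)))
        + M.covector_comp d (\<psi> x) (snd (e i (\<psi> x))) (tensor_comp B r\<^sub>M d (P (z c)) (snd d (\<psi> x))) = 0"
      by (simp add: pairing_def M.covector_comp_def M.covector_component[OF d] eg tangent_map_in[OF z]
          Pz[symmetric] M.tensor_apply_component[OF d, symmetric] M.tensorD(1)[OF r(2)]
          dual_map_def restrict0_def)
    ultimately show "g i (snd c x) * M.concomitant_at r\<^sub>M d (\<psi> x) (\<lambda>q. fst (e i q)) (\<lambda>q. snd (e i q)) (P v) (P (z c))
          (M.covector_comp d (\<psi> x) \<gamma>)
      + fd (g i) (snd c x) v * (M.covector_comp d (\<psi> x) \<gamma> (tensor_comp B r\<^sub>M d (fst (e i (\<psi> x)) d) (snd d (\<psi> x)))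
        + M.covector_comp d (\<psi> x) (snd (e i (\<psi> x))) (tensor_comp B r\<^sub>M d (P (z c)) (snd d (\<psi> x))))
      - fd (g i) (snd c x) (tensor_comp A r\<^sub>N c v (snd c x)) * (M.covector_comp d (\<psi> x) \<gamma> (fst (e i (\<psi> x)) d)
        + M.covector_comp d (\<psi> x) (snd (e i (\<psi> x))) (P (z c))) = 0"
      by simp
  qed
  finally show ?thesis
    by (simp add: P_def cotangent_map_component[OF c d, symmetric])
qed

end

section \<open>Backward Dirac maps\<close>

lemma linear_on_set_zero: "linear_on_set V f \<Longrightarrow> 0 \<in> V \<Longrightarrow> f 0 = 0"
  unfolding linear_on_set_def by (metis scaleR_zero_left)

text \<open>Covectors are linear on the tangent space only, so membership of the partial sums is
  carried through the same induction.\<close>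

lemma pairing_sum_right:
  assumes "\<And>i. i \<in> I \<Longrightarrow> b i \<in> gtangent_space A p" "a \<in> gtangent_space A p" "manifold A"
  shows "pairing a (\<Sum>i\<in>I. t i *\<^sub>R b i) = (\<Sum>i\<in>I. t i * pairing a (b i))"
    and "(\<Sum>i\<in>I. t i *\<^sub>R b i) \<in> gtangent_space A p"
proof -
  interpret manifold A by fact
  have lin: "linear_on_set (tangent_space A p) (snd a)"
    using assms(2) by (auto simp: gtangent_space_def cotangent_space_def)
  have "pairing a (\<Sum>i\<in>I. t i *\<^sub>R b i) = (\<Sum>i\<in>I. t i * pairing a (b i)) \<and>
    (\<Sum>i\<in>I. t i *\<^sub>R b i) \<in> gtangent_space A p"
    using assms(1)
  proof (induction I rule: infinite_finite_induct)
    case (insert i I)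
    have b: "fst (b i) \<in> tangent_space A p" "snd (b i) \<in> cotangent_space A p"
      using insert.prems[of i] by (auto simp: gtangent_space_def)
    define S where "S = (\<Sum>i\<in>I. t i *\<^sub>R b i)"
    have S: "fst S \<in> tangent_space A p" "snd S \<in> cotangent_space A p"
      and pS: "pairing a S = (\<Sum>i\<in>I. t i * pairing a (b i))"
      using insert by (auto simp: S_def gtangent_space_def)
    have "snd (t i *\<^sub>R b i + S) \<in> cotangent_space A p"
      using cotangent_space_diff[OF cotangent_space_scaleR[OF b(2), of "t i"] cotangent_space_scaleR[OF S(2), of "-1"]]
      by simp
    moreover have "pairing a (t i *\<^sub>R b i + S) = t i * pairing a (b i) + pairing a S"
      using lin tangent_space_scaleR[OF b(1), of "t i"] b S
      by (simp add: pairing_def linear_on_set_def scaleR_fun_def[of _ "snd (b i)"] algebra_simps)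
    ultimately show ?case
      using insert(1,2) b S pS tangent_space_add[OF tangent_space_scaleR[OF b(1)] S(1), of "t i"]
      by (simp add: S_def[symmetric] gtangent_space_def mem_Times_iff)
  qed (auto simp: pairing_def gtangent_space_def zero_prod_def tangent_space_zero cotangent_space_zero
      intro: linear_on_set_zero[OF lin])
  then show "pairing a (\<Sum>i\<in>I. t i *\<^sub>R b i) = (\<Sum>i\<in>I. t i * pairing a (b i))"
    and "(\<Sum>i\<in>I. t i *\<^sub>R b i) \<in> gtangent_space A p" by auto
qed

context manifold_map
begin

lemma backward_dirac_map_lift:
  assumes "backward_dirac_map A L\<^sub>N B L\<^sub>M \<psi>" "a \<in> L\<^sub>N x"
  obtains \<beta> where "fst a \<in> tangent_space A x" "snd a = cotangent_map A B \<psi> x \<beta>"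
    "(tangent_map A B \<psi> x (fst a), \<beta>) \<in> L\<^sub>M (\<psi> x)"
  using assms unfolding backward_dirac_map_def by force

lemma differentiable_oneform_along:
  assumes "\<alpha> \<in> oneforms_on B UNIV" "c \<in> charts_at A x" "d \<in> charts_at B (\<psi> x)"
  shows "(\<lambda>y. oneform_comp B \<alpha> d (fd (rep c d) y w) (rep c d y)) differentiable (at (snd c x))"
proof -
  have "d \<in> B" using assms(3) by (simp add: charts_at_def)
  then have "linear (\<lambda>w. oneform_comp B \<alpha> d w m)" if "m \<in> snd d ` fst d" for m
    using M.linear_oneform_comp[OF assms(1), of d] that by simp
  from has_derivative_rep_apply[where F = "\<lambda>m w. oneform_comp B \<alpha> d w m", OF assms(2,3) this
      M.oneform_differentiable[OF assms(1,3)]]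
  show ?thesis by (rule has_derivative_imp_differentiable)
qed

lemma differentiable_vfield_along:
  assumes "X \<in> vfields_on B UNIV" "c \<in> charts_at A x" "d \<in> charts_at B (\<psi> x)"
  shows "(\<lambda>y. vfield_comp X d (rep c d y)) differentiable (at (snd c x))"
  by (rule has_derivative_imp_differentiable,
      rule has_derivative_compose[where f = "rep c d" and g = "vfield_comp X d",
        OF rep_has_derivative[OF assms(2,3)] M.vfield_differentiable[OF assms(1,3), folded rep_at[OF assms(2), of d]]])

text \<open>Density in the form in which it is used: every nonempty open \<open>W\<close> inside the
  common domain contains a good point. Lifting s is a linear system for the coefficients of the
  spanning sections, and the backward Dirac property is its solvability at each single
  point.\<close>

lemma DD_op_orthogonal_somewhere:
  fixes k :: nat
  assumes LM: "dirac_structure B L\<^sub>M" and LN: "dirac_structure A L\<^sub>N"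
    and bw: "backward_dirac_map A L\<^sub>N B L\<^sub>M \<psi>" and cm: "compatible B L\<^sub>M r\<^sub>M"
    and r: "r\<^sub>N \<in> vector_valued_oneforms A" "r\<^sub>M \<in> vector_valued_oneforms B"
    and rel: "related_by A B \<psi> r\<^sub>N r\<^sub>M"
    and X: "X \<in> vfields_on A UNIV" and s: "s \<in> sections A L\<^sub>N"
    and e: "\<And>i. i < k \<Longrightarrow> e i \<in> sections B L\<^sub>M"
    and span: "\<And>q a. q \<in> V \<Longrightarrow> a \<in> L\<^sub>M q \<Longrightarrow> \<exists>t. a = (\<Sum>i<k. t i *\<^sub>R e i q)"
    and cd: "c \<in> A" "d \<in> B"
    and W: "open W" "W \<noteq> {}" "W \<subseteq> snd c ` (fst c \<inter> \<psi> -` (fst d \<inter> V))"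
  shows "\<exists>y\<in>W. \<forall>b\<in>L\<^sub>N (chart_inv c y). pairing (DD_op A r\<^sub>N X s (chart_inv c y)) b = 0"
proof -
  define Y where "Y = (\<lambda>q. fst (s q))"
  define \<alpha> where "\<alpha> = (\<lambda>q. snd (s q))"
  have Y: "Y \<in> vfields_on A UNIV" and \<alpha>: "\<alpha> \<in> oneforms_on A UNIV" and sL: "\<And>q. s q \<in> L\<^sub>N q"
    using s by (auto simp: sections_on_def Y_def \<alpha>_def)
  have eY: "(\<lambda>q. fst (e i q)) \<in> vfields_on B UNIV" and e\<alpha>: "(\<lambda>q. snd (e i q)) \<in> oneforms_on B UNIV"
    if "i < k" for i using e[OF that] by (auto simp: sections_on_def)
  have pt: "\<exists>q. c \<in> charts_at A q \<and> d \<in> charts_at B (\<psi> q) \<and> \<psi> q \<in> V \<and> y = snd c q \<and> chart_inv c y = q"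
    if "y \<in> W" for y using that W(3) cd by (auto simp: charts_at_def)
  \<comment> \<open>One scalar equation for each test vector: \<open>Inl u\<close> evaluates the
    covector part on u, \<open>Inr u\<close> takes the inner product of the vector part with u.
    Taking all u avoids a choice of bases.\<close>
  define v :: "nat \<Rightarrow> 'd + 'e \<Rightarrow> 'd \<Rightarrow> real" where "v = (\<lambda>i \<kappa> y. case \<kappa> of
      Inl u \<Rightarrow> oneform_comp B (\<lambda>q. snd (e i q)) d (fd (rep c d) y u) (rep c d y)
    | Inr u \<Rightarrow> vfield_comp (\<lambda>q. fst (e i q)) d (rep c d y) \<bullet> u)"
  define w :: "'d + 'e \<Rightarrow> 'd \<Rightarrow> real" where "w = (\<lambda>\<kappa> y. case \<kappa> of
      Inl u \<Rightarrow> oneform_comp A \<alpha> c u y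
    | Inr u \<Rightarrow> fd (rep c d) y (vfield_comp Y c y) \<bullet> u)"
  have "\<exists>V g. open V \<and> V \<noteq> {} \<and> V \<subseteq> W \<and> (\<forall>i<k. \<forall>y\<in>V. g i differentiable (at y)) \<and>
    (\<forall>y\<in>V. \<forall>\<kappa>. w \<kappa> y = (\<Sum>i<k. g i y * v i \<kappa> y))"
  proof (rule differentiable_solution_on_open_subset[OF W(1,2)])
    fix i :: nat and \<kappa> :: "'d + 'e" and y assume i: "i < k" and "y \<in> W"
    then obtain q where q: "c \<in> charts_at A q" "d \<in> charts_at B (\<psi> q)" "y = snd c q"
      using pt by blast
    show "v i \<kappa> differentiable (at y)"
    proof (cases \<kappa>)
      case (Inl u)
      then show ?thesis unfolding v_def q(3)
        using differentiable_oneform_along[OF e\<alpha>[OF i] q(1,2)] by simp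
    next
      case (Inr u)
      then show ?thesis unfolding v_def q(3)
        using has_derivative_imp_differentiable[OF has_derivative_inner_left[OF
              has_derivative_frechet[OF differentiable_vfield_along[OF eY[OF i] q(1,2)]]]] by simp
    qed
  next
    fix \<kappa> :: "'d + 'e" and y assume "y \<in> W"
    then obtain q where q: "c \<in> charts_at A q" "d \<in> charts_at B (\<psi> q)" "y = snd c q"
      using pt by blast
    show "w \<kappa> differentiable (at y)"
    proof (cases \<kappa>)
      case (Inl u)
      then show ?thesis unfolding w_def q(3) using N.oneform_differentiable[OF \<alpha> q(1), of u] by simp
    next
      case (Inr u)
      then show ?thesis unfolding w_def q(3)
        using has_derivative_imp_differentiable[OF has_derivative_inner_left[OF
              has_derivative_rep_fd_apply[OF q(1,2) N.vfield_differentiable[OF Y q(1)]]]] by simp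
    qed
  next
    fix y assume "y \<in> W"
    then obtain q where q: "c \<in> charts_at A q" "d \<in> charts_at B (\<psi> q)" "\<psi> q \<in> V" "y = snd c q"
      using pt by blast
    \<comment> \<open>A lift at one point, without any regularity in y, is all that the elimination
      asks for.\<close>
    obtain \<beta> where \<beta>: "Y q \<in> tangent_space A q" "\<alpha> q = cotangent_map A B \<psi> q \<beta>"
      "(tangent_map A B \<psi> q (Y q), \<beta>) \<in> L\<^sub>M (\<psi> q)"
      using backward_dirac_map_lift[OF bw sL[of q]] unfolding Y_def \<alpha>_def by blast
    obtain t where t: "(tangent_map A B \<psi> q (Y q), \<beta>) = (\<Sum>i<k. t i *\<^sub>R e i (\<psi> q))"
      using span[OF q(3) \<beta>(3)] by blast
    have tY: "tangent_map A B \<psi> q (Y q) = (\<Sum>i<k. t i *\<^sub>R fst (e i (\<psi> q)))"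
      using arg_cong[OF t, of fst] by (simp add: fst_sum)
    have t\<beta>: "\<beta> = (\<Sum>i<k. t i *\<^sub>R snd (e i (\<psi> q)))"
      using arg_cong[OF t, of snd] by (simp add: snd_sum)
    have sum_apply: "(\<Sum>i<k. t i *\<^sub>R f i) z = (\<Sum>i<k. t i *\<^sub>R f i z)"
      for f :: "nat \<Rightarrow> 'z \<Rightarrow> 'y::real_vector" and z
      by (induction k) (simp_all add: scaleR_fun_def)
    show "\<exists>t. \<forall>\<kappa>. w \<kappa> y = (\<Sum>i<k. t i * v i \<kappa> y)"
    proof (intro exI[of _ t] allI)
      fix \<kappa> :: "'d + 'e"
      show "w \<kappa> y = (\<Sum>i<k. t i * v i \<kappa> y)"
      proof (cases \<kappa>)
        case (Inl u)
        have "oneform_comp A \<alpha> c u y = \<beta> (tangent_of B d (\<psi> q) (fd (rep c d) (snd c q) u))"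
          unfolding q(4) N.oneform_comp_at[OF q(1)] \<beta>(2)
          using cotangent_map_component[OF q(1,2), of \<beta> u] by (simp add: N.covector_comp_def M.covector_comp_def)
        then show ?thesis
          unfolding Inl v_def w_def sum.case q(4) rep_at[OF q(1)] M.oneform_comp_at[OF q(2)] t\<beta>
          by (simp add: sum_apply)
      next
        case (Inr u)
        have "fd (rep c d) y (vfield_comp Y c y) = tangent_map A B \<psi> q (Y q) d"
          unfolding q(4) N.vfield_comp_at[OF q(1)] tangent_map_component[OF q(1,2) \<beta>(1)] ..
        also have "\<dots> = (\<Sum>i<k. t i *\<^sub>R fst (e i (\<psi> q)) d)"
          unfolding tY by (rule sum_apply)
        finally show ?thesis
          unfolding Inr v_def w_def sum.case
          by (simp add: q(4) rep_at[OF q(1)] M.vfield_comp_at[OF q(2)] inner_sum_left)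
      qed
    qed
  qed
  then obtain W' g where W': "open W'" "W' \<noteq> {}" "W' \<subseteq> W"
    and g: "\<forall>i<k. \<forall>y\<in>W'. g i differentiable (at y)"
    and eq: "\<forall>y\<in>W'. \<forall>\<kappa>. w \<kappa> y = (\<Sum>i<k. g i y * v i \<kappa> y)"
    by (elim exE conjE) (rule that)
  obtain y where y: "y \<in> W'" using W'(2) by blast
  obtain q where q: "c \<in> charts_at A q" "d \<in> charts_at B (\<psi> q)" "y = snd c q" "chart_inv c y = q"
    using pt y W'(3) by blast
  have liftY: "fd (rep c d) y (vfield_comp Y c y)
      = (\<Sum>i<k. g i y *\<^sub>R vfield_comp (\<lambda>q. fst (e i q)) d (rep c d y))" if "y \<in> W'" for y
  proof -
    have "fd (rep c d) y (vfield_comp Y c y) \<bullet> u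
      = (\<Sum>i<k. g i y *\<^sub>R vfield_comp (\<lambda>q. fst (e i q)) d (rep c d y)) \<bullet> u" for u
      using bspec[OF eq that, THEN spec, of "Inr u"] by (simp add: w_def v_def inner_sum_left)
    then show ?thesis using vector_eq_rdot by blast
  qed
  have lift\<alpha>: "oneform_comp A \<alpha> c u y
      = (\<Sum>i<k. g i y * oneform_comp B (\<lambda>q. snd (e i q)) d (fd (rep c d) y u) (rep c d y))"
    if "y \<in> W'" for y u
    using bspec[OF eq that, THEN spec, of "Inl u"] by (simp add: w_def v_def)
  have "pairing (DD_op A r\<^sub>N X s q) b = 0" if b: "b \<in> L\<^sub>N q" for b
  proof -
    \<comment> \<open>Since b is never differentiated, its lift at the point q alone is
      enough.\<close>
    obtain \<gamma> where \<gamma>: "fst b \<in> tangent_space A q" "snd b = cotangent_map A B \<psi> q \<gamma>"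
      "(tangent_map A B \<psi> q (fst b), \<gamma>) \<in> L\<^sub>M (\<psi> q)"
      using backward_dirac_map_lift[OF bw b] by blast
    have "b \<in> gtangent_space A q" using N.dirac_subset[OF LN] b by blast
    from N.pairing_DD_op[OF r(1) X s q(1) this]
    show ?thesis
      unfolding Y_def[symmetric] \<alpha>_def[symmetric] \<gamma>(2)
      using concomitant_at_lift_zero[OF LM cm r rel Y \<alpha> e q(1,2) W'(1) y[unfolded q(3)]
          g[rule_format, OF _ y, unfolded q(3)] liftY lift\<alpha> \<gamma>(1,3)]
      by simp
  qed
  then show ?thesis using y W'(3) q(4) by blast
qed

text \<open>Continuity needs a section to pair with, while b is a vector at x only; so local frame
  sections of \<open>L\<^sub>N\<close> are tested first. A pairing that is nonzero at x stays
  nonzero on an open set, which \<open>DD_op_orthogonal_somewhere\<close> forbids; linearity then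
  gives b.\<close>

lemma DD_op_orthogonal:
  assumes LM: "dirac_structure B L\<^sub>M" and LN: "dirac_structure A L\<^sub>N"
    and bw: "backward_dirac_map A L\<^sub>N B L\<^sub>M \<psi>" and cm: "compatible B L\<^sub>M r\<^sub>M"
    and r: "r\<^sub>N \<in> vector_valued_oneforms A" "r\<^sub>M \<in> vector_valued_oneforms B"
    and rel: "related_by A B \<psi> r\<^sub>N r\<^sub>M"
    and X: "X \<in> vfields_on A UNIV" and s: "s \<in> sections A L\<^sub>N" and b: "b \<in> L\<^sub>N x"
  shows "pairing (DD_op A r\<^sub>N X s x) b = 0"
proof -
  define Y where "Y = D_op A r\<^sub>N X (\<lambda>q. fst (s q))"
  define \<alpha> where "\<alpha> = D_op_dual A r\<^sub>N X (\<lambda>q. snd (s q))"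
  have Y: "Y \<in> vfields_on A UNIV" and \<alpha>: "\<alpha> \<in> oneforms_on A UNIV"
    using s N.D_op_vfields[OF r(1) X] N.D_op_dual_oneforms[OF r(1) X]
    by (auto simp: sections_on_def Y_def \<alpha>_def)
  have DD: "DD_op A r\<^sub>N X s q = (Y q, \<alpha> q)" for q by (simp add: DD_op_def Y_def \<alpha>_def)
  define c where "c = some_chart_at A x"
  define d where "d = some_chart_at B (\<psi> x)"
  have c: "c \<in> A" "x \<in> fst c" and d: "d \<in> B" "\<psi> x \<in> fst d"
    using N.some_chart[of x] M.some_chart[of "\<psi> x"] by (auto simp: c_def d_def charts_at_def)
  have sub: "subbundle B L\<^sub>M" "subbundle A L\<^sub>N" using LM LN by (auto simp: dirac_structure_def)
  obtain V k and e :: "nat \<Rightarrow> 'b \<Rightarrow> ('b, 'e) gvector"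
    where V: "open V" "\<psi> x \<in> V" and e: "\<And>i. i < k \<Longrightarrow> e i \<in> sections B L\<^sub>M"
      and sp: "\<And>q a. q \<in> V \<Longrightarrow> a \<in> L\<^sub>M q \<Longrightarrow> \<exists>t. a = (\<Sum>i<k. t i *\<^sub>R e i q)"
    by (rule M.subbundle_spanning_sections[OF sub(1), of "\<psi> x"]) (rule that)
  obtain U l and f :: "nat \<Rightarrow> 'a \<Rightarrow> ('a, 'd) gvector"
    where U: "open U" "x \<in> U" and f: "\<And>i. i < l \<Longrightarrow> f i \<in> sections_on A U L\<^sub>N"
      and inj: "\<And>q. q \<in> U \<Longrightarrow> inj_on (\<lambda>i. f i q) {..<l}"
      and fr: "\<And>q. q \<in> U \<Longrightarrow> span ((\<lambda>i. f i q) ` {..<l}) = L\<^sub>N q"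
    by (rule N.subbundle_local_frame[OF sub(2), of x]) (rule that)
  \<comment> \<open>On \<open>S\<close> all local data are available together: both charts, the
    frame of \<open>L\<^sub>N\<close>, and the sections spanning \<open>L\<^sub>M\<close> along
    \<psi>.\<close>
  define S where "S = snd c ` (fst c \<inter> (U \<inter> \<psi> -` (fst d \<inter> V)))"
  have S: "open S" "snd c x \<in> S" "S \<subseteq> snd c ` (fst c \<inter> \<psi> -` (fst d \<inter> V))" "S \<subseteq> snd c ` (fst c \<inter> U)"
    unfolding S_def using c d U V
    by (auto intro!: N.open_chart_image open_Int open_preimage M.open_chart)
  have zero: "pairing (DD_op A r\<^sub>N X s x) (f i x) = 0" if i: "i < l" for i
  proof (rule ccontr)
    assume nz: "pairing (DD_op A r\<^sub>N X s x) (f i x) \<noteq> 0"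
    have fY: "(\<lambda>q. fst (f i q)) \<in> vfields_on A U" and f\<alpha>: "(\<lambda>q. snd (f i q)) \<in> oneforms_on A U"
      and fL: "\<And>q. q \<in> U \<Longrightarrow> f i q \<in> L\<^sub>N q"
      using f[OF i] by (auto simp: sections_on_def)
    define F where "F = (\<lambda>y. pairing (DD_op A r\<^sub>N X s (chart_inv c y)) (f i (chart_inv c y)))"
    note o = N.open_chart_image[OF c(1) U(1)]
    have restr: "smooth_on (snd c ` (fst c \<inter> U)) h"
      if "smooth_on (snd c ` (fst c \<inter> UNIV)) h" "c \<in> A"
      for c and h :: "'d \<Rightarrow> 'z::real_normed_vector"
      by (rule smooth_on_subset[OF that(1) N.open_chart_image[OF that(2) open_UNIV]]) auto
    have "\<alpha> \<in> oneforms_on A U"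
      unfolding oneforms_on_def
      using N.oneforms_onD(1)[OF \<alpha> UNIV_I] restr[OF N.oneforms_onD(2)[OF \<alpha>]] by blast
    then have "smooth_on (snd c ` (fst c \<inter> U)) (\<lambda>y.
        oneform_comp A (\<lambda>q. snd (f i q)) c (vfield_comp Y c y) y
        + oneform_comp A \<alpha> c (vfield_comp (\<lambda>q. fst (f i q)) c y) y)"
      by (intro smooth_on_add o N.smooth_on_oneform_apply[OF _ c(1) U(1)] f\<alpha>
          restr[OF N.vfields_onD(2)[OF Y c(1)] c(1)] N.vfields_onD(2)[OF fY c(1)])
    then have "smooth_on (snd c ` (fst c \<inter> U)) F"
    proof (rule smooth_on_cong[OF _ o])
      fix y assume "y \<in> snd c ` (fst c \<inter> U)"
      then obtain q where q: "q \<in> U" "c \<in> charts_at A q" "y = snd c q" "chart_inv c y = q"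
        using N.chart_image_cases[OF c(1)] by metis
      show "F y = oneform_comp A (\<lambda>q. snd (f i q)) c (vfield_comp Y c y) y
        + oneform_comp A \<alpha> c (vfield_comp (\<lambda>q. fst (f i q)) c y) y"
        unfolding F_def q(4) DD pairing_def fst_conv snd_conv
        unfolding q(3) N.oneform_comp_at[OF q(2)] N.vfield_comp_at[OF q(2)]
          N.tangent_of_component[OF q(2) N.vfields_onD(1)[OF Y UNIV_I]]
          N.tangent_of_component[OF q(2) N.vfields_onD(1)[OF fY q(1)]] ..
    qed
    then have "continuous_on S F"
      using S(4) smooth_on_imp_continuous_on continuous_on_subset by blast
    then have "open (S \<inter> F -` (- {0}))"
      using S(1) by (intro continuous_open_preimage) auto
    moreover have "snd c x \<in> S \<inter> F -` (- {0})" using nz S(2) c by (simp add: F_def)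
    ultimately obtain y where y: "y \<in> S \<inter> F -` (- {0})"
      "\<forall>b\<in>L\<^sub>N (chart_inv c y). pairing (DD_op A r\<^sub>N X s (chart_inv c y)) b = 0"
      using DD_op_orthogonal_somewhere[where W = "S \<inter> F -` (- {0})", OF LM LN bw cm r rel X s e sp c(1) d(1)] S(3)
      by blast
    have "chart_inv c y \<in> U" using y(1) S(4) c N.chart_inv_in[OF c(1), of y U] by blast
    then have "F y = 0" unfolding F_def using y(2) fL by blast
    then show False using y(1) by simp
  qed
  have "b \<in> span ((\<lambda>i. f i x) ` {..<l})" using b fr[OF U(2)] by simp
  then obtain u where "b = (\<Sum>v\<in>(\<lambda>i. f i x) ` {..<l}. u v *\<^sub>R v)"
    by (auto simp: span_finite)
  then have beq: "b = (\<Sum>i<l. u (f i x) *\<^sub>R f i x)"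
    using inj[OF U(2)] by (simp add: sum.reindex)
  have "f i x \<in> gtangent_space A x" if "i \<in> {..<l}" for i
    using f[of i] that U(2) N.dirac_subset[OF LN] by (auto simp: sections_on_def)
  moreover have "DD_op A r\<^sub>N X s x \<in> gtangent_space A x"
    using N.vfields_onD(1)[OF Y] N.oneforms_onD(1)[OF \<alpha>] by (simp add: DD gtangent_space_def)
  ultimately have "pairing (DD_op A r\<^sub>N X s x) b = (\<Sum>i<l. u (f i x) * pairing (DD_op A r\<^sub>N X s x) (f i x))"
    unfolding beq using N.manifold_axioms by (intro pairing_sum_right(1))
  then show ?thesis using zero by simp
qed

text \<open>The pointwise half involves no derivatives. Dualising the relation, the cotangent map of
  \<psi> intertwines the duals of \<open>r\<^sub>M\<close> and \<open>r\<^sub>N\<close>; hence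
  applying \<open>r\<^sub>M\<close> and its dual to a lift gives a lift of the image under
  \<open>r\<^sub>N\<close> and its dual.\<close>

lemma backward_dirac_map_compatible:
  assumes LN: "dirac_structure A L\<^sub>N" and LM: "dirac_structure B L\<^sub>M"
    and bw: "backward_dirac_map A L\<^sub>N B L\<^sub>M \<psi>"
    and r: "r\<^sub>N \<in> vector_valued_oneforms A" "r\<^sub>M \<in> vector_valued_oneforms B"
    and rel: "related_by A B \<psi> r\<^sub>N r\<^sub>M" and cm: "compatible B L\<^sub>M r\<^sub>M"
  shows "compatible A L\<^sub>N r\<^sub>N"
proof -
  have "(r\<^sub>N x v, dual_map A r\<^sub>N x \<alpha>) \<in> L\<^sub>N x" if v: "(v, \<alpha>) \<in> L\<^sub>N x" for x v \<alpha>
  proof -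
    obtain \<beta> where \<beta>: "v \<in> tangent_space A x" "\<alpha> = cotangent_map A B \<psi> x \<beta>"
      "(tangent_map A B \<psi> x v, \<beta>) \<in> L\<^sub>M (\<psi> x)"
      using backward_dirac_map_lift[OF bw v] by auto
    have rv: "r\<^sub>M (\<psi> x) (tangent_map A B \<psi> x u) = tangent_map A B \<psi> x (r\<^sub>N x u)"
      if "u \<in> tangent_space A x" for u using rel that by (simp add: related_by_def)
    have "(r\<^sub>M (\<psi> x) (tangent_map A B \<psi> x v), dual_map B r\<^sub>M (\<psi> x) \<beta>) \<in> L\<^sub>M (\<psi> x)"
      using cm \<beta>(3) unfolding compatible_def by blast
    moreover have "\<beta> \<in> cotangent_space B (\<psi> x)"
      using M.dirac_subset[OF LM] \<beta>(3) by (auto simp: gtangent_space_def)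
    moreover have "dual_map A r\<^sub>N x \<alpha> = cotangent_map A B \<psi> x (dual_map B r\<^sub>M (\<psi> x) \<beta>)"
      unfolding \<beta>(2) dual_map_def cotangent_map_def restrict0_def
      by (rule ext) (simp add: N.tensorD(1)[OF r(1)] tangent_map_in rv)
    ultimately show ?thesis
      using bw \<beta>(1) N.tensorD(1)[OF r(1) \<beta>(1)] M.dual_map_cotangent[OF r(2)] rv
      unfolding backward_dirac_map_def by auto
  qed
  moreover have "DD_op A r\<^sub>N X s \<in> sections A L\<^sub>N" if X: "X \<in> vfields_on A UNIV" and s: "s \<in> sections A L\<^sub>N" for X s
  proof -
    have Y: "(\<lambda>q. fst (DD_op A r\<^sub>N X s q)) \<in> vfields_on A UNIV"
      and \<alpha>: "(\<lambda>q. snd (DD_op A r\<^sub>N X s q)) \<in> oneforms_on A UNIV"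
      using s N.D_op_vfields[OF r(1) X] N.D_op_dual_oneforms[OF r(1) X]
      by (auto simp: sections_on_def DD_op_def)
    have "DD_op A r\<^sub>N X s x \<in> L\<^sub>N x" for x
    proof -
      have "DD_op A r\<^sub>N X s x \<in> gtangent_space A x"
        using N.vfields_onD(1)[OF Y UNIV_I] N.oneforms_onD(1)[OF \<alpha> UNIV_I]
        by (simp add: gtangent_space_def mem_Times_iff)
      moreover have "L\<^sub>N x = {a \<in> gtangent_space A x. \<forall>b\<in>L\<^sub>N x. pairing a b = 0}"
        using LN unfolding dirac_structure_def by blast
      ultimately show ?thesis
        using DD_op_orthogonal[OF LM LN bw cm r rel X s] by blast
    qed
    then show ?thesis using Y \<alpha> by (simp add: sections_on_def)
  qed
  ultimately show ?thesis unfolding compatible_def by blast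
qed

end

theorem proposition4p1:
  fixes A\<^sub>N :: "('a::{t2_space, second_countable_topology}, 'd::real_inner) chart set"
    and A\<^sub>M :: "('b::{t2_space, second_countable_topology}, 'e::real_inner) chart set"
    and L\<^sub>N :: "'a \<Rightarrow> ('a, 'd) gvector set"
    and L\<^sub>M :: "'b \<Rightarrow> ('b, 'e) gvector set"
    and r\<^sub>N :: "('a, 'd) tensor11"
    and r\<^sub>M :: "('b, 'e) tensor11"
    and \<psi> :: "'a \<Rightarrow> 'b"
  assumes "smooth_atlas A\<^sub>N" and "smooth_atlas A\<^sub>M"
    and "dirac_structure A\<^sub>N L\<^sub>N" and "dirac_structure A\<^sub>M L\<^sub>M"
    and "backward_dirac_map A\<^sub>N L\<^sub>N A\<^sub>M L\<^sub>M \<psi>"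
    and "r\<^sub>N \<in> vector_valued_oneforms A\<^sub>N" and "r\<^sub>M \<in> vector_valued_oneforms A\<^sub>M"
    and "related_by A\<^sub>N A\<^sub>M \<psi> r\<^sub>N r\<^sub>M"
    and "compatible A\<^sub>M L\<^sub>M r\<^sub>M"
  shows "compatible A\<^sub>N L\<^sub>N r\<^sub>N"
proof -
  interpret manifold_map A\<^sub>N A\<^sub>M \<psi>
    using assms(1,2,5) by unfold_locales (auto simp: backward_dirac_map_def)
  show ?thesis by (rule backward_dirac_map_compatible[OF assms(3-9)])
qed

end
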